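(* Let $\alpha'>0$ be a constant and let $M$ be a compact connected $6$-dimensional Riemannian spin manifold with metric $g$, a 3-form $H$, a smooth function $\phi$ (the dilaton), a nowhere vanishing chiral spinor field $\epsilon$, and a vector bundle $E$ with connection $A$ with curvature $F^A$. Suppose that the heterotic supersymmetry (Killing spinor) equations $$\nabla^+\epsilon=0,\qquad \left(d\phi-\tfrac12 H\right)\cdot\epsilon=0,\qquad F^A\cdot\epsilon=0$$ hold, and that the anomaly cancellation condition taken with respect to the $(-)$-connection $\nabla^-$ (with curvature $R^-$), $$dH=\frac{\alpha'}{4}\Big(\mathrm{Tr}(R^-\wedge R^-)-\mathrm{Tr}(F^A\wedge F^A)\Big),$$ holds. Then the heterotic equations of motion (with $R=R^-$) $$\mathrm{Ric}^g_{ij}-\tfrac14 H_{imn}H_j{}^{mn}+2\nabla^g_i\nabla^g_j\phi-\tfrac{\alpha'}{4}\Big[(F^A)_{imns}(F^A)_j{}^{mns}-R^-_{imns}(R^-)_j{}^{mns}\Big]=0,$$ $$\nabla^g_i\big(e^{-2\phi}H^i{}_{jk}\big)=0,\qquad \nabla^+_i\big(e^{-2\phi}(F^A)^i{}_j\big)=0$$ are satisfied if and only if $H=0$, i.e. the solution is a Calabi-Yau manifold ($\nabla^g\epsilon=0$).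
   Context: Conventions. Indices refer to a local orthonormal frame $e_1,\dots,e_6$ and repeated indices are summed. A $p$-form is written $\beta=\frac1{p!}\beta_{i_1\dots i_p}e_{i_1}\wedge\dots\wedge e_{i_p}$. $\nabla^g$ is the Levi-Civita connection and $\mathrm{Ric}^g$ its Ricci tensor (positive on round spheres). $\nabla^{\pm}=\nabla^g\pm\frac12H$ are the metric connections with totally skew-symmetric torsion $\pm H$, i.e. $g(\nabla^\pm_XY,Z)=g(\nabla^g_XY,Z)\pm\frac12H(X,Y,Z)$. The same symbol $\nabla^+$ denotes the induced connection on the spinor bundle, and on $F^A$ the covariant derivative $\nabla^+$ is coupled to the connection $A$ on $E$. Spinors. The dot denotes Clifford multiplication of forms on spinors, with Clifford generators satisfying $\Gamma^m\Gamma^n+\Gamma^n\Gamma^m=2\delta^{mn}$; thus $d\phi\cdot\epsilon=\partial_m\phi\,\Gamma^m\epsilon$, $H\cdot\epsilon=\frac16H_{mnp}\Gamma^{mnp}\epsilon$, and $F^A\cdot\epsilon=0$ means $F^A_{mn}\Gamma^{mn}\epsilon=0$ (for each endomorphism component). The stabilizer of a nonzero chiral spinor in $Spin(6)$ is $SU(3)$. Curvatures. $E$ is a real vector bundle with a fibre metric and $A$ is a metric connection on it. In $(F^A)_{imns}$ and $R^-_{imns}$ the first two indices are the 2-form indices and the last two are the endomorphism indices (with respect to an orthonormal frame of $E$, respectively of $TM$): $R^-_{ijkl}=g(R^-(e_i,e_j)e_k,e_l)$ with $R^-(X,Y)=[\nabla^-_X,\nabla^-_Y]-\nabla^-_{[X,Y]}$.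 For a curvature $R$ the 4-form $\mathrm{Tr}(R\wedge R)$ is defined by $$\mathrm{Tr}(R\wedge R)_{ijkl}=2\big(R_{ijab}R_{klab}+R_{jkab}R_{ilab}+R_{kiab}R_{jlab}\big),$$ and $\mathrm{Tr}(F^A\wedge F^A)$ is defined by the same formula with $F^A$ in place of $R$. *)

theory Defs
  imports "HOL-Analysis.Analysis"
begin

text \<open>
  A 6-manifold is given by an atlas, indexed by a type. All bundles are given by trivialisations
  over the charts of this atlas together with their transition functions (charts can always be
  shrunk so that they trivialise every bundle involved). A tensor at a point \<open>x\<close> of the chart
  domain \<open>patch M a\<close> is a multilinear function of tangent vectors, and a tangent vector is
  represented by its components in the coordinates of the chart \<open>a\<close>, an element of
  \<^typ>\<open>real^6\<close>.
\<close>

section \<open>Smooth functions\<close>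

primrec Ck_on :: "nat \<Rightarrow> 'a::real_normed_vector set \<Rightarrow> ('a \<Rightarrow> 'b::real_normed_vector) \<Rightarrow> bool" where
  "Ck_on 0 S f \<longleftrightarrow> continuous_on S f"
| "Ck_on (Suc k) S f \<longleftrightarrow>
     (\<forall>x\<in>S. f differentiable (at x)) \<and> (\<forall>v. Ck_on k S (\<lambda>x. frechet_derivative f (at x) v))"

text \<open>Only meaningful for open \<open>S\<close>.\<close>

definition smooth_on :: "'a::real_normed_vector set \<Rightarrow> ('a \<Rightarrow> 'b::real_normed_vector) \<Rightarrow> bool" where
  "smooth_on S f \<longleftrightarrow> (\<forall>k. Ck_on k S f)"


section \<open>Riemannian spin 6-manifolds\<close>

text \<open>
  \<open>gmet M a x u v\<close> is the metric, \<open>frame M a i\<close> (\<open>i :: 6\<close>) the \<open>i\<close>-th vector field of a local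
  orthonormal frame on \<open>patch M a\<close>, and \<open>spin_lift M a b x\<close> the transition function of the spin
  structure, which lifts the change from the frame of \<open>b\<close> to the frame of \<open>a\<close>.
\<close>

record ('i, 'm) spin_mfd =
  patch :: "'i \<Rightarrow> 'm set"
  coord :: "'i \<Rightarrow> 'm \<Rightarrow> real^6"
  gmet :: "'i \<Rightarrow> 'm \<Rightarrow> real^6 \<Rightarrow> real^6 \<Rightarrow> real"
  frame :: "'i \<Rightarrow> 6 \<Rightarrow> 'm \<Rightarrow> real^6"
  spin_lift :: "'i \<Rightarrow> 'i \<Rightarrow> 'm \<Rightarrow> complex^8^8"

definition in_coord :: "('i, 'm) spin_mfd \<Rightarrow> 'i \<Rightarrow> ('m \<Rightarrow> 'b) \<Rightarrow> real^6 \<Rightarrow> 'b" where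
  "in_coord M a f = f \<circ> inv_into (patch M a) (coord M a)"

definition smooth_in ::
  "('i, 'm) spin_mfd \<Rightarrow> 'i \<Rightarrow> 'm set \<Rightarrow> ('m \<Rightarrow> 'b::real_normed_vector) \<Rightarrow> bool" where
  "smooth_in M a V f \<longleftrightarrow> smooth_on (coord M a ` V) (in_coord M a f)"

text \<open>The derivative \<open>X f\<close> of a function along a vector field.\<close>

definition vd :: "('i, 'm) spin_mfd \<Rightarrow> 'i \<Rightarrow> ('m \<Rightarrow> real^6) \<Rightarrow> ('m \<Rightarrow> 'b::real_normed_vector) \<Rightarrow> 'm \<Rightarrow> 'b" where
  "vd M a X f x = frechet_derivative (in_coord M a f) (at (coord M a x)) (X x)"

text \<open>Change of the components of a tangent vector from the chart \<open>a\<close> to the chart \<open>b\<close>.\<close>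

definition jac :: "('i, 'm) spin_mfd \<Rightarrow> 'i \<Rightarrow> 'i \<Rightarrow> 'm \<Rightarrow> real^6 \<Rightarrow> real^6" where
  "jac M a b x v = vd M a (\<lambda>_. v) (coord M b) x"

definition smooth_atlas :: "('i, 'm::topological_space) spin_mfd \<Rightarrow> bool" where
  "smooth_atlas M \<longleftrightarrow>
     (\<Union>a. patch M a) = UNIV \<and>
     (\<forall>a. open (patch M a) \<and> open (coord M a ` patch M a) \<and>
          homeomorphism (patch M a) (coord M a ` patch M a)
            (coord M a) (inv_into (patch M a) (coord M a))) \<and>
     (\<forall>a b. smooth_in M a (patch M a \<inter> patch M b) (coord M b))"

definition smooth_function :: "('i, 'm) spin_mfd \<Rightarrow> ('m \<Rightarrow> real) \<Rightarrow> bool" where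
  "smooth_function M f \<longleftrightarrow> (\<forall>a. smooth_in M a (patch M a) f)"

definition riemannian_metric :: "('i, 'm) spin_mfd \<Rightarrow> bool" where
  "riemannian_metric M \<longleftrightarrow>
     (\<forall>a. \<forall>x\<in>patch M a.
        bilinear (gmet M a x) \<and>
        (\<forall>u v. gmet M a x u v = gmet M a x v u) \<and>
        (\<forall>u. u \<noteq> 0 \<longrightarrow> gmet M a x u u > 0)) \<and>
     (\<forall>a u v. smooth_in M a (patch M a) (\<lambda>x. gmet M a x u v)) \<and>
     (\<forall>a b. \<forall>x\<in>patch M a \<inter> patch M b. \<forall>u v.
        gmet M b x (jac M a b x u) (jac M a b x v) = gmet M a x u v)"

definition orthonormal_frames :: "('i, 'm) spin_mfd \<Rightarrow> bool" where
  "orthonormal_frames M \<longleftrightarrow>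
     (\<forall>a i. smooth_in M a (patch M a) (frame M a i)) \<and>
     (\<forall>a i j. \<forall>x\<in>patch M a. gmet M a x (frame M a i x) (frame M a j x) = (if i = j then 1 else 0))"

text \<open>Clifford generators; every such system on \<^typ>\<open>complex^8\<close> is irreducible and is unique up to
  equivalence.\<close>

definition clifford_generators :: "(6 \<Rightarrow> complex^8^8) \<Rightarrow> bool" where
  "clifford_generators \<Gamma> \<longleftrightarrow>
     (\<forall>m n. \<Gamma> m ** \<Gamma> n + \<Gamma> n ** \<Gamma> m = (if m = n then 2 *\<^sub>R mat 1 else 0))"

definition cliff :: "(6 \<Rightarrow> complex^8^8) \<Rightarrow> real^6 \<Rightarrow> complex^8^8" where
  "cliff \<Gamma> v = (\<Sum>i\<in>UNIV. (v $ i) *\<^sub>R \<Gamma> i)"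

text \<open>\<open>Spin(6)\<close>: the products of an even number of unit vectors in the Clifford algebra.\<close>

inductive_set spin_group :: "(6 \<Rightarrow> complex^8^8) \<Rightarrow> (complex^8^8) set" for \<Gamma> where
  one: "mat 1 \<in> spin_group \<Gamma>"
| step: "s \<in> spin_group \<Gamma> \<Longrightarrow> norm u = 1 \<Longrightarrow> norm v = 1 \<Longrightarrow> s ** cliff \<Gamma> u ** cliff \<Gamma> v \<in> spin_group \<Gamma>"

text \<open>
  The last condition says that \<open>s = spin_lift M a b x\<close> covers the change of frame \<open>h\<close> given by
  \<open>e\<^sup>b\<^sub>j = \<Sum>\<^sub>i h\<^sub>i\<^sub>j e\<^sup>a\<^sub>i\<close>, that is \<open>s \<Gamma>\<^sub>j s\<^sup>-\<^sup>1 = \<Sum>\<^sub>i h\<^sub>i\<^sub>j \<Gamma>\<^sub>i\<close>. In particular \<open>h\<close> takes values in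
  \<open>SO(6)\<close>, so the frames define an orientation.
\<close>

definition spin_structure :: "(6 \<Rightarrow> complex^8^8) \<Rightarrow> ('i, 'm) spin_mfd \<Rightarrow> bool" where
  "spin_structure \<Gamma> M \<longleftrightarrow>
     (\<forall>a b. smooth_in M a (patch M a \<inter> patch M b) (spin_lift M a b)) \<and>
     (\<forall>a b. \<forall>x\<in>patch M a \<inter> patch M b. spin_lift M a b x \<in> spin_group \<Gamma>) \<and>
     (\<forall>a b c. \<forall>x\<in>patch M a \<inter> patch M b \<inter> patch M c.
        spin_lift M a b x ** spin_lift M b c x = spin_lift M a c x) \<and>
     (\<forall>a b. \<forall>x\<in>patch M a \<inter> patch M b. \<forall>j.
        spin_lift M a b x ** \<Gamma> j =
        cliff \<Gamma> (\<chi> i. gmet M a x (jac M b a x (frame M b j x)) (frame M a i x)) ** spin_lift M a b x)"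

definition riemannian_spin_manifold ::
  "(6 \<Rightarrow> complex^8^8) \<Rightarrow> ('i, 'm::topological_space) spin_mfd \<Rightarrow> bool" where
  "riemannian_spin_manifold \<Gamma> M \<longleftrightarrow>
     smooth_atlas M \<and> riemannian_metric M \<and> orthonormal_frames M \<and> spin_structure \<Gamma> M"


section \<open>Differential forms\<close>

type_synonym ('i, 'm) form3 = "'i \<Rightarrow> 'm \<Rightarrow> real^6 \<Rightarrow> real^6 \<Rightarrow> real^6 \<Rightarrow> real"

definition three_form :: "('i, 'm) spin_mfd \<Rightarrow> ('i, 'm) form3 \<Rightarrow> bool" where
  "three_form M H \<longleftrightarrow>
     (\<forall>a. \<forall>x\<in>patch M a.
        (\<forall>v w. linear (\<lambda>u. H a x u v w)) \<and>
        (\<forall>u v w. H a x v u w = - H a x u v w \<and> H a x u w v = - H a x u v w)) \<and>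
     (\<forall>a u v w. smooth_in M a (patch M a) (\<lambda>x. H a x u v w)) \<and>
     (\<forall>a b. \<forall>x\<in>patch M a \<inter> patch M b. \<forall>u v w.
        H b x (jac M a b x u) (jac M a b x v) (jac M a b x w) = H a x u v w)"

definition H_comp :: "('i, 'm) spin_mfd \<Rightarrow> ('i, 'm) form3 \<Rightarrow> 'i \<Rightarrow> 'm \<Rightarrow> 6 \<Rightarrow> 6 \<Rightarrow> 6 \<Rightarrow> real" where
  "H_comp M H a x i j k = H a x (frame M a i x) (frame M a j x) (frame M a k x)"

text \<open>Vectors are extended to vector fields with constant, hence commuting, coordinate components.\<close>

definition ext_deriv ::
  "('i, 'm) spin_mfd \<Rightarrow> ('i, 'm) form3 \<Rightarrow> 'i \<Rightarrow> 'm \<Rightarrow> real^6 \<Rightarrow> real^6 \<Rightarrow> real^6 \<Rightarrow> real^6 \<Rightarrow> real" where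
  "ext_deriv M H a x t u v w =
       vd M a (\<lambda>_. t) (\<lambda>y. H a y u v w) x - vd M a (\<lambda>_. u) (\<lambda>y. H a y t v w) x
     + vd M a (\<lambda>_. v) (\<lambda>y. H a y t u w) x - vd M a (\<lambda>_. w) (\<lambda>y. H a y t u v) x"

definition dH_comp :: "('i, 'm) spin_mfd \<Rightarrow> ('i, 'm) form3 \<Rightarrow> 'i \<Rightarrow> 'm \<Rightarrow> 6 \<Rightarrow> 6 \<Rightarrow> 6 \<Rightarrow> 6 \<Rightarrow> real" where
  "dH_comp M H a x i j k l =
     ext_deriv M H a x (frame M a i x) (frame M a j x) (frame M a k x) (frame M a l x)"


section \<open>Connections and curvature on the tangent bundle\<close>

text \<open>Christoffel symbols of the first kind; the third index is raised in \<open>nabla_g\<close> by means of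
  the orthonormal frame.\<close>

definition christoffel :: "('i, 'm) spin_mfd \<Rightarrow> 'i \<Rightarrow> 'm \<Rightarrow> real^6 \<Rightarrow> real^6 \<Rightarrow> real^6 \<Rightarrow> real" where
  "christoffel M a x u v w =
     (vd M a (\<lambda>_. u) (\<lambda>y. gmet M a y v w) x + vd M a (\<lambda>_. v) (\<lambda>y. gmet M a y u w) x
      - vd M a (\<lambda>_. w) (\<lambda>y. gmet M a y u v) x) / 2"

definition nabla_g ::
  "('i, 'm) spin_mfd \<Rightarrow> 'i \<Rightarrow> ('m \<Rightarrow> real^6) \<Rightarrow> ('m \<Rightarrow> real^6) \<Rightarrow> 'm \<Rightarrow> real^6" where
  "nabla_g M a X Y x =
     vd M a X Y x + (\<Sum>k\<in>UNIV. christoffel M a x (X x) (Y x) (frame M a k x) *\<^sub>R frame M a k x)"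

text \<open>The connection with \<open>g(\<nabla>\<^sub>X Y, Z) = g(\<nabla>\<^sup>g\<^sub>X Y, Z) + (c/2) H(X, Y, Z)\<close>: the connections
  \<open>\<nabla>\<^sup>g\<close>, \<open>\<nabla>\<^sup>+\<close>, \<open>\<nabla>\<^sup>-\<close> are obtained for \<open>c = 0, 1, -1\<close>.\<close>

definition nabla ::
  "('i, 'm) spin_mfd \<Rightarrow> ('i, 'm) form3 \<Rightarrow> real \<Rightarrow>
   'i \<Rightarrow> ('m \<Rightarrow> real^6) \<Rightarrow> ('m \<Rightarrow> real^6) \<Rightarrow> 'm \<Rightarrow> real^6" where
  "nabla M H c a X Y x =
     nabla_g M a X Y x + (\<Sum>k\<in>UNIV. (c / 2 * H a x (X x) (Y x) (frame M a k x)) *\<^sub>R frame M a k x)"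

definition bracket ::
  "('i, 'm) spin_mfd \<Rightarrow> 'i \<Rightarrow> ('m \<Rightarrow> real^6) \<Rightarrow> ('m \<Rightarrow> real^6) \<Rightarrow> 'm \<Rightarrow> real^6" where
  "bracket M a X Y x = vd M a X Y x - vd M a Y X x"

definition curvature ::
  "('i, 'm) spin_mfd \<Rightarrow> 'i \<Rightarrow> (('m \<Rightarrow> real^6) \<Rightarrow> ('m \<Rightarrow> real^6) \<Rightarrow> 'm \<Rightarrow> real^6) \<Rightarrow>
   ('m \<Rightarrow> real^6) \<Rightarrow> ('m \<Rightarrow> real^6) \<Rightarrow> ('m \<Rightarrow> real^6) \<Rightarrow> 'm \<Rightarrow> real^6" where
  "curvature M a D X Y Z x = D X (D Y Z) x - D Y (D X Z) x - D (bracket M a X Y) Z x"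

definition R_comp ::
  "('i, 'm) spin_mfd \<Rightarrow> ('i, 'm) form3 \<Rightarrow> real \<Rightarrow> 'i \<Rightarrow> 'm \<Rightarrow> 6 \<Rightarrow> 6 \<Rightarrow> 6 \<Rightarrow> 6 \<Rightarrow> real" where
  "R_comp M H c a x i j k l =
     gmet M a x (curvature M a (nabla M H c a) (frame M a i) (frame M a j) (frame M a k) x)
       (frame M a l x)"

abbreviation R_minus ::
  "('i, 'm) spin_mfd \<Rightarrow> ('i, 'm) form3 \<Rightarrow> 'i \<Rightarrow> 'm \<Rightarrow> 6 \<Rightarrow> 6 \<Rightarrow> 6 \<Rightarrow> 6 \<Rightarrow> real" where
  "R_minus M H \<equiv> R_comp M H (-1)"

definition Ric_g :: "('i, 'm) spin_mfd \<Rightarrow> 'i \<Rightarrow> 'm \<Rightarrow> 6 \<Rightarrow> 6 \<Rightarrow> real" where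
  "Ric_g M a x i j =
     (\<Sum>k\<in>UNIV. gmet M a x (curvature M a (nabla_g M a) (frame M a k) (frame M a i) (frame M a j) x)
                 (frame M a k x))"

text \<open>\<open>\<nabla>\<^sup>g\<^sub>i \<nabla>\<^sup>g\<^sub>j \<phi>\<close>\<close>

definition hess :: "('i, 'm) spin_mfd \<Rightarrow> ('m \<Rightarrow> real) \<Rightarrow> 'i \<Rightarrow> 'm \<Rightarrow> 6 \<Rightarrow> 6 \<Rightarrow> real" where
  "hess M \<phi> a x i j =
     vd M a (frame M a i) (vd M a (frame M a j) \<phi>) x
     - vd M a (nabla_g M a (frame M a i) (frame M a j)) \<phi> x"


section \<open>Spinors\<close>

text \<open>A section of the bundle associated to the spin structure and the spinor representation
  \<^typ>\<open>complex^8\<close>.\<close>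

definition spinor_field :: "('i, 'm) spin_mfd \<Rightarrow> ('i \<Rightarrow> 'm \<Rightarrow> complex^8) \<Rightarrow> bool" where
  "spinor_field M \<epsilon> \<longleftrightarrow>
     (\<forall>a. smooth_in M a (patch M a) (\<epsilon> a)) \<and>
     (\<forall>a b. \<forall>x\<in>patch M a \<inter> patch M b. \<epsilon> a x = spin_lift M a b x *v \<epsilon> b x)"

text \<open>The square of the product of all six generators is \<open>-1\<close>; its two eigenspaces are the
  spaces of spinors of positive and of negative chirality.\<close>

definition chiral :: "(6 \<Rightarrow> complex^8^8) \<Rightarrow> ('i, 'm) spin_mfd \<Rightarrow> ('i \<Rightarrow> 'm \<Rightarrow> complex^8) \<Rightarrow> bool" where
  "chiral \<Gamma> M \<epsilon> \<longleftrightarrow>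
     (\<exists>c\<in>{\<i>, - \<i>}. \<forall>a. \<forall>x\<in>patch M a.
        (\<Gamma> 1 ** \<Gamma> 2 ** \<Gamma> 3 ** \<Gamma> 4 ** \<Gamma> 5 ** \<Gamma> 6) *v \<epsilon> a x = c *s \<epsilon> a x)"

definition nowhere_vanishing :: "('i, 'm) spin_mfd \<Rightarrow> ('i \<Rightarrow> 'm \<Rightarrow> complex^8) \<Rightarrow> bool" where
  "nowhere_vanishing M \<epsilon> \<longleftrightarrow> (\<forall>a. \<forall>x\<in>patch M a. \<epsilon> a x \<noteq> 0)"

text \<open>
  The connection induced by \<open>nabla M H c\<close> on spinors,
  \<open>\<nabla>\<^sub>X \<epsilon> = X \<epsilon> + 1/4 \<Sum>\<^sub>j\<^sub>k g(\<nabla>\<^sub>X e\<^sub>k, e\<^sub>j) \<Gamma>\<^sup>j \<Gamma>\<^sup>k \<epsilon>\<close>. For generators with square \<open>+1\<close> this is the sign for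
  which Clifford multiplication is parallel: \<open>\<nabla>\<^sub>X (v \<cdot> \<epsilon>) = (\<nabla>\<^sub>X v) \<cdot> \<epsilon> + v \<cdot> \<nabla>\<^sub>X \<epsilon>\<close>.
\<close>

definition nabla_spin ::
  "(6 \<Rightarrow> complex^8^8) \<Rightarrow> ('i, 'm) spin_mfd \<Rightarrow> ('i, 'm) form3 \<Rightarrow> real \<Rightarrow>
   'i \<Rightarrow> ('m \<Rightarrow> real^6) \<Rightarrow> ('i \<Rightarrow> 'm \<Rightarrow> complex^8) \<Rightarrow> 'm \<Rightarrow> complex^8" where
  "nabla_spin \<Gamma> M H c a X \<epsilon> x =
     vd M a X (\<epsilon> a) x +
     (1/4) *\<^sub>R (\<Sum>j\<in>UNIV. \<Sum>k\<in>UNIV.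
       gmet M a x (nabla M H c a X (frame M a k) x) (frame M a j x) *\<^sub>R ((\<Gamma> j ** \<Gamma> k) *v \<epsilon> a x))"

definition parallel_spinor ::
  "(6 \<Rightarrow> complex^8^8) \<Rightarrow> ('i, 'm) spin_mfd \<Rightarrow> ('i, 'm) form3 \<Rightarrow> real \<Rightarrow> ('i \<Rightarrow> 'm \<Rightarrow> complex^8) \<Rightarrow> bool" where
  "parallel_spinor \<Gamma> M H c \<epsilon> \<longleftrightarrow> (\<forall>a. \<forall>x\<in>patch M a. \<forall>i. nabla_spin \<Gamma> M H c a (frame M a i) \<epsilon> x = 0)"

text \<open>Products of generators contracted with antisymmetric components may replace the
  antisymmetrised products \<open>\<Gamma>\<^sup>m\<^sup>n\<^sup>p\<close> and \<open>\<Gamma>\<^sup>m\<^sup>n\<close>, here and in \<open>gaugino_eq\<close>.\<close>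

definition dilatino_eq ::
  "(6 \<Rightarrow> complex^8^8) \<Rightarrow> ('i, 'm) spin_mfd \<Rightarrow> ('i, 'm) form3 \<Rightarrow> ('m \<Rightarrow> real) \<Rightarrow>
   ('i \<Rightarrow> 'm \<Rightarrow> complex^8) \<Rightarrow> bool" where
  "dilatino_eq \<Gamma> M H \<phi> \<epsilon> \<longleftrightarrow>
     (\<forall>a. \<forall>x\<in>patch M a.
        (\<Sum>m\<in>UNIV. vd M a (frame M a m) \<phi> x *\<^sub>R (\<Gamma> m *v \<epsilon> a x))
        - (1/2) *\<^sub>R ((1/6) *\<^sub>R (\<Sum>m\<in>UNIV. \<Sum>n\<in>UNIV. \<Sum>p\<in>UNIV.
             H_comp M H a x m n p *\<^sub>R ((\<Gamma> m ** \<Gamma> n ** \<Gamma> p) *v \<epsilon> a x))) = 0)"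


section \<open>The gauge bundle\<close>

text \<open>
  A real vector bundle of rank \<open>CARD('r)\<close> with a fibre metric and a metric connection, in local
  orthonormal frames: sections transform by \<open>\<sigma>\<^sub>a = t\<^sub>a\<^sub>b \<sigma>\<^sub>b\<close> with \<open>t\<^sub>a\<^sub>b = gauge_tr E a b\<close>, and
  \<open>\<nabla>\<^sup>A\<^sub>u \<sigma> = u \<sigma> + A(u) \<sigma>\<close> with \<open>A(u) = gauge_pot E a x u\<close>.
\<close>

record ('i, 'm, 'r) metric_bundle =
  gauge_tr :: "'i \<Rightarrow> 'i \<Rightarrow> 'm \<Rightarrow> real^'r^'r"
  gauge_pot :: "'i \<Rightarrow> 'm \<Rightarrow> real^6 \<Rightarrow> real^'r^'r"

definition bundle_with_connection ::
  "('i, 'm) spin_mfd \<Rightarrow> ('i, 'm, 'r::finite) metric_bundle \<Rightarrow> bool" where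
  "bundle_with_connection M E \<longleftrightarrow>
     (\<forall>a b. smooth_in M a (patch M a \<inter> patch M b) (gauge_tr E a b)) \<and>
     (\<forall>a b. \<forall>x\<in>patch M a \<inter> patch M b. orthogonal_matrix (gauge_tr E a b x)) \<and>
     (\<forall>a b c. \<forall>x\<in>patch M a \<inter> patch M b \<inter> patch M c.
        gauge_tr E a b x ** gauge_tr E b c x = gauge_tr E a c x) \<and>
     (\<forall>a. \<forall>x\<in>patch M a.
        linear (gauge_pot E a x) \<and>
        (\<forall>u. transpose (gauge_pot E a x u) = - gauge_pot E a x u)) \<and>
     (\<forall>a u. smooth_in M a (patch M a) (\<lambda>x. gauge_pot E a x u)) \<and>
     (\<forall>a b. \<forall>x\<in>patch M a \<inter> patch M b. \<forall>u.
        gauge_pot E b x (jac M a b x u) =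
        transpose (gauge_tr E a b x) **
          (gauge_pot E a x u ** gauge_tr E a b x + vd M a (\<lambda>_. u) (gauge_tr E a b) x))"

definition gauge_curv ::
  "('i, 'm) spin_mfd \<Rightarrow> ('i, 'm, 'r::finite) metric_bundle \<Rightarrow>
   'i \<Rightarrow> 'm \<Rightarrow> real^6 \<Rightarrow> real^6 \<Rightarrow> real^'r^'r" where
  "gauge_curv M E a x u v =
     vd M a (\<lambda>_. u) (\<lambda>y. gauge_pot E a y v) x - vd M a (\<lambda>_. v) (\<lambda>y. gauge_pot E a y u) x
     + gauge_pot E a x u ** gauge_pot E a x v - gauge_pot E a x v ** gauge_pot E a x u"

text \<open>As for \<open>R_comp\<close>, \<open>F\<^sub>i\<^sub>j\<^sub>s\<^sub>t = \<langle>F(e\<^sub>i, e\<^sub>j) u\<^sub>s, u\<^sub>t\<rangle>\<close>.\<close>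

definition F_comp ::
  "('i, 'm) spin_mfd \<Rightarrow> ('i, 'm, 'r::finite) metric_bundle \<Rightarrow>
   'i \<Rightarrow> 'm \<Rightarrow> 6 \<Rightarrow> 6 \<Rightarrow> 'r \<Rightarrow> 'r \<Rightarrow> real" where
  "F_comp M E a x i j s t = gauge_curv M E a x (frame M a i x) (frame M a j x) $ t $ s"

definition gaugino_eq ::
  "(6 \<Rightarrow> complex^8^8) \<Rightarrow> ('i, 'm) spin_mfd \<Rightarrow> ('i, 'm, 'r::finite) metric_bundle \<Rightarrow>
   ('i \<Rightarrow> 'm \<Rightarrow> complex^8) \<Rightarrow> bool" where
  "gaugino_eq \<Gamma> M E \<epsilon> \<longleftrightarrow>
     (\<forall>a. \<forall>x\<in>patch M a. \<forall>s t.
        (\<Sum>m\<in>UNIV. \<Sum>n\<in>UNIV. F_comp M E a x m n s t *\<^sub>R ((\<Gamma> m ** \<Gamma> n) *v \<epsilon> a x)) = 0)"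


section \<open>Anomaly cancellation and equations of motion\<close>

definition Tr_wedge :: "(6 \<Rightarrow> 6 \<Rightarrow> 'n::finite \<Rightarrow> 'n \<Rightarrow> real) \<Rightarrow> 6 \<Rightarrow> 6 \<Rightarrow> 6 \<Rightarrow> 6 \<Rightarrow> real" where
  "Tr_wedge R i j k l =
     2 * (\<Sum>a\<in>UNIV. \<Sum>b\<in>UNIV. R i j a b * R k l a b + R j k a b * R i l a b + R k i a b * R j l a b)"

definition anomaly_cancellation ::
  "real \<Rightarrow> ('i, 'm) spin_mfd \<Rightarrow> ('i, 'm) form3 \<Rightarrow> ('i, 'm, 'r::finite) metric_bundle \<Rightarrow> bool" where
  "anomaly_cancellation \<alpha>' M H E \<longleftrightarrow>
     (\<forall>a. \<forall>x\<in>patch M a. \<forall>i j k l.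
        dH_comp M H a x i j k l =
        \<alpha>' / 4 * (Tr_wedge (R_minus M H a x) i j k l - Tr_wedge (F_comp M E a x) i j k l))"

definition einstein_eq ::
  "real \<Rightarrow> ('i, 'm) spin_mfd \<Rightarrow> ('i, 'm) form3 \<Rightarrow> ('m \<Rightarrow> real) \<Rightarrow>
   ('i, 'm, 'r::finite) metric_bundle \<Rightarrow> bool" where
  "einstein_eq \<alpha>' M H \<phi> E \<longleftrightarrow>
     (\<forall>a. \<forall>x\<in>patch M a. \<forall>i j.
        Ric_g M a x i j
        - 1/4 * (\<Sum>m\<in>UNIV. \<Sum>n\<in>UNIV. H_comp M H a x i m n * H_comp M H a x j m n)
        + 2 * hess M \<phi> a x i j
        - \<alpha>' / 4 *
          ((\<Sum>m\<in>UNIV. \<Sum>n\<in>UNIV. \<Sum>s\<in>UNIV. F_comp M E a x i m n s * F_comp M E a x j m n s)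
           - (\<Sum>m\<in>UNIV. \<Sum>n\<in>UNIV. \<Sum>s\<in>UNIV. R_minus M H a x i m n s * R_minus M H a x j m n s))
        = 0)"

definition nabla_g_form3 ::
  "('i, 'm) spin_mfd \<Rightarrow> ('i, 'm) form3 \<Rightarrow> 'i \<Rightarrow> ('m \<Rightarrow> real^6) \<Rightarrow>
   ('m \<Rightarrow> real^6) \<Rightarrow> ('m \<Rightarrow> real^6) \<Rightarrow> ('m \<Rightarrow> real^6) \<Rightarrow> 'm \<Rightarrow> real" where
  "nabla_g_form3 M B a X U V W x =
     vd M a X (\<lambda>y. B a y (U y) (V y) (W y)) x
     - B a x (nabla_g M a X U x) (V x) (W x)
     - B a x (U x) (nabla_g M a X V x) (W x)
     - B a x (U x) (V x) (nabla_g M a X W x)"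

definition H_field_eq ::
  "('i, 'm) spin_mfd \<Rightarrow> ('i, 'm) form3 \<Rightarrow> ('m \<Rightarrow> real) \<Rightarrow> bool" where
  "H_field_eq M H \<phi> \<longleftrightarrow>
     (\<forall>a. \<forall>x\<in>patch M a. \<forall>j k.
        (\<Sum>i\<in>UNIV. nabla_g_form3 M (\<lambda>b y u v w. exp (- 2 * \<phi> y) * H b y u v w) a
           (frame M a i) (frame M a i) (frame M a j) (frame M a k) x) = 0)"

text \<open>The covariant derivative of a 2-form \<open>B\<close> with values in the endomorphisms of \<open>E\<close>, by
  \<open>\<nabla>\<^sup>+\<close> coupled to \<open>A\<close>.\<close>

definition nabla_plus_A ::
  "('i, 'm) spin_mfd \<Rightarrow> ('i, 'm) form3 \<Rightarrow> ('i, 'm, 'r::finite) metric_bundle \<Rightarrow>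
   ('i \<Rightarrow> 'm \<Rightarrow> real^6 \<Rightarrow> real^6 \<Rightarrow> real^'r^'r) \<Rightarrow>
   'i \<Rightarrow> ('m \<Rightarrow> real^6) \<Rightarrow> ('m \<Rightarrow> real^6) \<Rightarrow> ('m \<Rightarrow> real^6) \<Rightarrow> 'm \<Rightarrow> real^'r^'r" where
  "nabla_plus_A M H E B a X U V x =
     vd M a X (\<lambda>y. B a y (U y) (V y)) x
     + gauge_pot E a x (X x) ** B a x (U x) (V x) - B a x (U x) (V x) ** gauge_pot E a x (X x)
     - B a x (nabla M H 1 a X U x) (V x)
     - B a x (U x) (nabla M H 1 a X V x)"

definition gauge_field_eq ::
  "('i, 'm) spin_mfd \<Rightarrow> ('i, 'm) form3 \<Rightarrow> ('m \<Rightarrow> real) \<Rightarrow> ('i, 'm, 'r::finite) metric_bundle \<Rightarrow> bool" where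
  "gauge_field_eq M H \<phi> E \<longleftrightarrow>
     (\<forall>a. \<forall>x\<in>patch M a. \<forall>j.
        (\<Sum>i\<in>UNIV. nabla_plus_A M H E (\<lambda>b y u v. exp (- 2 * \<phi> y) *\<^sub>R gauge_curv M E b y u v) a
           (frame M a i) (frame M a i) (frame M a j) x) = 0)"

definition H_vanishes :: "('i, 'm) spin_mfd \<Rightarrow> ('i, 'm) form3 \<Rightarrow> bool" where
  "H_vanishes M H \<longleftrightarrow> (\<forall>a. \<forall>x\<in>patch M a. \<forall>u v w. H a x u v w = 0)"

end

theory Submission
  imports Defs
begin

text \<open>
  Write \<open>a\<^sub>i = 1/2 H\<^sub>i\<^sub>j\<^sub>k \<Gamma>\<^sup>j \<Gamma>\<^sup>k\<close>. Differentiating \<open>\<nabla>\<^sup>+ \<epsilon> = 0\<close> gives \<open>R\<^sup>+\<^sub>i\<^sub>j\<^sub>k\<^sub>l \<Gamma>\<^sup>k \<Gamma>\<^sup>l \<epsilon> = 0\<close>; multiplying by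
  \<open>\<Gamma>\<^sup>j\<close> and using the Bianchi identity of \<open>\<nabla>\<^sup>+\<close> together with the derivative of the dilatino
  equation yields \<open>E\<^sub>i\<^sub>j \<Gamma>\<^sup>j \<epsilon> = - 1/12 dH\<^sub>i\<^sub>j\<^sub>k\<^sub>l \<Gamma>\<^sup>j \<Gamma>\<^sup>k \<Gamma>\<^sup>l \<epsilon>\<close>, where \<open>E\<close> collects the left-hand sides, without
  \<open>\<alpha>'\<close>-corrections, of the Einstein equation (symmetric part) and of the \<open>H\<close>-equation
  (antisymmetric part). Inserting the anomaly cancellation condition, the equations of motion force
  \<open>R\<^sup>-\<^sub>i\<^sub>j\<^sub>a\<^sub>b \<Gamma>\<^sup>j \<psi>\<^sub>a\<^sub>b = 0\<close> with \<open>\<psi>\<^sub>a\<^sub>b = R\<^sup>-\<^sub>k\<^sub>l\<^sub>a\<^sub>b \<Gamma>\<^sup>k \<Gamma>\<^sup>l \<epsilon>\<close>, hence \<open>\<psi> = 0\<close>: the connection \<open>\<nabla>\<^sup>-\<close> is an instanton.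
  Since \<open>R\<^sup>+\<^sub>i\<^sub>j\<^sub>k\<^sub>l - R\<^sup>-\<^sub>k\<^sub>l\<^sub>i\<^sub>j = 1/2 dH\<^sub>i\<^sub>j\<^sub>k\<^sub>l\<close>, also \<open>dH\<^sub>i\<^sub>j\<^sub>k\<^sub>l \<Gamma>\<^sup>k \<Gamma>\<^sup>l \<epsilon> = 0\<close>, and then the Dirac operator applied
  to the dilatino equation gives \<open>\<Delta>\<phi> = 2 \<bar>d\<phi>\<bar>\<^sup>2 - 1/12 H\<^sub>i\<^sub>j\<^sub>k H\<^sub>i\<^sub>j\<^sub>k\<close>. By the strong minimum principle \<open>\<phi>\<close> is
  constant, so \<open>H = 0\<close>.

  Conversely, if \<open>H = 0\<close> then \<open>d\<phi> = 0\<close> and \<open>\<nabla>\<^sup>- = \<nabla>\<^sup>+\<close> is an instanton, which gives the Einstein equation; the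
  gauge field equation follows by multiplying the derivative of \<open>F\<^sub>m\<^sub>n \<Gamma>\<^sup>m \<Gamma>\<^sup>n \<epsilon> = 0\<close> by \<open>\<Gamma>\<^sup>k\<close> and using the
  Bianchi identity of \<open>F\<close>.

  If both \<open>\<nabla>\<^sup>+ \<epsilon>\<close> and \<open>\<nabla>\<^sup>g \<epsilon>\<close> vanish, then \<open>a\<^sub>i \<epsilon> = 0\<close>, and the Clifford identity
  \<open>(1/6 H\<^sub>i\<^sub>j\<^sub>k \<Gamma>\<^sup>i \<Gamma>\<^sup>j \<Gamma>\<^sup>k)\<^sup>2 = \<Sum>\<^sub>i a\<^sub>i\<^sup>2 + 1/3 H\<^sub>i\<^sub>j\<^sub>k H\<^sub>i\<^sub>j\<^sub>k\<close> gives \<open>H = 0\<close>.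
\<close>

section \<open>Smooth functions and symmetry of second derivatives\<close>

text \<open>Derivatives look at a full neighbourhood, so agreement on an open set passes to them.
  The rules below compute a derivative only on \<open>S\<close> and transfer its smoothness along
  this lemma.\<close>

lemma Ck_on_cong:
  assumes "open S" "\<And>x. x \<in> S \<Longrightarrow> f x = g x" "Ck_on k S f"
  shows "Ck_on k S g"
  using assms(2,3)
proof (induction k arbitrary: f g)
  case 0
  then show ?case by (auto cong: continuous_on_cong)
next
  case (Suc k)
  have d: "g differentiable (at x)" "frechet_derivative g (at x) = frechet_derivative f (at x)"
    if x: "x \<in> S" for x
  proof -
    have "(f has_derivative frechet_derivative f (at x)) (at x)"
      using Suc.prems(2) x frechet_derivative_works by auto
    then have "(g has_derivative frechet_derivative f (at x)) (at x)"
      by (rule has_derivative_transform_within_open[OF _ assms(1) x]) (use Suc.prems(1) in auto)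
    then show "g differentiable (at x)" "frechet_derivative g (at x) = frechet_derivative f (at x)"
      using frechet_derivative_at differentiable_def by metis+
  qed
  show ?case
    using Suc.prems(2) d Suc.IH by auto
qed

lemma Ck_on_const: "Ck_on k S (\<lambda>x. c)"
  by (induction k arbitrary: c) auto

lemma Ck_on_Suc: "Ck_on (Suc k) S f \<Longrightarrow> Ck_on k S f"
proof (induction k arbitrary: f)
  case 0
  then show ?case
    by (auto intro!: continuous_at_imp_continuous_on differentiable_imp_continuous_within)
qed auto

lemma Ck_on_bounded_linear:
  assumes S: "open S" and h: "bounded_linear h" and f: "Ck_on k S f"
  shows "Ck_on k S (\<lambda>x. h (f x))"
  using f
proof (induction k arbitrary: f)
  case 0
  then show ?case using h by (auto intro: bounded_linear.continuous_on)
next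
  case (Suc k)
  have d: "((\<lambda>x. h (f x)) has_derivative (\<lambda>v. h (frechet_derivative f (at x) v))) (at x)"
    if x: "x \<in> S" for x
  proof -
    have "(f has_derivative frechet_derivative f (at x)) (at x)"
      using Suc.prems x frechet_derivative_works by auto
    then show ?thesis
      by (rule bounded_linear.has_derivative[OF h])
  qed
  have "Ck_on k S (\<lambda>x. frechet_derivative (\<lambda>x. h (f x)) (at x) v)" for v
  proof (rule Ck_on_cong[OF S])
    show "Ck_on k S (\<lambda>x. h (frechet_derivative f (at x) v))"
      using Suc by auto
  qed (simp add: frechet_derivative_at[OF d, symmetric])
  then show ?case
    using d by (auto simp: differentiable_def)
qed

lemma Ck_on_add:
  assumes S: "open S"
  shows "Ck_on k S f \<Longrightarrow> Ck_on k S g \<Longrightarrow> Ck_on k S (\<lambda>x. f x + g x)"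
proof (induction k arbitrary: f g)
  case (Suc k)
  have d: "((\<lambda>x. f x + g x) has_derivative
      (\<lambda>v. frechet_derivative f (at x) v + frechet_derivative g (at x) v)) (at x)"
    if x: "x \<in> S" for x
    using Suc.prems x frechet_derivative_works by (intro has_derivative_add) auto
  have "Ck_on k S (\<lambda>x. frechet_derivative (\<lambda>x. f x + g x) (at x) v)" for v
  proof (rule Ck_on_cong[OF S])
    show "Ck_on k S (\<lambda>x. frechet_derivative f (at x) v + frechet_derivative g (at x) v)"
      using Suc by auto
  qed (simp add: frechet_derivative_at[OF d, symmetric])
  then show ?case
    using d by (auto simp: differentiable_def)
qed (auto intro: continuous_intros)

text \<open>The product rule leaves one factor undifferentiated; it is one order smoother than the
  induction hypothesis asks for, which \<open>Ck_on_Suc\<close> makes usable. A general product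
  \<open>p\<close> covers scalar multiplication and matrix products alike.\<close>

lemma Ck_on_bilinear:
  assumes S: "open S" and b: "bounded_bilinear p" and f: "Ck_on k S f" and g: "Ck_on k S g"
  shows "Ck_on k S (\<lambda>x. p (f x) (g x))"
  using f g
proof (induction k arbitrary: f g)
  case 0
  then show ?case using b by (auto intro: bounded_bilinear.continuous_on)
next
  case (Suc k)
  have d: "((\<lambda>x. p (f x) (g x)) has_derivative
      (\<lambda>v. p (f x) (frechet_derivative g (at x) v) + p (frechet_derivative f (at x) v) (g x))) (at x)"
    if x: "x \<in> S" for x
    using Suc.prems x unfolding Ck_on.simps frechet_derivative_works
    by (intro bounded_bilinear.FDERIV[OF b]; simp)
  have "Ck_on k S (\<lambda>x. frechet_derivative (\<lambda>x. p (f x) (g x)) (at x) v)" for v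
  proof (rule Ck_on_cong[OF S])
    show "Ck_on k S (\<lambda>x. p (f x) (frechet_derivative g (at x) v) + p (frechet_derivative f (at x) v) (g x))"
      using Suc.prems Ck_on_Suc[OF Suc.prems(1)] Ck_on_Suc[OF Suc.prems(2)]
      by (intro Ck_on_add[OF S] Suc.IH) auto
  qed (simp add: frechet_derivative_at[OF d, symmetric])
  then show ?case
    using d by (auto simp: differentiable_def)
qed

text \<open>The second difference of \<open>f\<close> along \<open>u\<close> and \<open>v\<close> is estimated by applying the mean value
  theorem in one direction and then the other.\<close>

lemma second_difference_mvt:
  fixes f :: "'a::real_normed_vector \<Rightarrow> real"
  assumes B: "\<And>s t. 0 \<le> s \<Longrightarrow> s \<le> h \<Longrightarrow> 0 \<le> t \<Longrightarrow> t \<le> h \<Longrightarrow> x + s *\<^sub>R u + t *\<^sub>R v \<in> S"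
    and h: "h > 0"
    and f1: "\<And>y. y \<in> S \<Longrightarrow> (f has_derivative f' y) (at y)"
    and f2: "\<And>y. y \<in> S \<Longrightarrow> ((\<lambda>y. f' y u) has_derivative f'' y) (at y)"
  obtains s t where "0 \<le> s" "s \<le> h" "0 \<le> t" "t \<le> h"
    "f (x + h *\<^sub>R u + h *\<^sub>R v) - f (x + h *\<^sub>R u) - f (x + h *\<^sub>R v) + f x
       = h * (h * f'' (x + s *\<^sub>R u + t *\<^sub>R v) v)"
proof -
  define G where "G s = f (x + s *\<^sub>R u + h *\<^sub>R v) - f (x + s *\<^sub>R u + 0 *\<^sub>R v)" for s
  have dG: "(G has_derivative (\<lambda>r. r * (f' (x + s *\<^sub>R u + h *\<^sub>R v) u - f' (x + s *\<^sub>R u + 0 *\<^sub>R v) u))) (at s)"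
    if "0 \<le> s" "s \<le> h" for s
  proof -
    have l: "linear (f' (x + s *\<^sub>R u + t *\<^sub>R v))" if "0 \<le> t" "t \<le> h" for t
      using f1[OF B] that \<open>0 \<le> s\<close> \<open>s \<le> h\<close> has_derivative_linear by blast
    have "((\<lambda>s. f (x + s *\<^sub>R u + t *\<^sub>R v)) has_derivative (\<lambda>r. f' (x + s *\<^sub>R u + t *\<^sub>R v) (r *\<^sub>R u))) (at s)"
      if "0 \<le> t" "t \<le> h" for t
      by (rule has_derivative_compose[where f = "\<lambda>s. x + s *\<^sub>R u + t *\<^sub>R v" and g = f])
         (use f1[OF B] that \<open>0 \<le> s\<close> \<open>s \<le> h\<close> in \<open>auto intro!: derivative_eq_intros\<close>)
    from has_derivative_diff[OF this[of h] this[of 0]] show ?thesis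
      unfolding G_def using h l[of h] l[of 0] by (simp add: linear_scale algebra_simps)
  qed
  have "\<exists>s\<in>{0<..<h}. G h - G 0 = (h - 0) * (f' (x + s *\<^sub>R u + h *\<^sub>R v) u - f' (x + s *\<^sub>R u + 0 *\<^sub>R v) u)"
    by (rule mvt_simple[OF h has_derivative_at_withinI[OF dG]])
  then obtain s where s: "0 < s" "s < h"
    "G h - G 0 = h * (f' (x + s *\<^sub>R u + h *\<^sub>R v) u - f' (x + s *\<^sub>R u + 0 *\<^sub>R v) u)"
    by (metis diff_zero greaterThanLessThan_iff)
  define K where "K t = f' (x + s *\<^sub>R u + t *\<^sub>R v) u" for t
  have dK: "(K has_derivative (\<lambda>r. r * f'' (x + s *\<^sub>R u + t *\<^sub>R v) v)) (at t)"
    if "0 \<le> t" "t \<le> h" for t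
  proof -
    have l: "linear (f'' (x + s *\<^sub>R u + t *\<^sub>R v))"
      using f2[OF B] that s has_derivative_linear by (metis less_imp_le)
    have "((\<lambda>t. f' (x + s *\<^sub>R u + t *\<^sub>R v) u) has_derivative (\<lambda>r. f'' (x + s *\<^sub>R u + t *\<^sub>R v) (r *\<^sub>R v))) (at t)"
      by (rule has_derivative_compose[where f = "\<lambda>t. x + s *\<^sub>R u + t *\<^sub>R v" and g = "\<lambda>y. f' y u"])
         (use f2[OF B] that s in \<open>auto intro!: derivative_eq_intros\<close>)
    then show ?thesis
      unfolding K_def using l by (simp add: linear_scale)
  qed
  have "\<exists>t\<in>{0<..<h}. K h - K 0 = (h - 0) * f'' (x + s *\<^sub>R u + t *\<^sub>R v) v"
    by (rule mvt_simple[OF h has_derivative_at_withinI[OF dK]])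
  then obtain t where t: "0 < t" "t < h" "K h - K 0 = h * f'' (x + s *\<^sub>R u + t *\<^sub>R v) v"
    by (metis diff_zero greaterThanLessThan_iff)
  show thesis
    by (rule that[of s t]) (use s t in \<open>auto simp: G_def K_def\<close>)
qed

text \<open>Both mixed derivatives arise from the same second difference, which is symmetric in
  \<open>u\<close> and \<open>v\<close>. If their values at \<open>x\<close> differed, continuity
  would separate them on a whole ball, yet a small second difference is \<open>h * h\<close> times
  each of them at points of that ball.\<close>

lemma second_derivative_symmetric_real:
  fixes f :: "'a::real_normed_vector \<Rightarrow> real"
  assumes S: "open S" and x: "x \<in> S" and f: "Ck_on 2 S f"
  shows "frechet_derivative (\<lambda>y. frechet_derivative f (at y) u) (at x) v
       = frechet_derivative (\<lambda>y. frechet_derivative f (at y) v) (at x) u"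
proof (rule ccontr)
  define D where "D u v y = frechet_derivative (\<lambda>y. frechet_derivative f (at y) u) (at y) v" for u v y
  assume "\<not> ?thesis"
  then have ne: "D u v x \<noteq> D v u x" by (simp add: D_def)
  \<comment> \<open>Half the gap: two numbers, each strictly within \<open>e\<close> of its own
    value at \<open>x\<close>, cannot coincide.\<close>
  define e where "e = \<bar>D u v x - D v u x\<bar> / 2"
  have e: "e > 0" using ne by (simp add: e_def)
  have C: "continuous_on S (D u v)" for u v
    using f by (simp add: numeral_2_eq_2 D_def[abs_def])
  have f1: "(f has_derivative frechet_derivative f (at y)) (at y)" if "y \<in> S" for y
    using f that frechet_derivative_works by (auto simp: numeral_2_eq_2)
  have f2: "((\<lambda>y. frechet_derivative f (at y) u) has_derivative (\<lambda>v. D u v y)) (at y)" if "y \<in> S" for y u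
    using f that frechet_derivative_works[of "\<lambda>y. frechet_derivative f (at y) u"]
    by (auto simp: numeral_2_eq_2 D_def)
  have "\<forall>\<^sub>F y in at x. y \<in> S \<and> dist (D u v y) (D u v x) < e \<and> dist (D v u y) (D v u x) < e"
    using C[of u v] C[of v u] S x e
    by (auto intro!: eventually_conj tendstoD eventually_at_in_open'
        simp: continuous_on_eq_continuous_at[OF S] continuous_at)
  then obtain d where d: "d > 0" and
    d': "\<And>y. dist y x < d \<Longrightarrow> y \<in> S \<and> dist (D u v y) (D u v x) < e \<and> dist (D v u y) (D v u x) < e"
    using x e unfolding eventually_at by (metis dist_self UNIV_I)
  \<comment> \<open>The parallelogram with sides \<open>h *\<^sub>R u\<close> and
    \<open>h *\<^sub>R v\<close> stays within \<open>d / 2\<close> of \<open>x\<close>; the summand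
    1 keeps the denominator positive when both vectors vanish.\<close>
  define h where "h = d / (1 + norm u + norm v) / 2"
  have p: "1 + norm u + norm v > 0" by (smt (verit) norm_ge_zero)
  have h: "h > 0" using d p by (simp add: h_def)
  have near: "dist (x + s *\<^sub>R u + t *\<^sub>R v) x < d" if "0 \<le> s" "s \<le> h" "0 \<le> t" "t \<le> h" for s t
  proof -
    have "dist (x + s *\<^sub>R u + t *\<^sub>R v) x \<le> s * norm u + t * norm v"
      using that norm_triangle_ineq[of "s *\<^sub>R u" "t *\<^sub>R v"] by (simp add: dist_norm)
    also have "\<dots> \<le> h * norm u + h * norm v"
      using that by (intro add_mono mult_right_mono) auto
    also have "\<dots> \<le> h * (1 + norm u + norm v)"
      using h by (simp add: algebra_simps)
    also have "\<dots> = d / 2" using p by (simp only: h_def) (simp add: field_simps)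
    also have "\<dots> < d" using d by simp
    finally show ?thesis .
  qed
  have near': "x + s *\<^sub>R v + t *\<^sub>R u \<in> S" if "0 \<le> s" "s \<le> h" "0 \<le> t" "t \<le> h" for s t
  proof -
    have "x + s *\<^sub>R v + t *\<^sub>R u = x + t *\<^sub>R u + s *\<^sub>R v" by simp
    then show ?thesis using d' near that by metis
  qed
  obtain s t where st: "0 \<le> s" "s \<le> h" "0 \<le> t" "t \<le> h"
    "f (x + h *\<^sub>R u + h *\<^sub>R v) - f (x + h *\<^sub>R u) - f (x + h *\<^sub>R v) + f x
       = h * (h * D u v (x + s *\<^sub>R u + t *\<^sub>R v))"
    by (rule second_difference_mvt[of h x u v S f "\<lambda>y. frechet_derivative f (at y)" "\<lambda>y v. D u v y"])
       (use d' near h f1 f2 in auto)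
  obtain s' t' where st': "0 \<le> s'" "s' \<le> h" "0 \<le> t'" "t' \<le> h"
    "f (x + h *\<^sub>R v + h *\<^sub>R u) - f (x + h *\<^sub>R v) - f (x + h *\<^sub>R u) + f x
       = h * (h * D v u (x + s' *\<^sub>R v + t' *\<^sub>R u))"
    by (rule second_difference_mvt[of h x v u S f "\<lambda>y. frechet_derivative f (at y)" "\<lambda>y u. D v u y"])
       (use near' h f1 f2 in auto)
  have "h * (h * D u v (x + s *\<^sub>R u + t *\<^sub>R v)) = h * (h * D v u (x + t' *\<^sub>R u + s' *\<^sub>R v))"
    using st(5) st'(5) by (simp add: algebra_simps)
  then have "D u v (x + s *\<^sub>R u + t *\<^sub>R v) = D v u (x + t' *\<^sub>R u + s' *\<^sub>R v)"
    using h by simp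
  moreover have "dist (D u v (x + s *\<^sub>R u + t *\<^sub>R v)) (D u v x) < e"
    "dist (D v u (x + t' *\<^sub>R u + s' *\<^sub>R v)) (D v u x) < e"
    using d' near st st' by auto
  ultimately show False
    by (auto simp: e_def dist_real_def abs_if split: if_splits)
qed

lemma second_derivative_symmetric:
  fixes f :: "'a::real_normed_vector \<Rightarrow> 'b::euclidean_space"
  assumes S: "open S" and x: "x \<in> S" and f: "Ck_on 2 S f"
  shows "frechet_derivative (\<lambda>y. frechet_derivative f (at y) u) (at x) v
       = frechet_derivative (\<lambda>y. frechet_derivative f (at y) v) (at x) u"
proof (rule euclidean_eqI)
  fix b :: 'b assume "b \<in> Basis"
  have bl: "bounded_linear (\<lambda>z. z \<bullet> b)" by (rule bounded_linear_inner_left)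
  have f1: "(f has_derivative frechet_derivative f (at y)) (at y)" if "y \<in> S" for y
    using f that frechet_derivative_works by (auto simp: numeral_2_eq_2)
  have f2: "((\<lambda>y. frechet_derivative f (at y) u) has_derivative
      frechet_derivative (\<lambda>y. frechet_derivative f (at y) u) (at y)) (at y)" if "y \<in> S" for y u
    using f that frechet_derivative_works[of "\<lambda>y. frechet_derivative f (at y) u"]
    by (auto simp: numeral_2_eq_2)
  have a: "frechet_derivative (\<lambda>y. f y \<bullet> b) (at y) w = frechet_derivative f (at y) w \<bullet> b"
    if "y \<in> S" for y w
    using frechet_derivative_at[OF bounded_linear.has_derivative[OF bl f1[OF that]]] by metis
  have "frechet_derivative (\<lambda>y. frechet_derivative (\<lambda>y. f y \<bullet> b) (at y) u) (at x) w
      = frechet_derivative (\<lambda>y. frechet_derivative f (at y) u) (at x) w \<bullet> b" for u w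
  proof -
    have "((\<lambda>y. frechet_derivative (\<lambda>y. f y \<bullet> b) (at y) u) has_derivative
       (\<lambda>w. frechet_derivative (\<lambda>y. frechet_derivative f (at y) u) (at x) w \<bullet> b)) (at x)"
      by (rule has_derivative_transform_within_open[OF
            bounded_linear.has_derivative[OF bl f2[OF x]] S x]) (simp add: a)
    then show ?thesis using frechet_derivative_at by metis
  qed
  then show "frechet_derivative (\<lambda>y. frechet_derivative f (at y) u) (at x) v \<bullet> b
       = frechet_derivative (\<lambda>y. frechet_derivative f (at y) v) (at x) u \<bullet> b"
    using second_derivative_symmetric_real[OF S x Ck_on_bounded_linear[OF S bl f], of u v] by metis
qed

section \<open>Calculus in a chart\<close>

lemma vd_at: "vd M a X f x = vd M a (\<lambda>_. X x) f x"
  by (simp add: vd_def)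

locale chart =
  fixes M :: "('i, 'm) spin_mfd" and a :: 'i
  assumes open_image: "open (coord M a ` patch M a)"
    and inj: "inj_on (coord M a) (patch M a)"
begin

abbreviation P where "P \<equiv> patch M a"
abbreviation sm where "sm \<equiv> smooth_in M a P"
abbreviation dv where "dv v \<equiv> vd M a (\<lambda>_. v)"

lemma in_coord_apply [simp]: "x \<in> P \<Longrightarrow> in_coord M a f (coord M a x) = f x"
  by (simp add: in_coord_def inj)

lemma image_coord_cases:
  assumes "z \<in> coord M a ` P"
  obtains x where "x \<in> P" "z = coord M a x"
  using assms by auto

lemma sm_deriv:
  assumes "sm f" "x \<in> P"
  shows "(in_coord M a f has_derivative (\<lambda>v. dv v f x)) (at (coord M a x))"
proof -
  have "Ck_on 1 (coord M a ` P) (in_coord M a f)"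
    using assms(1) by (simp add: smooth_in_def smooth_on_def)
  then have "in_coord M a f differentiable (at (coord M a x))"
    using assms(2) by auto
  then show ?thesis
    by (simp add: frechet_derivative_works vd_def)
qed

lemma dv_unique:
  "(in_coord M a f has_derivative D) (at (coord M a x)) \<Longrightarrow> dv v f x = D v"
  by (simp add: vd_def frechet_derivative_at[symmetric])

lemma dv_linear: "sm f \<Longrightarrow> x \<in> P \<Longrightarrow> linear (\<lambda>v. dv v f x)"
  using sm_deriv has_derivative_linear by blast

text \<open>Off the chart image \<open>in_coord\<close> takes arbitrary values; openness of the
  image keeps them from affecting the derivative.\<close>

lemma dv_transform:
  assumes "(in_coord M a g has_derivative D) (at (coord M a x))" "x \<in> P" "\<And>y. y \<in> P \<Longrightarrow> f y = g y"
  shows "(in_coord M a f has_derivative D) (at (coord M a x))"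
  by (rule has_derivative_transform_within_open[OF assms(1) open_image])
     (use assms in \<open>auto elim!: image_coord_cases\<close>)

lemma dv_cong:
  assumes "\<And>y. y \<in> P \<Longrightarrow> f y = g y" "sm g" "x \<in> P"
  shows "dv v f x = dv v g x"
  by (rule dv_unique[OF dv_transform[OF sm_deriv[OF assms(2,3)] assms(3,1)]])

lemma sm_cong:
  assumes "\<And>y. y \<in> P \<Longrightarrow> f y = g y" "sm g"
  shows "sm f"
  unfolding smooth_in_def smooth_on_def
proof
  fix k
  show "Ck_on k (coord M a ` P) (in_coord M a f)"
    by (rule Ck_on_cong[OF open_image, of "in_coord M a g"])
       (use assms in \<open>auto simp: smooth_in_def smooth_on_def\<close>)
qed

lemma dv_const [simp]: "dv v (\<lambda>_. c) x = 0"
  by (rule dv_unique[where D = "\<lambda>_. 0"]) (simp add: in_coord_def o_def)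

lemma sm_const [intro, simp]: "sm (\<lambda>_. c)"
  by (auto simp: smooth_in_def smooth_on_def in_coord_def o_def Ck_on_const)

lemma sm_bounded_linear:
  assumes "bounded_linear h" "sm f"
  shows "sm (\<lambda>x. h (f x))"
  unfolding smooth_in_def smooth_on_def
proof
  fix k
  have "in_coord M a (\<lambda>x. h (f x)) = (\<lambda>z. h (in_coord M a f z))"
    by (simp add: in_coord_def o_def)
  then show "Ck_on k (coord M a ` P) (in_coord M a (\<lambda>x. h (f x)))"
    using assms by (auto simp: smooth_in_def smooth_on_def intro: Ck_on_bounded_linear[OF open_image])
qed

lemma dv_bounded_linear:
  assumes "bounded_linear h" "sm f" "x \<in> P"
  shows "dv v (\<lambda>x. h (f x)) x = h (dv v f x)"
proof (rule dv_unique)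
  have "in_coord M a (\<lambda>x. h (f x)) = (\<lambda>z. h (in_coord M a f z))"
    by (simp add: in_coord_def o_def)
  then show "(in_coord M a (\<lambda>x. h (f x)) has_derivative (\<lambda>v. h (dv v f x))) (at (coord M a x))"
    using bounded_linear.has_derivative[OF assms(1) sm_deriv[OF assms(2,3)]] by simp
qed

lemma sm_add [intro, simp]:
  assumes "sm f" "sm g"
  shows "sm (\<lambda>x. f x + g x)"
  unfolding smooth_in_def smooth_on_def
proof
  fix k
  have "in_coord M a (\<lambda>x. f x + g x) = (\<lambda>z. in_coord M a f z + in_coord M a g z)"
    by (simp add: in_coord_def o_def)
  then show "Ck_on k (coord M a ` P) (in_coord M a (\<lambda>x. f x + g x))"
    using assms by (auto simp: smooth_in_def smooth_on_def intro: Ck_on_add[OF open_image])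
qed

lemma dv_add:
  assumes "sm f" "sm g" "x \<in> P"
  shows "dv v (\<lambda>x. f x + g x) x = dv v f x + dv v g x"
proof (rule dv_unique)
  have "in_coord M a (\<lambda>x. f x + g x) = (\<lambda>z. in_coord M a f z + in_coord M a g z)"
    by (simp add: in_coord_def o_def)
  then show "(in_coord M a (\<lambda>x. f x + g x) has_derivative (\<lambda>v. dv v f x + dv v g x)) (at (coord M a x))"
    using has_derivative_add[OF sm_deriv[OF assms(1,3)] sm_deriv[OF assms(2,3)]] by simp
qed

lemma sm_bilinear:
  assumes "bounded_bilinear p" "sm f" "sm g"
  shows "sm (\<lambda>x. p (f x) (g x))"
  unfolding smooth_in_def smooth_on_def
proof
  fix k
  have "in_coord M a (\<lambda>x. p (f x) (g x)) = (\<lambda>z. p (in_coord M a f z) (in_coord M a g z))"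
    by (simp add: in_coord_def o_def)
  then show "Ck_on k (coord M a ` P) (in_coord M a (\<lambda>x. p (f x) (g x)))"
    using assms by (auto simp: smooth_in_def smooth_on_def intro: Ck_on_bilinear[OF open_image])
qed

lemma dv_bilinear:
  assumes "bounded_bilinear p" "sm f" "sm g" "x \<in> P"
  shows "dv v (\<lambda>x. p (f x) (g x)) x = p (f x) (dv v g x) + p (dv v f x) (g x)"
proof (rule dv_unique)
  have "in_coord M a (\<lambda>x. p (f x) (g x)) = (\<lambda>z. p (in_coord M a f z) (in_coord M a g z))"
    by (simp add: in_coord_def o_def)
  then show "(in_coord M a (\<lambda>x. p (f x) (g x)) has_derivative
      (\<lambda>v. p (f x) (dv v g x) + p (dv v f x) (g x))) (at (coord M a x))"
    using bounded_bilinear.FDERIV[OF assms(1) sm_deriv[OF assms(2,4)] sm_deriv[OF assms(3,4)]] assms(4)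
    by simp
qed

lemmas sm_scaleR [intro, simp] = sm_bilinear[OF bounded_bilinear_scaleR]
lemmas dv_scaleR = dv_bilinear[OF bounded_bilinear_scaleR]
lemmas sm_minus [intro, simp] = sm_bounded_linear[OF bounded_linear_minus[OF bounded_linear_ident]]
lemmas dv_minus = dv_bounded_linear[OF bounded_linear_minus[OF bounded_linear_ident]]
lemmas sm_cmult = sm_bounded_linear[OF bounded_linear_scaleR_right]
lemmas dv_cmult = dv_bounded_linear[OF bounded_linear_scaleR_right]
lemmas sm_nth [intro, simp] = sm_bounded_linear[OF bounded_linear_vec_nth]
lemmas dv_nth = dv_bounded_linear[OF bounded_linear_vec_nth]

lemma sm_diff [intro, simp]: "sm f \<Longrightarrow> sm g \<Longrightarrow> sm (\<lambda>x. f x - g x)"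
  using sm_add[OF _ sm_minus, of f g] by simp

lemma dv_diff: "sm f \<Longrightarrow> sm g \<Longrightarrow> x \<in> P \<Longrightarrow> dv v (\<lambda>x. f x - g x) x = dv v f x - dv v g x"
  using dv_add[of f "\<lambda>x. - g x" x v] by (simp add: dv_minus)

lemma sm_sum [intro, simp]:
  assumes "\<And>i. i \<in> I \<Longrightarrow> sm (f i)"
  shows "sm (\<lambda>x. \<Sum>i\<in>I. f i x)"
  using assms
proof (induction I rule: infinite_finite_induct)
  case (insert i I)
  then have "sm (\<lambda>x. f i x + (\<Sum>i\<in>I. f i x))" by (intro sm_add) simp_all
  then show ?case using insert by simp
qed simp_all

lemma dv_sum:
  assumes "\<And>i. i \<in> I \<Longrightarrow> sm (f i)" "x \<in> P"
  shows "dv v (\<lambda>x. \<Sum>i\<in>I. f i x) x = (\<Sum>i\<in>I. dv v (f i) x)"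
  using assms
proof (induction I rule: infinite_finite_induct)
  case (insert i I)
  then have "dv v (\<lambda>x. f i x + (\<Sum>i\<in>I. f i x)) x = dv v (f i) x + dv v (\<lambda>x. \<Sum>i\<in>I. f i x) x"
    by (intro dv_add sm_sum) simp_all
  then show ?case using insert by simp
qed simp_all

lemma sm_dv [intro, simp]:
  assumes "sm f"
  shows "sm (dv v f)"
  unfolding smooth_in_def smooth_on_def
proof
  fix k
  have "Ck_on (Suc k) (coord M a ` P) (in_coord M a f)"
    using assms by (auto simp: smooth_in_def smooth_on_def simp del: Ck_on.simps)
  then have "Ck_on k (coord M a ` P) (\<lambda>z. frechet_derivative (in_coord M a f) (at z) v)"
    by simp
  then show "Ck_on k (coord M a ` P) (in_coord M a (dv v f))"
    by (rule Ck_on_cong[OF open_image, rotated]) (auto simp: vd_def)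
qed

lemma dv_commute:
  fixes f :: "'m \<Rightarrow> 'b::euclidean_space"
  assumes f: "sm f" and x: "x \<in> P"
  shows "dv u (dv v f) x = dv v (dv u f) x"
proof -
  have "dv u (dv v f) x = frechet_derivative (\<lambda>z. frechet_derivative (in_coord M a f) (at z) v) (at (coord M a x)) u"
    if "sm f" for u v and f :: "'m \<Rightarrow> 'b"
  proof (rule dv_unique)
    have "Ck_on 2 (coord M a ` P) (in_coord M a f)"
      using that by (auto simp: smooth_in_def smooth_on_def simp del: Ck_on.simps)
    then have "((\<lambda>z. frechet_derivative (in_coord M a f) (at z) v) has_derivative
       frechet_derivative (\<lambda>z. frechet_derivative (in_coord M a f) (at z) v) (at (coord M a x))) (at (coord M a x))"
      using x frechet_derivative_works[of "\<lambda>z. frechet_derivative (in_coord M a f) (at z) v"]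
      by (auto simp: numeral_2_eq_2)
    then show "(in_coord M a (dv v f) has_derivative
       frechet_derivative (\<lambda>z. frechet_derivative (in_coord M a f) (at z) v) (at (coord M a x))) (at (coord M a x))"
      by (rule has_derivative_transform_within_open[OF _ open_image]) (use x in \<open>auto simp: vd_def\<close>)
  qed
  moreover have "Ck_on 2 (coord M a ` P) (in_coord M a f)"
    using f by (auto simp: smooth_in_def smooth_on_def simp del: Ck_on.simps)
  ultimately show ?thesis
    using second_derivative_symmetric[OF open_image imageI[OF x]] f by simp
qed

lemma linear_axis_expansion:
  fixes B :: "real^'n \<Rightarrow> 'b::real_vector"
  assumes "linear B"
  shows "B v = (\<Sum>p\<in>UNIV. (v $ p) *\<^sub>R B (axis p 1))"
proof -
  have "B v = B (\<Sum>p\<in>UNIV. (v $ p) *\<^sub>R axis p 1)"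
    by (simp add: basis_expansion scalar_mult_eq_scaleR[symmetric])
  then show ?thesis
    using assms by (simp add: linear_sum linear_scale)
qed

text \<open>Expanding the argument in the standard basis turns \<open>B y (Y y)\<close> into a
  finite sum of products of smooth functions. The Leibniz rule then splits into differentiating the
  tensor at a frozen argument and differentiating the argument.\<close>

lemma
  fixes B :: "'m \<Rightarrow> real^6 \<Rightarrow> 'b::real_normed_vector"
  assumes lin: "\<And>y. y \<in> P \<Longrightarrow> linear (B y)" and B: "\<And>u. sm (\<lambda>y. B y u)" and Y: "sm Y"
  shows sm_linear: "sm (\<lambda>y. B y (Y y))"
    and dv_linear_family: "x \<in> P \<Longrightarrow> dv u (\<lambda>y. B y (Y y)) x = dv u (\<lambda>y. B y (Y x)) x + B x (dv u Y x)"
proof -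
  have eq: "B y v = (\<Sum>p\<in>UNIV. (v $ p) *\<^sub>R B y (axis p 1))" if "y \<in> P" for y v
    by (rule linear_axis_expansion[OF lin[OF that]])
  have sm: "sm (\<lambda>y. \<Sum>p\<in>UNIV. (Y y $ p) *\<^sub>R B y (axis p 1))"
    using B Y by auto
  show "sm (\<lambda>y. B y (Y y))"
    by (rule sm_cong[OF _ sm]) (rule eq)
  show "dv u (\<lambda>y. B y (Y y)) x = dv u (\<lambda>y. B y (Y x)) x + B x (dv u Y x)" if x: "x \<in> P"
  proof -
    have "dv u (\<lambda>y. B y (Y y)) x = dv u (\<lambda>y. \<Sum>p\<in>UNIV. (Y y $ p) *\<^sub>R B y (axis p 1)) x"
      by (rule dv_cong[OF _ sm x]) (rule eq)
    also have "\<dots> = (\<Sum>p\<in>UNIV. (Y x $ p) *\<^sub>R dv u (\<lambda>y. B y (axis p 1)) x)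
       + (\<Sum>p\<in>UNIV. (dv u Y x $ p) *\<^sub>R B x (axis p 1))"
      using B Y x by (simp add: dv_sum dv_scaleR dv_nth sum.distrib)
    also have "(\<Sum>p\<in>UNIV. (dv u Y x $ p) *\<^sub>R B x (axis p 1)) = B x (dv u Y x)"
      using eq[OF x] by metis
    also have "(\<Sum>p\<in>UNIV. (Y x $ p) *\<^sub>R dv u (\<lambda>y. B y (axis p 1)) x)
      = dv u (\<lambda>y. \<Sum>p\<in>UNIV. (Y x $ p) *\<^sub>R B y (axis p 1)) x"
      using B x by (simp add: dv_sum dv_cmult sm_cmult)
    also have "\<dots> = dv u (\<lambda>y. B y (Y x)) x"
      using B by (intro dv_cong[OF _ _ x, symmetric] eq) (auto simp: sm_cmult eq)
    finally show ?thesis .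
  qed
qed

lemma
  fixes B :: "'m \<Rightarrow> real^6 \<Rightarrow> real^6 \<Rightarrow> 'b::real_normed_vector"
  assumes lin: "\<And>y u. y \<in> P \<Longrightarrow> linear (B y u)" "\<And>y v. y \<in> P \<Longrightarrow> linear (\<lambda>u. B y u v)"
    and B: "\<And>u v. sm (\<lambda>y. B y u v)" and Y: "sm Y" and Z: "sm Z"
  shows sm_linear2: "sm (\<lambda>y. B y (Y y) (Z y))"
    and dv_linear2: "x \<in> P \<Longrightarrow> dv u (\<lambda>y. B y (Y y) (Z y)) x
      = dv u (\<lambda>y. B y (Y x) (Z x)) x + B x (dv u Y x) (Z x) + B x (Y x) (dv u Z x)"
proof -
  have s: "sm (\<lambda>y. B y v (Z y))" for v
    by (rule sm_linear[OF _ _ Z]) (use lin B in auto)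
  show "sm (\<lambda>y. B y (Y y) (Z y))"
    by (rule sm_linear[OF _ _ Y, of "\<lambda>y v. B y v (Z y)"]) (use lin s in auto)
  show "dv u (\<lambda>y. B y (Y y) (Z y)) x
      = dv u (\<lambda>y. B y (Y x) (Z x)) x + B x (dv u Y x) (Z x) + B x (Y x) (dv u Z x)" if x: "x \<in> P"
    using dv_linear_family[OF _ _ Y x, of "\<lambda>y v. B y v (Z y)" u]
      dv_linear_family[OF _ _ Z x, of "\<lambda>y v. B y (Y x) v" u] lin s B
    by simp
qed

lemma
  fixes B :: "'m \<Rightarrow> real^6 \<Rightarrow> real^6 \<Rightarrow> real^6 \<Rightarrow> 'b::real_normed_vector"
  assumes lin: "\<And>y u v. y \<in> P \<Longrightarrow> linear (B y u v)" "\<And>y u w. y \<in> P \<Longrightarrow> linear (\<lambda>v. B y u v w)"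
      "\<And>y v w. y \<in> P \<Longrightarrow> linear (\<lambda>u. B y u v w)"
    and B: "\<And>u v w. sm (\<lambda>y. B y u v w)" and X: "sm X" and Y: "sm Y" and Z: "sm Z"
  shows sm_linear3: "sm (\<lambda>y. B y (X y) (Y y) (Z y))"
    and dv_linear3: "x \<in> P \<Longrightarrow> dv u (\<lambda>y. B y (X y) (Y y) (Z y)) x
      = dv u (\<lambda>y. B y (X x) (Y x) (Z x)) x + B x (dv u X x) (Y x) (Z x)
        + B x (X x) (dv u Y x) (Z x) + B x (X x) (Y x) (dv u Z x)"
proof -
  have s: "sm (\<lambda>y. B y v (Y y) (Z y))" for v
    by (rule sm_linear2[OF _ _ _ Y Z]) (use lin B in auto)
  show "sm (\<lambda>y. B y (X y) (Y y) (Z y))"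
    by (rule sm_linear[OF _ _ X, of "\<lambda>y v. B y v (Y y) (Z y)"]) (use lin s in auto)
  show "dv u (\<lambda>y. B y (X y) (Y y) (Z y)) x
      = dv u (\<lambda>y. B y (X x) (Y x) (Z x)) x + B x (dv u X x) (Y x) (Z x)
        + B x (X x) (dv u Y x) (Z x) + B x (X x) (Y x) (dv u Z x)" if x: "x \<in> P"
    using dv_linear_family[OF _ _ X x, of "\<lambda>y v. B y v (Y y) (Z y)" u]
      dv_linear2[OF _ _ _ Y Z x, of "\<lambda>y v w. B y (X x) v w" u] lin s B
    by simp
qed

lemma sm_vd [intro, simp]:
  assumes "sm X" "sm f"
  shows "sm (vd M a X f)"
proof -
  have "sm (\<lambda>y. dv (X y) f y)"
    by (rule sm_linear[OF dv_linear[OF assms(2)] sm_dv[OF assms(2)] assms(1)])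
  then show ?thesis
    by (rule sm_cong[rotated]) (rule vd_at)
qed

text \<open>Iterating along a field that itself varies adds a first-order term. In the commutator
  the second-order parts cancel by \<open>dv_commute\<close>, and these first-order terms form the
  bracket.\<close>

lemma vd_vd:
  fixes f :: "'m \<Rightarrow> 'b::euclidean_space"
  assumes Y: "sm Y" and f: "sm f" and x: "x \<in> P"
  shows "vd M a X (vd M a Y f) x = dv (X x) (dv (Y x) f) x + dv (vd M a X Y x) f x"
proof -
  have "vd M a Y f = (\<lambda>y. dv (Y y) f y)"
    by (rule ext) (rule vd_at)
  then have "vd M a X (vd M a Y f) x = dv (X x) (\<lambda>y. dv (Y y) f y) x"
    using vd_at[of M a X "vd M a Y f" x] by metis
  also have "\<dots> = dv (X x) (\<lambda>y. dv (Y x) f y) x + dv (dv (X x) Y x) f x"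
    by (rule dv_linear_family[OF dv_linear[OF f] sm_dv[OF f] Y x])
  finally show ?thesis by (simp add: vd_at[of M a X])
qed

lemma vd_commutator:
  fixes f :: "'m \<Rightarrow> 'b::euclidean_space"
  assumes X: "sm X" and Y: "sm Y" and f: "sm f" and x: "x \<in> P"
  shows "vd M a X (vd M a Y f) x - vd M a Y (vd M a X f) x = dv (bracket M a X Y x) f x"
  using vd_vd[OF Y f x, of X] vd_vd[OF X f x, of Y] dv_commute[OF f x, of "X x" "Y x"]
    linear_diff[OF dv_linear[OF f x], of "vd M a X Y x" "vd M a Y X x"]
  by (simp add: bracket_def)

end

section \<open>Clifford modules\<close>

lemma scaleR_3: "3 *\<^sub>R x = x + x + (x::'a::real_vector)"
  using scaleR_add_left[of 2 1 x] by (simp add: scaleR_2)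
lemma scaleR_4: "4 *\<^sub>R x = x + x + x + (x::'a::real_vector)"
  using scaleR_add_left[of 3 1 x] by (simp add: scaleR_3)
lemma scaleR_12: "12 *\<^sub>R x = x + x + x + x + x + x + x + x + x + x + x + (x::'a::real_vector)"
proof -
  have "12 *\<^sub>R x = 3 *\<^sub>R 4 *\<^sub>R x" by simp
  then show ?thesis unfolding scaleR_3 scaleR_4 by (simp only: add.assoc)
qed

locale clifford_module =
  fixes \<gamma> :: "'n::finite \<Rightarrow> 'v::real_vector \<Rightarrow> 'v"
  assumes linear_\<gamma>: "linear (\<gamma> i)"
    and clifford: "\<gamma> i (\<gamma> j e) + \<gamma> j (\<gamma> i e) = (if i = j then 2 *\<^sub>R e else 0)"
begin

text \<open>Coefficients are not assumed antisymmetric, and each degree is nested in the next. All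
  index permutations of one tensor can thus be compared, with contractions as remainders of lower
  degree, and identities climb from one degree to the next.\<close>

definition G1 :: "('n \<Rightarrow> real) \<Rightarrow> 'v \<Rightarrow> 'v" where
  "G1 v e = (\<Sum>i\<in>UNIV. v i *\<^sub>R \<gamma> i e)"
definition G2 :: "('n \<Rightarrow> 'n \<Rightarrow> real) \<Rightarrow> 'v \<Rightarrow> 'v" where
  "G2 A e = (\<Sum>i\<in>UNIV. \<gamma> i (G1 (A i) e))"
definition G3 :: "('n \<Rightarrow> 'n \<Rightarrow> 'n \<Rightarrow> real) \<Rightarrow> 'v \<Rightarrow> 'v" where
  "G3 X e = (\<Sum>i\<in>UNIV. \<gamma> i (G2 (X i) e))"
definition G4 :: "('n \<Rightarrow> 'n \<Rightarrow> 'n \<Rightarrow> 'n \<Rightarrow> real) \<Rightarrow> 'v \<Rightarrow> 'v" where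
  "G4 Z e = (\<Sum>i\<in>UNIV. \<gamma> i (G3 (Z i) e))"

lemmas \<gamma>_simps = linear_add[OF linear_\<gamma>] linear_diff[OF linear_\<gamma>] linear_scale[OF linear_\<gamma>]
  linear_0[OF linear_\<gamma>] linear_neg[OF linear_\<gamma>]
lemmas \<gamma>_sum = linear_sum[OF linear_\<gamma>]

lemma G1_add: "G1 (\<lambda>i. v i + w i) e = G1 v e + G1 w e"
  by (simp add: G1_def scaleR_add_left sum.distrib)
lemma G1_scale: "G1 (\<lambda>i. c * v i) e = c *\<^sub>R G1 v e"
  by (simp add: G1_def scaleR_sum_right)
lemma G2_add: "G2 (\<lambda>i j. A i j + B i j) e = G2 A e + G2 B e"
  by (simp add: G2_def G1_add \<gamma>_simps sum.distrib)
lemma G2_scale: "G2 (\<lambda>i j. c * A i j) e = c *\<^sub>R G2 A e"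
  by (simp add: G2_def G1_scale \<gamma>_simps scaleR_sum_right)
lemma G3_add: "G3 (\<lambda>i j k. A i j k + B i j k) e = G3 A e + G3 B e"
  by (simp add: G3_def G2_add \<gamma>_simps sum.distrib)
lemma G3_scale: "G3 (\<lambda>i j k. c * A i j k) e = c *\<^sub>R G3 A e"
  by (simp add: G3_def G2_scale \<gamma>_simps scaleR_sum_right)
lemma G4_add: "G4 (\<lambda>i j k l. A i j k l + B i j k l) e = G4 A e + G4 B e"
  by (simp add: G4_def G3_add \<gamma>_simps sum.distrib)
lemma G4_scale: "G4 (\<lambda>i j k l. c * A i j k l) e = c *\<^sub>R G4 A e"
  by (simp add: G4_def G3_scale \<gamma>_simps scaleR_sum_right)

lemma G1_minus: "G1 (\<lambda>i. - v i) e = - G1 v e"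
  using G1_scale[of "-1" v e] by simp
lemma G2_minus: "G2 (\<lambda>i j. - A i j) e = - G2 A e"
  using G2_scale[of "-1" A e] by simp
lemma G3_minus: "G3 (\<lambda>i j k. - A i j k) e = - G3 A e"
  using G3_scale[of "-1" A e] by simp
lemma G4_minus: "G4 (\<lambda>i j k l. - A i j k l) e = - G4 A e"
  using G4_scale[of "-1" A e] by simp
lemma G1_diff: "G1 (\<lambda>i. v i - w i) e = G1 v e - G1 w e"
  using G1_add[of v "\<lambda>i. - w i" e] by (simp add: G1_minus)
lemma G2_diff: "G2 (\<lambda>i j. A i j - B i j) e = G2 A e - G2 B e"
  using G2_add[of A "\<lambda>i j. - B i j" e] by (simp add: G2_minus)
lemma G3_diff: "G3 (\<lambda>i j k. A i j k - B i j k) e = G3 A e - G3 B e"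
  using G3_add[of A "\<lambda>i j k. - B i j k" e] by (simp add: G3_minus)
lemma G4_diff: "G4 (\<lambda>i j k l. A i j k l - B i j k l) e = G4 A e - G4 B e"
  using G4_add[of A "\<lambda>i j k l. - B i j k l" e] by (simp add: G4_minus)
lemma G1_0: "G1 (\<lambda>i. 0) e = 0"
  using G1_scale[of 0 _ e] by simp
lemma G2_0: "G2 (\<lambda>i j. 0) e = 0"
  using G2_scale[of 0 _ e] by simp
lemma G3_0: "G3 (\<lambda>i j k. 0) e = 0"
  using G3_scale[of 0 _ e] by simp

lemma G1_sum: "finite I \<Longrightarrow> G1 (\<lambda>i. \<Sum>p\<in>I. v p i) e = (\<Sum>p\<in>I. G1 (v p) e)"
  by (induction I rule: finite_induct) (simp_all add: G1_0 G1_add)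
lemma G2_sum: "finite I \<Longrightarrow> G2 (\<lambda>i j. \<Sum>p\<in>I. A p i j) e = (\<Sum>p\<in>I. G2 (A p) e)"
  by (induction I rule: finite_induct) (simp_all add: G2_0 G2_add)

lemma linear_G1: "linear (G1 v)"
  unfolding G1_def[abs_def]
  by (intro linear_compose_sum ballI linear_compose_scale_right linear_\<gamma>)
lemma linear_G2: "linear (G2 A)"
  unfolding G2_def[abs_def]
  by (intro linear_compose_sum ballI linear_compose[OF linear_G1 linear_\<gamma>, unfolded o_def])
lemma linear_G3: "linear (G3 X)"
  unfolding G3_def[abs_def]
  by (intro linear_compose_sum ballI linear_compose[OF linear_G2 linear_\<gamma>, unfolded o_def])

lemmas G1_simps = linear_add[OF linear_G1] linear_diff[OF linear_G1] linear_scale[OF linear_G1]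
  linear_0[OF linear_G1] linear_neg[OF linear_G1]
lemmas G2_simps = linear_add[OF linear_G2] linear_diff[OF linear_G2] linear_scale[OF linear_G2]
  linear_0[OF linear_G2] linear_neg[OF linear_G2]
lemmas G3_simps = linear_add[OF linear_G3] linear_diff[OF linear_G3] linear_scale[OF linear_G3]
  linear_0[OF linear_G3] linear_neg[OF linear_G3]

section \<open>Reordering of Clifford products\<close>

lemma \<gamma>_swap: "\<gamma> i (\<gamma> j e) = - \<gamma> j (\<gamma> i e) + (if i = j then 2 *\<^sub>R e else 0)"
  using clifford[of i j e] by (simp add: algebra_simps)

text \<open>The vector \<open>w\<close> carries whatever stands to the right of the two generators,
  so this one exchange underlies the index swaps in every degree.\<close>

lemma \<gamma>_swap_sum:
  "(\<Sum>i\<in>UNIV. \<Sum>j\<in>UNIV. \<gamma> i (\<gamma> j (w j i)))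
    = - (\<Sum>i\<in>UNIV. \<Sum>j\<in>UNIV. \<gamma> i (\<gamma> j (w i j))) + 2 *\<^sub>R (\<Sum>i\<in>UNIV. w i i)"
proof -
  have "(\<Sum>i\<in>UNIV. \<Sum>j\<in>UNIV. \<gamma> i (\<gamma> j (w j i)))
    = (\<Sum>i\<in>UNIV. \<Sum>j\<in>UNIV. - \<gamma> j (\<gamma> i (w j i)) + (if i = j then 2 *\<^sub>R w j i else 0))"
    by (subst \<gamma>_swap) (rule refl)
  also have "\<dots> = - (\<Sum>i\<in>UNIV. \<Sum>j\<in>UNIV. \<gamma> j (\<gamma> i (w j i))) + 2 *\<^sub>R (\<Sum>i\<in>UNIV. w i i)"
    by (simp add: sum.distrib sum_negf sum_subtractf scaleR_sum_right)
  also have "(\<Sum>i\<in>UNIV. \<Sum>j\<in>UNIV. \<gamma> j (\<gamma> i (w j i))) = (\<Sum>i\<in>UNIV. \<Sum>j\<in>UNIV. \<gamma> i (\<gamma> j (w i j)))"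
    by (rule sum.swap)
  finally show ?thesis .
qed

lemma G2_swap: "G2 (\<lambda>i j. A j i) e = - G2 A e + 2 *\<^sub>R (\<Sum>i\<in>UNIV. A i i) *\<^sub>R e"
  using \<gamma>_swap_sum[of "\<lambda>i j. A i j *\<^sub>R e"]
  by (simp add: G2_def G1_def \<gamma>_sum \<gamma>_simps scaleR_sum_left)

lemma G3_swap12: "G3 (\<lambda>i j k. X j i k) e = - G3 X e + 2 *\<^sub>R G1 (\<lambda>k. \<Sum>i\<in>UNIV. X i i k) e"
  using \<gamma>_swap_sum[of "\<lambda>i j. G1 (X i j) e"]
  by (simp add: G3_def G2_def \<gamma>_sum \<gamma>_simps G1_sum)

lemma G3_swap23: "G3 (\<lambda>i j k. X i k j) e = - G3 X e + 2 *\<^sub>R G1 (\<lambda>i. \<Sum>j\<in>UNIV. X i j j) e"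
proof -
  have "G3 (\<lambda>i j k. X i k j) e = (\<Sum>i\<in>UNIV. \<gamma> i (- G2 (X i) e + 2 *\<^sub>R (\<Sum>j\<in>UNIV. X i j j) *\<^sub>R e))"
    unfolding G3_def by (subst G2_swap) (rule refl)
  then show ?thesis
    by (simp add: G3_def G1_def \<gamma>_simps sum.distrib sum_negf sum_subtractf scaleR_sum_right)
qed

lemma G4_swap12: "G4 (\<lambda>i j k l. X j i k l) e = - G4 X e + 2 *\<^sub>R G2 (\<lambda>k l. \<Sum>i\<in>UNIV. X i i k l) e"
  using \<gamma>_swap_sum[of "\<lambda>i j. G2 (X i j) e"]
  by (simp add: G4_def G3_def \<gamma>_sum \<gamma>_simps G2_sum)

lemma G4_swap23: "G4 (\<lambda>i j k l. X i k j l) e = - G4 X e + 2 *\<^sub>R G2 (\<lambda>i l. \<Sum>j\<in>UNIV. X i j j l) e"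
proof -
  have "G4 (\<lambda>i j k l. X i k j l) e = (\<Sum>i\<in>UNIV. \<gamma> i (- G3 (X i) e + 2 *\<^sub>R G1 (\<lambda>l. \<Sum>j\<in>UNIV. X i j j l) e))"
    unfolding G4_def by (subst G3_swap12) (rule refl)
  then show ?thesis
    by (simp add: G4_def G2_def \<gamma>_simps sum.distrib sum_negf sum_subtractf scaleR_sum_right)
qed

lemma G4_swap34: "G4 (\<lambda>i j k l. X i j l k) e = - G4 X e + 2 *\<^sub>R G2 (\<lambda>i j. \<Sum>k\<in>UNIV. X i j k k) e"
proof -
  have "G4 (\<lambda>i j k l. X i j l k) e = (\<Sum>i\<in>UNIV. \<gamma> i (- G3 (X i) e + 2 *\<^sub>R G1 (\<lambda>j. \<Sum>k\<in>UNIV. X i j k k) e))"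
    unfolding G4_def by (subst G3_swap23) (rule refl)
  then show ?thesis
    by (simp add: G4_def G2_def \<gamma>_simps sum.distrib sum_negf sum_subtractf scaleR_sum_right)
qed

text \<open>Applying \<open>v\<close> twice multiplies the spinor by the squared length of
  \<open>v\<close>. This is how a spinor equation becomes a tensor equation.\<close>

lemma G1_eq_0D:
  assumes "G1 v e = 0" "e \<noteq> 0"
  shows "v i = 0"
proof -
  have "G2 (\<lambda>i j. v i * v j) e = (\<Sum>i\<in>UNIV. \<gamma> i (v i *\<^sub>R G1 v e))"
    by (simp add: G2_def G1_scale)
  then have "G2 (\<lambda>i j. v i * v j) e = 0"
    using assms(1) by (simp add: \<gamma>_simps)
  then have "(\<Sum>i\<in>UNIV. v i * v i) *\<^sub>R e = 0"
    using G2_swap[of "\<lambda>i j. v i * v j" e] by (simp add: mult.commute)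
  then have "(\<Sum>i\<in>UNIV. v i * v i) = 0"
    using assms(2) by simp
  then show ?thesis
    by (simp add: sum_nonneg_eq_0_iff)
qed

lemma G1_\<gamma>: "G1 v (\<gamma> m e) = - \<gamma> m (G1 v e) + (2 * v m) *\<^sub>R e"
proof -
  have "G1 v (\<gamma> m e) = (\<Sum>i\<in>UNIV. v i *\<^sub>R (- \<gamma> m (\<gamma> i e) + (if i = m then 2 *\<^sub>R e else 0)))"
    unfolding G1_def by (subst \<gamma>_swap) (rule refl)
  also have "\<dots> = - \<gamma> m (G1 v e) + (\<Sum>i\<in>UNIV. v i *\<^sub>R (if i = m then 2 *\<^sub>R e else 0))"
    by (simp add: scaleR_add_right scaleR_diff_right sum.distrib G1_def \<gamma>_simps \<gamma>_sum sum_negf sum_subtractf)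
  also have "(\<Sum>i\<in>UNIV. v i *\<^sub>R (if i = m then 2 *\<^sub>R e else 0)) = (\<Sum>i\<in>UNIV. if i = m then (2 * v m) *\<^sub>R e else 0)"
    by (rule sum.cong) auto
  finally show ?thesis by simp
qed

lemma \<gamma>_move: "(\<Sum>i\<in>UNIV. \<gamma> i (\<gamma> m (w i))) = - \<gamma> m (\<Sum>i\<in>UNIV. \<gamma> i (w i)) + 2 *\<^sub>R w m"
proof -
  have "(\<Sum>i\<in>UNIV. \<gamma> i (\<gamma> m (w i))) = (\<Sum>i\<in>UNIV. - \<gamma> m (\<gamma> i (w i)) + (if i = m then 2 *\<^sub>R w m else 0))"
    by (rule sum.cong) (auto simp: \<gamma>_swap[of _ m])
  then show ?thesis
    by (simp add: sum.distrib sum_negf sum_subtractf \<gamma>_sum)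
qed

text \<open>Each of the two slots contributes 2 from the Clifford relation, and antisymmetry makes
  both contractions equal.\<close>

lemma G2_\<gamma>:
  assumes "\<And>i j. A i j = - A j i"
  shows "G2 A (\<gamma> m e) = \<gamma> m (G2 A e) + 4 *\<^sub>R G1 (\<lambda>i. A i m) e"
proof -
  have "G2 A (\<gamma> m e) = - (\<Sum>i\<in>UNIV. \<gamma> i (\<gamma> m (G1 (A i) e))) + (\<Sum>i\<in>UNIV. (2 * A i m) *\<^sub>R \<gamma> i e)"
    by (simp add: G2_def G1_\<gamma> \<gamma>_simps sum.distrib sum_negf sum_subtractf)
  also have "(\<Sum>i\<in>UNIV. (2 * A i m) *\<^sub>R \<gamma> i e) = 2 *\<^sub>R G1 (\<lambda>i. A i m) e"
    by (simp add: G1_def scaleR_sum_right)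
  also have eq: "G1 (\<lambda>i. A i m) e = - G1 (A m) e"
  proof -
    have "(\<lambda>i. A i m) = (\<lambda>i. - A m i)" by (rule ext) (rule assms)
    then show ?thesis by (simp only: G1_minus)
  qed
  finally show ?thesis
    unfolding \<gamma>_move G2_def[symmetric]
    by (simp add: eq algebra_simps scaleR_add_left[symmetric])
qed

text \<open>An odd form anticommutes with a vector up to a contraction; 6 is the sum of 2 from the
  first slot and 4 from the 2-form in the remaining slots.\<close>

lemma G3_\<gamma>:
  assumes "\<And>i j k. H i j k = - H j i k" "\<And>i j k. H i j k = - H i k j"
  shows "G3 H (\<gamma> m e) = - \<gamma> m (G3 H e) + 6 *\<^sub>R G2 (H m) e"
proof -
  have "G3 H (\<gamma> m e) = (\<Sum>i\<in>UNIV. \<gamma> i (\<gamma> m (G2 (H i) e))) + 4 *\<^sub>R G2 (\<lambda>i j. H i j m) e"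
    unfolding G3_def G2_\<gamma>[OF assms(2)] by (simp add: \<gamma>_simps sum.distrib G2_def scaleR_sum_right)
  also have "(\<lambda>i j. H i j m) = H m"
  proof (intro ext)
    fix i j
    show "H i j m = H m i j"
      using assms(1)[of m i j] assms(2)[of i j m] by simp
  qed
  finally show ?thesis
    unfolding \<gamma>_move G3_def[symmetric] by (simp add: algebra_simps scaleR_add_left[symmetric])
qed

text \<open>Two-forms act on the Clifford algebra by commutators, as infinitesimal rotations.\<close>

lemma G2_G1:
  assumes "\<And>i j. A i j = - A j i"
  shows "G2 A (G1 v e) = G1 v (G2 A e) + 4 *\<^sub>R G1 (\<lambda>i. \<Sum>m\<in>UNIV. A i m * v m) e"
proof -
  have "G2 A (G1 v e) = (\<Sum>m\<in>UNIV. v m *\<^sub>R (\<gamma> m (G2 A e) + 4 *\<^sub>R G1 (\<lambda>i. A i m) e))"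
    unfolding G1_def[of v] by (simp add: linear_sum[OF linear_G2] G2_simps G2_\<gamma>[OF assms])
  also have "\<dots> = G1 v (G2 A e) + 4 *\<^sub>R (\<Sum>m\<in>UNIV. G1 (\<lambda>i. v m * A i m) e)"
    by (simp add: scaleR_add_right sum.distrib G1_def[of v] G1_scale scaleR_sum_right mult.commute)
  finally show ?thesis
    by (simp add: G1_sum mult.commute)
qed

text \<open>The Leibniz rule in a form that iterates: the vectors \<open>w i\<close> may depend on
  the index, so longer products are treated by peeling off the first generator.\<close>

lemma G2_sum_\<gamma>:
  assumes "\<And>i j. A i j = - A j i"
  shows "G2 A (\<Sum>i\<in>UNIV. \<gamma> i (w i)) = (\<Sum>i\<in>UNIV. \<gamma> i (G2 A (w i) + 4 *\<^sub>R (\<Sum>m\<in>UNIV. A i m *\<^sub>R w m)))"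
proof -
  have "G2 A (\<Sum>i\<in>UNIV. \<gamma> i (w i)) = (\<Sum>m\<in>UNIV. \<gamma> m (G2 A (w m)) + 4 *\<^sub>R G1 (\<lambda>i. A i m) (w m))"
    by (simp add: linear_sum[OF linear_G2] G2_\<gamma>[OF assms])
  also have "(\<Sum>m\<in>UNIV. 4 *\<^sub>R G1 (\<lambda>i. A i m) (w m)) = 4 *\<^sub>R (\<Sum>i\<in>UNIV. \<Sum>m\<in>UNIV. A i m *\<^sub>R \<gamma> i (w m))"
    unfolding G1_def scaleR_sum_right[symmetric] by (subst sum.swap) (rule refl)
  ultimately show ?thesis
    by (simp add: sum.distrib \<gamma>_simps \<gamma>_sum scaleR_sum_right)
qed

lemma G2_G2:
  assumes "\<And>i j. A i j = - A j i"
  shows "G2 A (G2 B e) = G2 B (G2 A e)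
    + 4 *\<^sub>R G2 (\<lambda>i j. (\<Sum>m\<in>UNIV. A i m * B m j) + (\<Sum>m\<in>UNIV. A j m * B i m)) e"
  unfolding G2_def[of B] G2_sum_\<gamma>[OF assms] G2_G1[OF assms]
  by (simp add: G2_def[of "\<lambda>i j. (\<Sum>m\<in>UNIV. A i m * B m j) + (\<Sum>m\<in>UNIV. A j m * B i m)"]
      G1_add G1_sum G1_scale \<gamma>_simps \<gamma>_sum sum.distrib scaleR_sum_right scaleR_add_right)

lemma G2_G3:
  assumes "\<And>i j. A i j = - A j i"
  shows "G2 A (G3 X e) = G3 X (G2 A e)
    + 4 *\<^sub>R G3 (\<lambda>i j k. (\<Sum>m\<in>UNIV. A i m * X m j k) + ((\<Sum>m\<in>UNIV. A j m * X i m k)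
        + (\<Sum>m\<in>UNIV. A k m * X i j m))) e"
  unfolding G3_def[of X] G2_sum_\<gamma>[OF assms] G2_G2[OF assms]
  by (simp add: G3_def[of "\<lambda>i j k. (\<Sum>m\<in>UNIV. A i m * X m j k) + _ i j k"]
      G2_add G2_sum G2_scale \<gamma>_simps \<gamma>_sum sum.distrib scaleR_sum_right scaleR_add_right)

section \<open>Contraction of cyclic and alternating sums\<close>

text \<open>Antisymmetry in the last pair lets each cyclic permutation be reached by adjacent swaps,
  at the cost of 2 and 4 copies of the trace. It contracts the Bianchi identities of the torsion
  connection and of the gauge field, and also the cyclic terms of \<open>Tr_wedge\<close>.\<close>

lemma G3_cyclic_sum:
  assumes skew: "\<And>j k l. X j k l = - X j l k"
  shows "G3 (\<lambda>j k l. X j k l + X k l j + X l j k) e = 3 *\<^sub>R G3 X e - 6 *\<^sub>R G1 (\<lambda>l. \<Sum>j\<in>UNIV. X j j l) e"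
proof -
  have t: "G1 (\<lambda>l. \<Sum>j\<in>UNIV. X j l j) e = - G1 (\<lambda>l. \<Sum>j\<in>UNIV. X j j l) e"
  proof -
    have "(\<lambda>l. \<Sum>j\<in>UNIV. X j l j) = (\<lambda>l. - (\<Sum>j\<in>UNIV. X j j l))"
      unfolding sum_negf[symmetric] by (intro ext sum.cong refl) (rule skew)
    then show ?thesis by (simp only: G1_minus)
  qed
  have a: "G3 (\<lambda>j k l. X k j l) e = - G3 X e + 2 *\<^sub>R G1 (\<lambda>l. \<Sum>j\<in>UNIV. X j j l) e"
    by (rule G3_swap12)
  have "G3 (\<lambda>j k l. X k l j) e = - G3 (\<lambda>j k l. X k j l) e"
  proof -
    have "(\<lambda>j k l. X k l j) = (\<lambda>j k l. - X k j l)"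
      by (intro ext) (rule skew)
    then show ?thesis by (simp only: G3_minus)
  qed
  then have 1: "G3 (\<lambda>j k l. X k l j) e = G3 X e - 2 *\<^sub>R G1 (\<lambda>l. \<Sum>j\<in>UNIV. X j j l) e"
    using a by simp
  have "G3 (\<lambda>j k l. X l j k) e = - G3 (\<lambda>j k l. X k j l) e + 2 *\<^sub>R G1 (\<lambda>l. \<Sum>j\<in>UNIV. X j l j) e"
    by (rule G3_swap23[of "\<lambda>j k l. X k j l"])
  then have 2: "G3 (\<lambda>j k l. X l j k) e = G3 X e - 4 *\<^sub>R G1 (\<lambda>l. \<Sum>j\<in>UNIV. X j j l) e"
    using a t by (simp add: algebra_simps scaleR_add_left[symmetric])
  show ?thesis
    unfolding G3_add 1 2 by (simp add: scaleR_3 algebra_simps scaleR_add_left[symmetric])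
qed

text \<open>Moving the first index through the other three costs 2, 4 and 6 copies of the trace, and
  the alternating signs add them up to 12. With \<open>T\<close> the covariant derivative of a
  3-form, the alternating sum is the exterior derivative.\<close>

lemma G4_alternation:
  assumes skew: "\<And>i j k l. T i j k l = - T i k j l" "\<And>i j k l. T i j k l = - T i j l k"
  shows "G4 (\<lambda>i j k l. T i j k l - T j i k l + T k i j l - T l i j k) e
    = 4 *\<^sub>R G4 T e - 12 *\<^sub>R G2 (\<lambda>k l. \<Sum>i\<in>UNIV. T i i k l) e"
proof -
  let ?t = "G2 (\<lambda>k l. \<Sum>i\<in>UNIV. T i i k l) e"
  have t: "(\<lambda>i l. \<Sum>j\<in>UNIV. T j i j l) = (\<lambda>i l. - (\<Sum>j\<in>UNIV. T j j i l))"
    unfolding sum_negf[symmetric] by (intro ext sum.cong refl) (rule skew(1))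
  have t': "(\<lambda>i l. \<Sum>j\<in>UNIV. T j i l j) = (\<lambda>i l. \<Sum>j\<in>UNIV. T j j i l)"
  proof (intro ext sum.cong refl)
    fix i l j show "T j i l j = T j j i l"
      using skew(1)[of j i j l] skew(2)[of j i l j] by simp
  qed
  have 1: "G4 (\<lambda>i j k l. T j i k l) e = - G4 T e + 2 *\<^sub>R ?t"
    by (rule G4_swap12)
  have 2: "G4 (\<lambda>i j k l. T k i j l) e = - G4 (\<lambda>i j k l. T j i k l) e + 2 *\<^sub>R G2 (\<lambda>i l. \<Sum>j\<in>UNIV. T j i j l) e"
    by (rule G4_swap23[of "\<lambda>i j k l. T j i k l"])
  have 3: "G4 (\<lambda>i j k l. T l i j k) e = - G4 (\<lambda>i j k l. T k i j l) e + 2 *\<^sub>R G2 (\<lambda>i j. \<Sum>k\<in>UNIV. T k i j k) e"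
    by (rule G4_swap34[of "\<lambda>i j k l. T k i j l"])
  show ?thesis
    unfolding G4_diff G4_add 3 2 1 t t' G2_minus
    by (simp add: scaleR_3 scaleR_4 scaleR_12 algebra_simps scaleR_2)
qed

lemma G2_symmetric:
  assumes "\<And>i j. A i j = A j i"
  shows "G2 A e = (\<Sum>i\<in>UNIV. A i i) *\<^sub>R e"
proof -
  have "(\<lambda>i j. A j i) = A" using assms by blast
  then have "2 *\<^sub>R G2 A e = 2 *\<^sub>R ((\<Sum>i\<in>UNIV. A i i) *\<^sub>R e)"
    using G2_swap[of A e] by (simp add: scaleR_2 eq_diff_eq)
  then show ?thesis by (simp only: scaleR_cancel_left) simp
qed

text \<open>The 4-form \<open>H\<^sub>i\<^sub>j\<^sub>m H\<^sub>m\<^sub>k\<^sub>l + cyclic (j k l)\<close>, which measures the difference between \<open>\<nabla>\<^sup>g H\<close> and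
  \<open>\<nabla>\<^sup>+ H\<close>.\<close>

definition quad_form :: "('n \<Rightarrow> 'n \<Rightarrow> 'n \<Rightarrow> real) \<Rightarrow> 'n \<Rightarrow> 'n \<Rightarrow> 'n \<Rightarrow> 'n \<Rightarrow> real" where
  "quad_form H i j k l = (\<Sum>m\<in>UNIV. H i j m * H m k l) + (\<Sum>m\<in>UNIV. H i k m * H m l j)
     + (\<Sum>m\<in>UNIV. H i l m * H m j k)"

section \<open>Clifford algebra of a single 3-form\<close>

context
  fixes H :: "'n \<Rightarrow> 'n \<Rightarrow> 'n \<Rightarrow> real"
  assumes skew12: "\<And>i j k. H i j k = - H j i k" and skew23: "\<And>i j k. H i j k = - H i k j"
begin

lemma H_cyclic: "H i j k = H j k i"
  using skew12[of i j k] skew23[of j i k] by simp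

text \<open>Each term of \<open>quad_form\<close> is, up to sign, an index permutation of
  \<open>Z\<close>, whose full Clifford contraction is the sum of the squares of the 2-forms
  \<open>H m\<close>. Every adjacent swap leaves a multiple of the symmetric tensor
  \<open>K\<close>, whose trace is the squared norm of \<open>H\<close>.\<close>

lemma G4_quad_form:
  "G4 (quad_form H) e = 3 *\<^sub>R (\<Sum>m\<in>UNIV. G2 (H m) (G2 (H m) e))
     + (6 * (\<Sum>i\<in>UNIV. \<Sum>j\<in>UNIV. \<Sum>k\<in>UNIV. H i j k * H i j k)) *\<^sub>R e"
proof -
  define Z where "Z i j k l = (\<Sum>m\<in>UNIV. H m i j * H m k l)" for i j k l
  define K where "K i j = (\<Sum>k\<in>UNIV. \<Sum>m\<in>UNIV. H m i k * H m j k)" for i j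
  define N where "N = (\<Sum>i\<in>UNIV. \<Sum>j\<in>UNIV. \<Sum>k\<in>UNIV. H i j k * H i j k)"
  have "G2 K e = (\<Sum>i\<in>UNIV. K i i) *\<^sub>R e"
    by (rule G2_symmetric) (simp add: K_def mult.commute)
  also have "(\<Sum>i\<in>UNIV. K i i) = (\<Sum>i\<in>UNIV. \<Sum>k\<in>UNIV. \<Sum>m\<in>UNIV. H i k m * H i k m)"
    unfolding K_def
  proof (intro sum.cong refl)
    fix i k m show "H m i k * H m i k = H i k m * H i k m"
      by (simp only: H_cyclic[of m i k])
  qed
  finally have K: "G2 K e = N *\<^sub>R e" by (simp add: N_def)
  have S: "quad_form H = (\<lambda>i j k l. Z i j k l + - Z i k j l + Z i l j k)"
  proof (intro ext)
    fix i j k l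
    have 1: "(\<Sum>m\<in>UNIV. H i j m * H m k l) = Z i j k l"
      unfolding Z_def by (simp only: H_cyclic[of _ i j])
    have 2: "(\<Sum>m\<in>UNIV. H i k m * H m l j) = - Z i k j l"
      unfolding Z_def sum_negf[symmetric]
    proof (intro sum.cong refl)
      fix m show "H i k m * H m l j = - (H m i k * H m j l)"
        using H_cyclic[of m i k] skew23[of m j l] by simp
    qed
    have 3: "(\<Sum>m\<in>UNIV. H i l m * H m j k) = Z i l j k"
      unfolding Z_def by (simp only: H_cyclic[of _ i l])
    show "quad_form H i j k l = Z i j k l + - Z i k j l + Z i l j k"
      unfolding quad_form_def 1 2 3 ..
  qed
  have Zt: "(\<lambda>i l. \<Sum>j\<in>UNIV. Z i j j l) = (\<lambda>i l. - K i l)"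
    unfolding Z_def K_def sum_negf[symmetric]
  proof (intro ext sum.cong refl)
    fix i l j m show "H m i j * H m j l = - (H m i j * H m l j)"
      using skew23[of m j l] by simp
  qed
  have 1: "G4 (\<lambda>i j k l. Z i k j l) e = - G4 Z e - (2 * N) *\<^sub>R e"
    unfolding G4_swap23[of Z] Zt G2_minus K by simp
  have "(\<lambda>i j. \<Sum>k\<in>UNIV. Z i k j k) = K"
    by (intro ext) (simp add: Z_def K_def)
  then have 2: "G4 (\<lambda>i j k l. Z i l j k) e = - G4 (\<lambda>i j k l. Z i k j l) e + (2 * N) *\<^sub>R e"
    using G4_swap34[of "\<lambda>i j k l. Z i k j l" e] K by simp
  have Z: "G4 Z e = (\<Sum>m\<in>UNIV. G2 (H m) (G2 (H m) e))"
  proof -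
    have "Z i j = (\<lambda>k l. \<Sum>m\<in>UNIV. H m i j * H m k l)" for i j
      by (intro ext) (simp add: Z_def)
    then have "G4 Z e = (\<Sum>i\<in>UNIV. \<Sum>j\<in>UNIV. \<Sum>m\<in>UNIV. H m i j *\<^sub>R \<gamma> i (\<gamma> j (G2 (H m) e)))"
      by (simp add: G4_def G3_def G2_sum G2_scale \<gamma>_sum \<gamma>_simps)
    also have "\<dots> = (\<Sum>i\<in>UNIV. \<Sum>m\<in>UNIV. \<Sum>j\<in>UNIV. H m i j *\<^sub>R \<gamma> i (\<gamma> j (G2 (H m) e)))"
      by (intro sum.cong refl sum.swap)
    also have "\<dots> = (\<Sum>m\<in>UNIV. \<Sum>i\<in>UNIV. \<Sum>j\<in>UNIV. H m i j *\<^sub>R \<gamma> i (\<gamma> j (G2 (H m) e)))"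
      by (rule sum.swap)
    finally show ?thesis
      by (simp add: G2_def[of "H _" "G2 _ _"] G1_def[of "H _ _" "G2 _ _"] \<gamma>_sum \<gamma>_simps)
  qed
  show ?thesis
    unfolding S G4_add G4_minus 2 1 N_def[symmetric] Z[symmetric]
    by (simp add: scaleR_3 algebra_simps scaleR_add_left[symmetric])
qed

text \<open>Pulling the terms of the outer \<open>G3 H\<close> through the inner one reproduces the
  square with the opposite sign, so twice the square consists of contractions. The commutators of
  \<open>H i\<close> with \<open>H\<close> assemble to \<open>quad_form\<close>.\<close>

lemma G3_square:
  "G3 H (G3 H e) = 9 *\<^sub>R (\<Sum>m\<in>UNIV. G2 (H m) (G2 (H m) e))
     + (12 * (\<Sum>i\<in>UNIV. \<Sum>j\<in>UNIV. \<Sum>k\<in>UNIV. H i j k * H i j k)) *\<^sub>R e"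
proof -
  have S: "(\<lambda>j k l. (\<Sum>m\<in>UNIV. H i j m * H m k l) + ((\<Sum>m\<in>UNIV. H i k m * H j m l)
        + (\<Sum>m\<in>UNIV. H i l m * H j k m))) = quad_form H i" for i
  proof (intro ext)
    fix j k l
    have "(\<Sum>m\<in>UNIV. H i k m * H j m l) = (\<Sum>m\<in>UNIV. H i k m * H m l j)"
      by (simp only: H_cyclic[of j])
    moreover have "(\<Sum>m\<in>UNIV. H i l m * H j k m) = (\<Sum>m\<in>UNIV. H i l m * H m j k)"
      by (simp only: H_cyclic[of _ j k])
    ultimately show "(\<Sum>m\<in>UNIV. H i j m * H m k l) + ((\<Sum>m\<in>UNIV. H i k m * H j m l)
        + (\<Sum>m\<in>UNIV. H i l m * H j k m)) = quad_form H i j k l"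
      by (simp add: quad_form_def)
  qed
  have "\<gamma> i (G2 (H i) (G3 H e)) = - G3 H (\<gamma> i (G2 (H i) e)) + 6 *\<^sub>R G2 (H i) (G2 (H i) e)
      + 4 *\<^sub>R \<gamma> i (G3 (quad_form H i) e)" for i
    unfolding G2_G3[of "H i", OF skew23] S using G3_\<gamma>[of H, OF skew12 skew23, of i]
    by (simp add: \<gamma>_simps)
  then have "G3 H (G3 H e) = - G3 H (G3 H e) + 6 *\<^sub>R (\<Sum>m\<in>UNIV. G2 (H m) (G2 (H m) e))
      + 4 *\<^sub>R G4 (quad_form H) e"
    by (subst G3_def, subst (2) G3_def)
       (simp add: G4_def sum.distrib sum_negf sum_subtractf linear_sum[OF linear_G3] scaleR_sum_right)
  then have "2 *\<^sub>R G3 H (G3 H e) = 6 *\<^sub>R (\<Sum>m\<in>UNIV. G2 (H m) (G2 (H m) e)) + 4 *\<^sub>R G4 (quad_form H) e"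
    unfolding scaleR_2 by (simp add: algebra_simps)
  also have "\<dots> = 2 *\<^sub>R (9 *\<^sub>R (\<Sum>m\<in>UNIV. G2 (H m) (G2 (H m) e))
     + (12 * (\<Sum>i\<in>UNIV. \<Sum>j\<in>UNIV. \<Sum>k\<in>UNIV. H i j k * H i j k)) *\<^sub>R e)"
    unfolding G4_quad_form by (simp add: scaleR_add_right add.assoc[symmetric] scaleR_add_left[symmetric])
  finally show ?thesis by (simp only: scaleR_cancel_left) simp
qed

lemma norm_H_eq_0:
  assumes "\<And>i. G2 (H i) e = 0" "e \<noteq> 0"
  shows "H i j k = 0"
proof -
  have "G3 H e = 0" by (simp add: G3_def assms(1) \<gamma>_simps)
  then have "(\<Sum>i\<in>UNIV. \<Sum>j\<in>UNIV. \<Sum>k\<in>UNIV. H i j k * H i j k) = 0"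
    using G3_square[of e] assms by (simp add: G3_simps G2_simps)
  then show ?thesis
    by (simp add: sum_nonneg_eq_0_iff sum_nonneg)
qed

text \<open>Here \<open>T\<close>, \<open>v\<close> and \<open>h\<close> are the pointwise values of
  the Levi-Civita derivative of \<open>H\<close>, the gradient and the Hessian of the dilaton.
  Contracting the derivative of the dilatino equation with generators gives one relation, applying
  \<open>H\<close> to the dilatino equation itself a second; the unknown spinors \<open>B\<close>
  and \<open>Q\<close> enter both in the combination \<open>B - (1/8) *\<^sub>R Q\<close> and are
  eliminated.\<close>

lemma dilaton_identity:
  assumes T: "\<And>i j k l. T i j k l = - T i k j l" "\<And>i j k l. T i j k l = - T i j l k"
    and e: "e \<noteq> 0"
    and dil: "G1 v e = (1/12) *\<^sub>R G3 H e"
    and ddil: "\<And>i. G1 (\<lambda>j. h i j - 1/2 * (\<Sum>m\<in>UNIV. H i j m * v m)) e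
        = (1/12) *\<^sub>R G3 (\<lambda>j k l. T i j k l - 1/2 * quad_form H i j k l) e"
    and h: "\<And>i j. h i j = h j i"
    and tr: "\<And>k l. (\<Sum>i\<in>UNIV. T i i k l) = 2 * (\<Sum>i\<in>UNIV. v i * H i k l)"
    and dH: "G4 (\<lambda>i j k l. T i j k l - T j i k l + T k i j l - T l i j k) e = 0"
  shows "(\<Sum>i\<in>UNIV. h i i) = 2 * (\<Sum>i\<in>UNIV. v i * v i)
    - (1/12) * (\<Sum>i\<in>UNIV. \<Sum>j\<in>UNIV. \<Sum>k\<in>UNIV. H i j k * H i j k)"
proof -
  define N where "N = (\<Sum>i\<in>UNIV. \<Sum>j\<in>UNIV. \<Sum>k\<in>UNIV. H i j k * H i j k)"
  define Q where "Q = (\<Sum>m\<in>UNIV. G2 (H m) (G2 (H m) e))"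
  define B where "B = (\<Sum>m\<in>UNIV. v m *\<^sub>R G2 (H m) e)"
  have B1: "G2 (\<lambda>k l. \<Sum>i\<in>UNIV. v i * H i k l) e = B"
    by (simp add: B_def G2_sum G2_scale)
  have B2: "G2 (\<lambda>i j. \<Sum>m\<in>UNIV. H i j m * v m) e = B"
  proof -
    have "(\<lambda>i j. \<Sum>m\<in>UNIV. H i j m * v m) = (\<lambda>k l. \<Sum>i\<in>UNIV. v i * H i k l)"
      by (intro ext sum.cong refl) (subst H_cyclic[symmetric], rule mult.commute)
    then show ?thesis using B1 by simp
  qed
  \<comment> \<open>The assumption on the exterior derivative leaves only the trace term of
    \<open>G4_alternation\<close>, and the divergence condition evaluates that trace.\<close>
  have "G4 T e = (1/4) *\<^sub>R (4 *\<^sub>R G4 T e)" by simp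
  also have "4 *\<^sub>R G4 T e = 12 *\<^sub>R G2 (\<lambda>k l. \<Sum>i\<in>UNIV. T i i k l) e"
    using dH unfolding G4_alternation[OF T] by simp
  also have "G2 (\<lambda>k l. \<Sum>i\<in>UNIV. T i i k l) e = 2 *\<^sub>R B"
    unfolding tr G2_scale B1 ..
  finally have GT: "G4 T e = 6 *\<^sub>R B" by simp
  have "G2 (\<lambda>i j. h i j - 1/2 * (\<Sum>m\<in>UNIV. H i j m * v m)) e
      = (1/12) *\<^sub>R G4 (\<lambda>i j k l. T i j k l - 1/2 * quad_form H i j k l) e"
    unfolding G2_def ddil G4_def by (simp add: \<gamma>_simps scaleR_sum_right)
  then have "G2 h e - (1/2) *\<^sub>R B = (1/12) *\<^sub>R (6 *\<^sub>R B - (1/2) *\<^sub>R (3 *\<^sub>R Q + (6 * N) *\<^sub>R e))"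
    unfolding G2_diff G2_scale G4_diff G4_scale GT B2 G4_quad_form Q_def[symmetric] N_def[symmetric] .
  moreover have "G2 h e = (\<Sum>i\<in>UNIV. h i i) *\<^sub>R e"
    by (rule G2_symmetric[OF h])
  ultimately have 1: "(\<Sum>i\<in>UNIV. h i i) *\<^sub>R e = B - (1/8) *\<^sub>R Q - (N / 4) *\<^sub>R e"
    by (simp add: algebra_simps) (simp add: scaleR_add_left[symmetric])
  have GH: "G3 H e = 12 *\<^sub>R G1 v e" using dil by simp
  \<comment> \<open>The square of the 3-form on \<open>e\<close> is computed a second time: the
    inner factor is replaced by \<open>12 *\<^sub>R G1 v e\<close>, and \<open>H\<close> is moved
    past \<open>v\<close> so that the dilatino equation applies again.\<close>
  have "G3 H (G1 v e) = (\<Sum>m\<in>UNIV. v m *\<^sub>R (- \<gamma> m (G3 H e) + 6 *\<^sub>R G2 (H m) e))"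
    unfolding G1_def by (simp add: linear_sum[OF linear_G3] G3_simps G3_\<gamma>[of H, OF skew12 skew23])
  also have "\<dots> = - G1 v (G3 H e) + 6 *\<^sub>R B"
    by (simp add: B_def G1_def scaleR_add_right scaleR_diff_right sum.distrib sum_negf sum_subtractf
        scaleR_sum_right mult.commute)
  also note GH
  also have "G1 v (12 *\<^sub>R G1 v e) = 12 *\<^sub>R G2 (\<lambda>i j. v i * v j) e"
    unfolding G1_simps by (simp add: G2_def G1_scale G1_def[of v "G1 v e"] \<gamma>_simps)
  also have "G2 (\<lambda>i j. v i * v j) e = (\<Sum>i\<in>UNIV. v i * v i) *\<^sub>R e"
    by (rule G2_symmetric) simp
  finally have "G3 H (G3 H e) = 12 *\<^sub>R (- (12 *\<^sub>R ((\<Sum>i\<in>UNIV. v i * v i) *\<^sub>R e)) + 6 *\<^sub>R B)"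
    by (simp only: GH G3_simps)
  then have "9 *\<^sub>R Q + (12 * N) *\<^sub>R e
      = 12 *\<^sub>R (- (12 *\<^sub>R ((\<Sum>i\<in>UNIV. v i * v i) *\<^sub>R e)) + 6 *\<^sub>R B)"
    unfolding G3_square Q_def N_def .
  then have "(1/72) *\<^sub>R (9 *\<^sub>R Q + (12 * N) *\<^sub>R e)
      = (1/72) *\<^sub>R (12 *\<^sub>R (- (12 *\<^sub>R ((\<Sum>i\<in>UNIV. v i * v i) *\<^sub>R e)) + 6 *\<^sub>R B))"
    by simp
  then have 2: "B = (1/8) *\<^sub>R Q + (N / 6) *\<^sub>R e + (2 * (\<Sum>i\<in>UNIV. v i * v i)) *\<^sub>R e"
    by (simp add: algebra_simps)
  have "(\<Sum>i\<in>UNIV. h i i) *\<^sub>R e = (N / 6 + 2 * (\<Sum>i\<in>UNIV. v i * v i) - N / 4) *\<^sub>R e"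
    unfolding 1 2 by (simp add: algebra_simps) (simp add: scaleR_add_left[symmetric])
  then have "(\<Sum>i\<in>UNIV. h i i) = N / 6 + 2 * (\<Sum>i\<in>UNIV. v i * v i) - N / 4"
    using e by simp
  then show ?thesis
    unfolding N_def[symmetric] by simp
qed

end

text \<open>At a fixed frame index, \<open>R\<close> is the curvature of the plus connection,
  \<open>D\<close> the exterior derivative of \<open>H\<close>, and \<open>n\<close> and
  \<open>N\<close> are the covariant derivatives of the dilaton gradient and of \<open>H\<close>.
  Integrability kills \<open>G3 R e\<close>, the cyclic identity expresses the Ricci-type trace of
  \<open>R\<close> by \<open>N\<close> and \<open>D\<close>, and the differentiated dilatino
  equation trades \<open>N\<close> for \<open>n\<close>.\<close>

lemma killing_ricci_identity:
  assumes skew: "\<And>j k l. R j k l = - R j l k"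
    and par: "\<And>j. G2 (R j) e = 0"
    and dil: "G1 n e = (1/12) *\<^sub>R G3 N e"
    and cyc: "\<And>j k l. R j k l + R k l j + R l j k = N j k l + 1/2 * D j k l"
  shows "G1 (\<lambda>l. (\<Sum>j\<in>UNIV. R j j l) + 2 * n l) e = - (1/12) *\<^sub>R G3 D e"
proof -
  have "G3 R e = 0" by (simp add: G3_def par \<gamma>_simps)
  then have "G3 N e + (1/2) *\<^sub>R G3 D e = - 6 *\<^sub>R G1 (\<lambda>l. \<Sum>j\<in>UNIV. R j j l) e"
    using G3_cyclic_sum[of R e, OF skew] unfolding cyc G3_add G3_scale by simp
  moreover have "G3 N e = 12 *\<^sub>R G1 n e" using dil by simp
  ultimately have "(- 1/6) *\<^sub>R (12 *\<^sub>R G1 n e + (1/2) *\<^sub>R G3 D e) = (- 1/6) *\<^sub>R (- 6 *\<^sub>R G1 (\<lambda>l. \<Sum>j\<in>UNIV. R j j l) e)"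
    by simp
  then have "G1 (\<lambda>l. \<Sum>j\<in>UNIV. R j j l) e = - 2 *\<^sub>R G1 n e - (1/12) *\<^sub>R G3 D e"
    by (simp add: algebra_simps)
  then show ?thesis
    by (simp add: G1_add G1_scale)
qed

text \<open>With \<open>i\<close> fixed the three products form a cyclic sum, so
  \<open>G3_cyclic_sum\<close> applies. Its trace term is the quadratic curvature term of the
  Einstein equation; the other term vanishes when the curvature annihilates the spinor.\<close>

lemma G3_trace_wedge:
  fixes R :: "'n \<Rightarrow> 'n \<Rightarrow> 'r::finite \<Rightarrow> 'r \<Rightarrow> real"
  assumes skew: "\<And>i j a b. R i j a b = - R j i a b"
  shows "G3 (\<lambda>j k l. 2 * (\<Sum>a\<in>UNIV. \<Sum>b\<in>UNIV. R i j a b * R k l a b + R j k a b * R i l a b + R k i a b * R j l a b)) e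
    = 6 *\<^sub>R (\<Sum>a\<in>UNIV. \<Sum>b\<in>UNIV. G1 (\<lambda>j. R i j a b) (G2 (\<lambda>k l. R k l a b) e))
      + 12 *\<^sub>R G1 (\<lambda>j. \<Sum>m\<in>UNIV. \<Sum>a\<in>UNIV. \<Sum>b\<in>UNIV. R i m a b * R j m a b) e"
proof -
  define X where "X j k l = (\<Sum>a\<in>UNIV. \<Sum>b\<in>UNIV. R i j a b * R k l a b)" for j k l
  have X: "X j k l = - X j l k" for j k l
    unfolding X_def sum_negf[symmetric]
  proof (intro sum.cong refl)
    fix a b show "R i j a b * R k l a b = - (R i j a b * R l k a b)"
      using skew[of k l a b] by simp
  qed
  have 1: "(\<lambda>j k l. 2 * (\<Sum>a\<in>UNIV. \<Sum>b\<in>UNIV. R i j a b * R k l a b + R j k a b * R i l a b + R k i a b * R j l a b))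
      = (\<lambda>j k l. 2 * (X j k l + X k l j + X l j k))"
  proof (intro ext)
    fix j k l
    have "R i j a b * R k l a b + R j k a b * R i l a b + R k i a b * R j l a b
      = R i j a b * R k l a b + R i k a b * R l j a b + R i l a b * R j k a b" for a b
      using skew[of k i a b] skew[of j l a b] by simp
    then show "2 * (\<Sum>a\<in>UNIV. \<Sum>b\<in>UNIV. R i j a b * R k l a b + R j k a b * R i l a b + R k i a b * R j l a b)
      = 2 * (X j k l + X k l j + X l j k)"
      by (simp add: X_def sum.distrib mult.commute)
  qed
  have 2: "G3 X e = (\<Sum>a\<in>UNIV. \<Sum>b\<in>UNIV. G1 (\<lambda>j. R i j a b) (G2 (\<lambda>k l. R k l a b) e))"
  proof -
    have "X j = (\<lambda>k l. \<Sum>a\<in>UNIV. \<Sum>b\<in>UNIV. R i j a b * R k l a b)" for j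
      by (intro ext) (simp add: X_def)
    then have "G3 X e = (\<Sum>j\<in>UNIV. \<Sum>a\<in>UNIV. \<Sum>b\<in>UNIV. R i j a b *\<^sub>R \<gamma> j (G2 (\<lambda>k l. R k l a b) e))"
      by (simp add: G3_def G2_sum G2_scale \<gamma>_sum \<gamma>_simps)
    also have "\<dots> = (\<Sum>a\<in>UNIV. \<Sum>j\<in>UNIV. \<Sum>b\<in>UNIV. R i j a b *\<^sub>R \<gamma> j (G2 (\<lambda>k l. R k l a b) e))"
      by (rule sum.swap)
    also have "\<dots> = (\<Sum>a\<in>UNIV. \<Sum>b\<in>UNIV. \<Sum>j\<in>UNIV. R i j a b *\<^sub>R \<gamma> j (G2 (\<lambda>k l. R k l a b) e))"
      by (intro sum.cong refl sum.swap)
    finally show ?thesis by (simp add: G1_def)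
  qed
  have 3: "(\<Sum>j\<in>UNIV. X j j l) = - (\<Sum>m\<in>UNIV. \<Sum>a\<in>UNIV. \<Sum>b\<in>UNIV. R i m a b * R l m a b)" for l
    unfolding X_def sum_negf[symmetric]
  proof (intro sum.cong refl)
    fix m a b show "R i m a b * R m l a b = - (R i m a b * R l m a b)"
      using skew[of m l a b] by simp
  qed
  show ?thesis
    unfolding 1 G3_scale G3_cyclic_sum[OF X] 2 3 G1_minus by (simp add: scaleR_diff_right scaleR_add_right)
qed

end

section \<open>Positivity and the instanton condition\<close>

locale inner_clifford_module = clifford_module \<gamma>
  for \<gamma> :: "'n::finite \<Rightarrow> 'v::real_inner \<Rightarrow> 'v"
begin

text \<open>Averaging over the finite group generated by the generators, one generator at a time.\<close>

lemma invariant_inner_product: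
  obtains h :: "'v \<Rightarrow> 'v \<Rightarrow> real" where
    "\<And>x. linear (h x)" "\<And>x y. h x y = h y x" "\<And>x. x \<noteq> 0 \<Longrightarrow> h x x > 0"
    "\<And>i x y. h (\<gamma> i x) (\<gamma> i y) = h x y"
proof -
  have "finite I \<Longrightarrow> \<exists>h :: 'v \<Rightarrow> 'v \<Rightarrow> real. (\<forall>x. linear (h x)) \<and> (\<forall>x y. h x y = h y x) \<and>
     (\<forall>x. x \<noteq> 0 \<longrightarrow> h x x > 0) \<and> (\<forall>i\<in>I. \<forall>x y. h (\<gamma> i x) (\<gamma> i y) = h x y)" for I
  proof (induction I rule: finite_induct)
    case empty
    show ?case
      by (intro exI[of _ inner])
         (simp add: inner_commute bounded_linear.linear[OF bounded_linear_inner_right])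
  next
    case (insert m I)
    from insert.IH obtain h :: "'v \<Rightarrow> 'v \<Rightarrow> real" where h': "(\<forall>x. linear (h x)) \<and> (\<forall>x y. h x y = h y x) \<and>
     (\<forall>x. x \<noteq> 0 \<longrightarrow> h x x > 0) \<and> (\<forall>i\<in>I. \<forall>x y. h (\<gamma> i x) (\<gamma> i y) = h x y)"
      by (rule exE)
    have h: "\<And>x. linear (h x)" "\<And>x y. h x y = h y x"
      "\<And>x. x \<noteq> 0 \<Longrightarrow> h x x > 0" "\<And>i x y. i \<in> I \<Longrightarrow> h (\<gamma> i x) (\<gamma> i y) = h x y"
      using h' by (fast, fast, fast, fast)
    \<comment> \<open>Adding the pullback under \<open>\<gamma> m\<close>, whose square is the
      identity, makes the product invariant under \<open>\<gamma> m\<close>. Invariance under the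
      earlier generators survives, because exchanging two generators introduces a sign in both
      arguments.\<close>
    define k where "k x y = h x y + h (\<gamma> m x) (\<gamma> m y)" for x y
    have sq: "\<gamma> i (\<gamma> i x) = x" for i x
      using clifford[of i i x] by (simp add: scaleR_2[symmetric])
    have neg: "h (- x) (- y) = h x y" for x y
      using linear_neg[OF h(1), of "- x" y] linear_neg[OF h(1), of y x] h(2)[of "- x" y] h(2)[of x y]
      by simp
    show ?case
    proof (intro exI[of _ k] conjI allI ballI impI)
      show "linear (k x)" for x
        unfolding k_def[abs_def]
        by (intro linear_compose_add h(1) linear_compose[OF linear_\<gamma> h(1), unfolded o_def])
      show "k x y = k y x" for x y
        using h(2) by (simp add: k_def)
      show "k x x > 0" if "x \<noteq> 0" for x
      proof -
        have "h (\<gamma> m x) (\<gamma> m x) \<ge> 0"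
          using h(3)[of "\<gamma> m x"] linear_0[OF h(1)] by (cases "\<gamma> m x = 0") (auto simp: less_imp_le)
        then show ?thesis using h(3)[OF that] by (simp add: k_def)
      qed
      fix i x y assume i: "i \<in> insert m I"
      show "k (\<gamma> i x) (\<gamma> i y) = k x y"
      proof (cases "i = m")
        case True
        then show ?thesis by (simp add: k_def sq)
      next
        case False
        then have "\<gamma> m (\<gamma> i x) = - \<gamma> i (\<gamma> m x)" for x
          using \<gamma>_swap[of m i x] by simp
        then show ?thesis using False i h(4) by (simp add: k_def neg)
      qed
    qed
  qed
  from this[of UNIV, OF finite] obtain h :: "'v \<Rightarrow> 'v \<Rightarrow> real" where
    h: "(\<forall>x. linear (h x)) \<and> (\<forall>x y. h x y = h y x) \<and>
     (\<forall>x. x \<noteq> 0 \<longrightarrow> h x x > 0) \<and> (\<forall>i\<in>UNIV. \<forall>x y. h (\<gamma> i x) (\<gamma> i y) = h x y)"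
    by (rule exE)
  show thesis
    by (rule that[of h]) (use h in \<open>fast+\<close>)
qed

text \<open>If \<open>R\<^sub>i\<^sub>j\<^sub>a\<^sub>b \<Gamma>\<^sup>j \<psi>\<^sub>a\<^sub>b = 0\<close> with \<open>\<psi>\<^sub>a\<^sub>b = R\<^sub>k\<^sub>l\<^sub>a\<^sub>b \<Gamma>\<^sup>k \<Gamma>\<^sup>l \<epsilon>\<close>, pairing with \<open>\<Gamma>\<^sup>i \<epsilon>\<close> gives
  \<open>\<bar>\<psi>\<bar>\<^sup>2 = 0\<close>.\<close>

lemma instanton_condition:
  fixes R :: "'n \<Rightarrow> 'n \<Rightarrow> 'r::finite \<Rightarrow> 'r \<Rightarrow> real"
  assumes skew: "\<And>i j a b. R i j a b = - R j i a b"
    and R: "\<And>i. (\<Sum>a\<in>UNIV. \<Sum>b\<in>UNIV. G1 (\<lambda>j. R i j a b) (G2 (\<lambda>k l. R k l a b) e)) = 0"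
  shows "G2 (\<lambda>k l. R k l a b) e = 0"
proof -
  obtain h :: "'v \<Rightarrow> 'v \<Rightarrow> real" where h: "\<And>x. linear (h x)" "\<And>x y. h x y = h y x"
    "\<And>x. x \<noteq> 0 \<Longrightarrow> h x x > 0" "\<And>i x y. h (\<gamma> i x) (\<gamma> i y) = h x y"
    using invariant_inner_product by blast
  define \<psi> where "\<psi> a b = G2 (\<lambda>k l. R k l a b) e" for a b
  have sq: "\<gamma> i (\<gamma> i x) = x" for i x
    using clifford[of i i x] by (simp add: scaleR_2[symmetric])
  have adj: "h (\<gamma> i x) y = h x (\<gamma> i y)" for i x y
    using h(4)[of i x "\<gamma> i y"] sq by simp
  have lin: "linear (\<lambda>x. h x y)" for y
  proof -
    have "(\<lambda>x. h x y) = h y" by (intro ext) (rule h(2))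
    then show ?thesis using h(1)[of y] by simp
  qed
  \<comment> \<open>The generators are self-adjoint for \<open>h\<close>, so the sum over
    \<open>i\<close> rebuilds \<open>\<psi> a b\<close> in the first argument, with the two
    generators in reversed order and hence with a minus sign.\<close>
  have "0 = (\<Sum>i\<in>UNIV. h (\<gamma> i e) (\<Sum>a\<in>UNIV. \<Sum>b\<in>UNIV. G1 (\<lambda>j. R i j a b) (\<psi> a b)))"
    by (simp add: \<psi>_def R linear_0[OF h(1)])
  also have "\<dots> = (\<Sum>i\<in>UNIV. \<Sum>a\<in>UNIV. \<Sum>b\<in>UNIV. \<Sum>j\<in>UNIV. R i j a b * h (\<gamma> j (\<gamma> i e)) (\<psi> a b))"
    by (simp add: G1_def linear_sum[OF h(1)] linear_scale[OF h(1)] adj)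
  also have "\<dots> = (\<Sum>a\<in>UNIV. \<Sum>i\<in>UNIV. \<Sum>b\<in>UNIV. \<Sum>j\<in>UNIV. R i j a b * h (\<gamma> j (\<gamma> i e)) (\<psi> a b))"
    by (rule sum.swap)
  also have "\<dots> = (\<Sum>a\<in>UNIV. \<Sum>b\<in>UNIV. \<Sum>i\<in>UNIV. \<Sum>j\<in>UNIV. R i j a b * h (\<gamma> j (\<gamma> i e)) (\<psi> a b))"
    by (intro sum.cong refl sum.swap)
  also have "\<dots> = (\<Sum>a\<in>UNIV. \<Sum>b\<in>UNIV. - h (\<psi> a b) (\<psi> a b))"
  proof (intro sum.cong refl)
    fix a b
    have "(\<Sum>i\<in>UNIV. \<Sum>j\<in>UNIV. R i j a b * h (\<gamma> j (\<gamma> i e)) (\<psi> a b))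
       = (\<Sum>j\<in>UNIV. \<Sum>i\<in>UNIV. R i j a b * h (\<gamma> j (\<gamma> i e)) (\<psi> a b))"
      by (rule sum.swap)
    also have "\<dots> = h (G2 (\<lambda>j i. R i j a b) e) (\<psi> a b)"
      by (simp add: G2_def G1_def \<gamma>_sum \<gamma>_simps linear_sum[OF lin] linear_scale[OF lin])
    also have "G2 (\<lambda>j i. R i j a b) e = - \<psi> a b"
    proof -
      have "(\<lambda>j i. R i j a b) = (\<lambda>j i. - R j i a b)"
        by (intro ext) (rule skew)
      then show ?thesis by (simp only: G2_minus \<psi>_def)
    qed
    also have "h (- \<psi> a b) (\<psi> a b) = - h (\<psi> a b) (\<psi> a b)"
      by (rule linear_neg[OF lin])
    finally show "(\<Sum>i\<in>UNIV. \<Sum>j\<in>UNIV. R i j a b * h (\<gamma> j (\<gamma> i e)) (\<psi> a b)) = - h (\<psi> a b) (\<psi> a b)" .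
  qed
  finally have "(\<Sum>a\<in>UNIV. \<Sum>b\<in>UNIV. h (\<psi> a b) (\<psi> a b)) = 0"
    by (simp add: sum_negf)
  moreover have "h (\<psi> a b) (\<psi> a b) \<ge> 0" for a b
    using h(3)[of "\<psi> a b"] linear_0[OF h(1)] by (cases "\<psi> a b = 0") (auto simp: less_imp_le)
  ultimately have "h (\<psi> a b) (\<psi> a b) = 0"
    by (simp add: sum_nonneg_eq_0_iff sum_nonneg)
  then show ?thesis
    using h(3)[of "\<psi> a b"] by (auto simp: \<psi>_def)
qed

end

section \<open>Orthonormal frames and the Levi-Civita connection\<close>

context chart
begin

lemma vd_cong:
  assumes "\<And>y. y \<in> P \<Longrightarrow> f y = g y" "sm g" "x \<in> P"
  shows "vd M a X f x = vd M a X g x"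
  unfolding vd_at[of M a X] using assms by (rule dv_cong)

lemma vd_const [simp]: "vd M a X (\<lambda>_. c) x = 0"
  unfolding vd_at[of M a X] by (rule dv_const)

lemma vd_add: "sm f \<Longrightarrow> sm g \<Longrightarrow> x \<in> P \<Longrightarrow> vd M a X (\<lambda>x. f x + g x) x = vd M a X f x + vd M a X g x"
  unfolding vd_at[of M a X] by (rule dv_add)

lemma vd_diff: "sm f \<Longrightarrow> sm g \<Longrightarrow> x \<in> P \<Longrightarrow> vd M a X (\<lambda>x. f x - g x) x = vd M a X f x - vd M a X g x"
  unfolding vd_at[of M a X] by (rule dv_diff)

lemma vd_scaleR:
  "sm f \<Longrightarrow> sm g \<Longrightarrow> x \<in> P \<Longrightarrow>
    vd M a X (\<lambda>x. f x *\<^sub>R g x) x = f x *\<^sub>R vd M a X g x + vd M a X f x *\<^sub>R g x"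
  unfolding vd_at[of M a X] by (rule dv_scaleR)

lemma vd_cmult: "sm f \<Longrightarrow> x \<in> P \<Longrightarrow> vd M a X (\<lambda>x. c *\<^sub>R f x) x = c *\<^sub>R vd M a X f x"
  unfolding vd_at[of M a X] by (rule dv_cmult)

lemma vd_sum:
  "(\<And>i. i \<in> I \<Longrightarrow> sm (f i)) \<Longrightarrow> x \<in> P \<Longrightarrow> vd M a X (\<lambda>x. \<Sum>i\<in>I. f i x) x = (\<Sum>i\<in>I. vd M a X (f i) x)"
  unfolding vd_at[of M a X] by (rule dv_sum)

lemma vd_bounded_linear:
  "bounded_linear h \<Longrightarrow> sm f \<Longrightarrow> x \<in> P \<Longrightarrow> vd M a X (\<lambda>x. h (f x)) x = h (vd M a X f x)"
  unfolding vd_at[of M a X] by (rule dv_bounded_linear)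

end

locale riemannian_chart = chart M a for M :: "('i, 'm) spin_mfd" and a +
  assumes g_bilinear: "x \<in> P \<Longrightarrow> bilinear (gmet M a x)"
    and g_sym: "x \<in> P \<Longrightarrow> gmet M a x u v = gmet M a x v u"
    and sm_g: "sm (\<lambda>x. gmet M a x u v)"
    and sm_frame [simp, intro]: "sm (frame M a i)"
    and orthonormal: "x \<in> P \<Longrightarrow> gmet M a x (frame M a i x) (frame M a j x) = (if i = j then 1 else 0)"
begin

abbreviation e where "e \<equiv> frame M a"
abbreviation D where "D i \<equiv> vd M a (frame M a i)"

lemma g_linear_left: "x \<in> P \<Longrightarrow> linear (\<lambda>u. gmet M a x u v)"
  using g_bilinear by (simp add: bilinear_def)
lemma g_linear_right: "x \<in> P \<Longrightarrow> linear (gmet M a x u)"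
  using g_bilinear by (simp add: bilinear_def)

lemmas g_simps = linear_add[OF g_linear_left] linear_diff[OF g_linear_left] linear_scale[OF g_linear_left]
  linear_0[OF g_linear_left] linear_neg[OF g_linear_left] linear_sum[OF g_linear_left]

lemma sm_g_fields [intro]: "sm X \<Longrightarrow> sm Y \<Longrightarrow> sm (\<lambda>y. gmet M a y (X y) (Y y))"
  by (rule sm_linear2) (auto intro: g_linear_left g_linear_right sm_g)

lemma g_frame_sum:
  assumes x: "x \<in> P"
  shows "gmet M a x (\<Sum>k\<in>UNIV. c k *\<^sub>R e k x) (e l x) = c l"
proof -
  have "gmet M a x (\<Sum>k\<in>UNIV. c k *\<^sub>R e k x) (e l x) = (\<Sum>k\<in>UNIV. if k = l then c k else 0)"
    using x by (simp add: g_simps orthonormal if_distrib[of "(*) _"] cong: if_cong)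
  then show ?thesis by simp
qed

text \<open>Orthonormality gives \<open>f \<circ> t = id\<close>; for linear maps of the same
  finite-dimensional space a one-sided inverse is two-sided, so the six orthonormal vectors
  span.\<close>

lemma frame_expansion:
  assumes x: "x \<in> P"
  shows "v = (\<Sum>k\<in>UNIV. gmet M a x v (e k x) *\<^sub>R e k x)"
proof -
  define f where "f v = (\<chi> k. gmet M a x v (e k x))" for v
  define t where "t w = (\<Sum>k\<in>UNIV. (w $ k) *\<^sub>R e k x)" for w :: "real^6"
  have "linear f"
    by (rule linearI) (simp_all add: f_def vec_eq_iff g_simps x)
  moreover have "linear t"
    by (rule linearI) (simp_all add: t_def scaleR_add_left sum.distrib scaleR_sum_right)
  moreover have "f \<circ> t = id"
    by (rule ext) (simp add: f_def t_def vec_eq_iff g_frame_sum[OF x])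
  ultimately have "t \<circ> f = id"
    using linear_inverse_left by blast
  then have "t (f v) = v" by (metis comp_apply id_apply)
  then show ?thesis by (simp add: f_def t_def)
qed

lemma g_right_expansion:
  assumes "linear f" "x \<in> P"
  shows "(\<Sum>k\<in>UNIV. gmet M a x w (e k x) *\<^sub>R f (e k x)) = f w"
proof -
  have "f w = f (\<Sum>k\<in>UNIV. gmet M a x w (e k x) *\<^sub>R e k x)"
    using frame_expansion[OF assms(2), of w] by simp
  then show ?thesis using assms(1) by (simp add: linear_sum linear_scale)
qed

text \<open>The part of the Levi-Civita connection that is bilinear and symmetric at each point,
  separated from the coordinate derivative of the second field.\<close>

definition chr where
  "chr x u v = (\<Sum>k\<in>UNIV. christoffel M a x u v (e k x) *\<^sub>R e k x)"

lemma chr_sym: "x \<in> P \<Longrightarrow> chr x u v = chr x v u"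
proof -
  assume x: "x \<in> P"
  have "dv w (\<lambda>y. gmet M a y u v) x = dv w (\<lambda>y. gmet M a y v u) x" for w
    by (rule dv_cong[OF _ _ x]) (auto intro: g_sym sm_g)
  then show ?thesis
    by (simp add: chr_def christoffel_def algebra_simps)
qed

lemma dv_g_linear:
  assumes x: "x \<in> P"
  shows "linear (\<lambda>u. dv w (\<lambda>y. gmet M a y u v) x)" "linear (\<lambda>v. dv w (\<lambda>y. gmet M a y u v) x)"
proof -
  have 1: "dv w (\<lambda>y. gmet M a y (u + u') v) x = dv w (\<lambda>y. gmet M a y u v) x + dv w (\<lambda>y. gmet M a y u' v) x"
    for u u' v
  proof -
    have "dv w (\<lambda>y. gmet M a y (u + u') v) x = dv w (\<lambda>y. gmet M a y u v + gmet M a y u' v) x"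
      by (rule dv_cong[OF _ _ x]) (auto simp: g_simps intro: sm_g)
    then show ?thesis by (simp add: dv_add sm_g x)
  qed
  have 2: "dv w (\<lambda>y. gmet M a y (c *\<^sub>R u) v) x = c *\<^sub>R dv w (\<lambda>y. gmet M a y u v) x" for c u v
  proof -
    have "dv w (\<lambda>y. gmet M a y (c *\<^sub>R u) v) x = dv w (\<lambda>y. c *\<^sub>R gmet M a y u v) x"
      by (rule dv_cong[OF _ sm_cmult[OF sm_g] x]) (simp add: g_simps)
    then show ?thesis by (simp add: dv_cmult sm_g x del: real_scaleR_def)
  qed
  show *: "linear (\<lambda>u. dv w (\<lambda>y. gmet M a y u v) x)" for v
    by (rule linearI) (rule 1, rule 2)
  have "dv w (\<lambda>y. gmet M a y u v) x = dv w (\<lambda>y. gmet M a y v u) x" for v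
    by (rule dv_cong[OF _ _ x]) (auto intro: g_sym sm_g)
  then show "linear (\<lambda>v. dv w (\<lambda>y. gmet M a y u v) x)"
    using * by simp
qed

lemma christoffel_linear:
  assumes x: "x \<in> P"
  shows "linear (\<lambda>u. christoffel M a x u v w)" "linear (\<lambda>v. christoffel M a x u v w)"
    "linear (\<lambda>w. christoffel M a x u v w)"
proof -
  note l = dv_g_linear[OF x] dv_linear[OF sm_g x]
  have h: "linear (\<lambda>r::real. r / 2)"
    by (rule linearI) (simp_all add: add_divide_distrib)
  note s = linear_compose[OF _ h, unfolded o_def] linear_compose_add linear_compose_sub
  show "linear (\<lambda>u. christoffel M a x u v w)" "linear (\<lambda>v. christoffel M a x u v w)"
    "linear (\<lambda>w. christoffel M a x u v w)"
    unfolding christoffel_def by (intro s l)+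
qed

lemma chr_linear:
  assumes x: "x \<in> P"
  shows "linear (\<lambda>u. chr x u v)" "linear (\<lambda>v. chr x u v)"
proof -
  have h: "linear (\<lambda>r::real. r *\<^sub>R w)" for w :: "real^6"
    by (rule linearI) (simp_all add: scaleR_add_left)
  show "linear (\<lambda>u. chr x u v)" "linear (\<lambda>v. chr x u v)"
    unfolding chr_def
    by (intro linear_compose_sum ballI linear_compose[OF christoffel_linear(1)[OF x] h, unfolded o_def]
      linear_compose[OF christoffel_linear(2)[OF x] h, unfolded o_def])+
qed

lemma g_chr: "x \<in> P \<Longrightarrow> gmet M a x (chr x u v) (e l x) = christoffel M a x u v (e l x)"
  unfolding chr_def by (rule g_frame_sum)

lemma nabla_g_eq: "nabla_g M a X Y x = dv (X x) Y x + chr x (X x) (Y x)"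
  by (simp add: nabla_g_def chr_def vd_at[of M a X])

definition W where "W i j k x = gmet M a x (nabla_g M a (e i) (e j) x) (e k x)"

lemma nabla_g_frame: "x \<in> P \<Longrightarrow> nabla_g M a (e i) (e j) x = (\<Sum>k\<in>UNIV. W i j k x *\<^sub>R e k x)"
  unfolding W_def by (rule frame_expansion)

lemma sm_christoffel:
  assumes "sm X" "sm Y" "sm Z"
  shows "sm (\<lambda>x. christoffel M a x (X x) (Y x) (Z x))"
proof (rule sm_linear3[OF christoffel_linear(3) christoffel_linear(2) christoffel_linear(1) _ assms])
  show "sm (\<lambda>y. christoffel M a y u v w)" for u v w
  proof -
    have "sm (\<lambda>y. (1/2) *\<^sub>R (dv u (\<lambda>y. gmet M a y v w) y + dv v (\<lambda>y. gmet M a y u w) y - dv w (\<lambda>y. gmet M a y u v) y))"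
      by (intro sm_cmult sm_add sm_diff sm_dv sm_g)
    then show ?thesis by (simp add: christoffel_def)
  qed
qed

lemma sm_nabla_g [intro, simp]: "sm X \<Longrightarrow> sm Y \<Longrightarrow> sm (nabla_g M a X Y)"
  unfolding nabla_g_def[abs_def] by (intro sm_add sm_vd sm_sum sm_scaleR sm_christoffel sm_frame)

lemma sm_W [intro, simp]: "sm (W i j k)"
  unfolding W_def[abs_def] by (intro sm_g_fields sm_nabla_g sm_frame)

text \<open>Differentiate the constant inner products of frame vectors: the two Christoffel symbols
  that arise add up to the derivative of the metric.\<close>

lemma W_skew:
  assumes x: "x \<in> P"
  shows "W i j k x = - W i k j x"
proof -
  have "0 = D i (\<lambda>y. gmet M a y (e j y) (e k y)) x"
    using vd_cong[of "\<lambda>y. gmet M a y (e j y) (e k y)" "\<lambda>_. if j = k then 1 else 0" x "e i"] x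
    by (simp add: orthonormal)
  also have "\<dots> = dv (e i x) (\<lambda>y. gmet M a y (e j x) (e k x)) x
      + gmet M a x (dv (e i x) (e j) x) (e k x) + gmet M a x (e j x) (dv (e i x) (e k) x)"
    unfolding vd_at[of M a "e i"]
    by (rule dv_linear2) (auto simp: x intro: g_linear_left g_linear_right sm_g)
  also have "dv (e i x) (\<lambda>y. gmet M a y (e j x) (e k x)) x
      = christoffel M a x (e i x) (e j x) (e k x) + christoffel M a x (e i x) (e k x) (e j x)"
  proof -
    have "dv (e i x) (\<lambda>y. gmet M a y (e j x) (e k x)) x = dv (e i x) (\<lambda>y. gmet M a y (e k x) (e j x)) x"
      by (rule dv_cong[OF _ _ x]) (auto intro: g_sym sm_g)
    then show ?thesis by (simp add: christoffel_def field_simps)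
  qed
  also have "gmet M a x (e j x) (dv (e i x) (e k) x) = gmet M a x (dv (e i x) (e k) x) (e j x)"
    by (rule g_sym[OF x])
  finally show ?thesis
    unfolding W_def nabla_g_eq by (simp add: g_simps g_chr x)
qed

text \<open>Structure functions of the frame: the Levi-Civita connection is torsion-free, so these
  differences are the components of the brackets of frame fields.\<close>

definition C where "C i j k x = W i j k x - W j i k x"

lemma sm_C [intro, simp]: "sm (C i j k)"
  unfolding C_def[abs_def] by (intro sm_diff sm_W)

lemma bracket_frame:
  assumes x: "x \<in> P"
  shows "bracket M a (e i) (e j) x = (\<Sum>m\<in>UNIV. C i j m x *\<^sub>R e m x)"
proof -
  have "bracket M a (e i) (e j) x = nabla_g M a (e i) (e j) x - nabla_g M a (e j) (e i) x"
    by (simp add: bracket_def nabla_g_eq chr_sym[OF x, of "e i x"] vd_at[of M a "e i"] vd_at[of M a "e j"])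
  then show ?thesis
    by (simp add: nabla_g_frame[OF x] C_def scaleR_diff_left sum_subtractf)
qed

lemma D_commutator:
  fixes f :: "'m \<Rightarrow> 'b::euclidean_space"
  assumes f: "sm f" and x: "x \<in> P"
  shows "D i (D j f) x - D j (D i f) x = (\<Sum>m\<in>UNIV. C i j m x *\<^sub>R D m f x)"
proof -
  have "D i (D j f) x - D j (D i f) x = dv (bracket M a (e i) (e j) x) f x"
    by (rule vd_commutator[OF sm_frame sm_frame f x])
  also have "\<dots> = (\<Sum>m\<in>UNIV. C i j m x *\<^sub>R dv (e m x) f x)"
    unfolding bracket_frame[OF x]
    by (simp add: linear_sum[OF dv_linear[OF f x]] linear_scale[OF dv_linear[OF f x]])
  finally show ?thesis by (simp add: vd_at[of M a "e _"])
qed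

text \<open>Differentiate each bracket of two frame fields along the third and add cyclically; the
  second derivatives of the frame reduce to commutators, which \<open>C\<close> describes again.
  This becomes the first Bianchi identity.\<close>

lemma jacobi:
  assumes x: "x \<in> P"
  shows "D i (C j k l) x + D j (C k i l) x + D k (C i j l) x
    + (\<Sum>m\<in>UNIV. C j k m x * C i m l x + C k i m x * C j m l x + C i j m x * C k m l x) = 0"
proof -
  have br: "D i (e j) y - D j (e i) y = (\<Sum>m\<in>UNIV. C i j m y *\<^sub>R e m y)" if "y \<in> P" for i j y
    using bracket_frame[OF that, of i j] by (simp add: bracket_def)
  have 1: "D i (D j (e k)) x - D i (D k (e j)) x
      = (\<Sum>m\<in>UNIV. C j k m x *\<^sub>R D i (e m) x) + (\<Sum>m\<in>UNIV. D i (C j k m) x *\<^sub>R e m x)" for i j k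
  proof -
    have "D i (D j (e k)) x - D i (D k (e j)) x = D i (\<lambda>y. D j (e k) y - D k (e j) y) x"
      by (rule vd_diff[symmetric]) (auto simp: x)
    also have "\<dots> = D i (\<lambda>y. \<Sum>m\<in>UNIV. C j k m y *\<^sub>R e m y) x"
      by (rule vd_cong[OF br _ x]) auto
    also have "\<dots> = (\<Sum>m\<in>UNIV. C j k m x *\<^sub>R D i (e m) x + D i (C j k m) x *\<^sub>R e m x)"
      by (simp add: vd_sum vd_scaleR x)
    finally show ?thesis by (simp add: sum.distrib)
  qed
  have 2: "D i (D j (e k)) x - D j (D i (e k)) x = (\<Sum>m\<in>UNIV. C i j m x *\<^sub>R D m (e k) x)" for i j k
    by (rule D_commutator[OF sm_frame x])
  have 3: "(\<Sum>m\<in>UNIV. C j k m x *\<^sub>R D i (e m) x) - (\<Sum>m\<in>UNIV. C j k m x *\<^sub>R D m (e i) x)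
      = (\<Sum>n\<in>UNIV. (\<Sum>m\<in>UNIV. C j k m x * C i m n x) *\<^sub>R e n x)" for i j k
  proof -
    have "(\<Sum>m\<in>UNIV. C j k m x *\<^sub>R D i (e m) x) - (\<Sum>m\<in>UNIV. C j k m x *\<^sub>R D m (e i) x)
      = (\<Sum>m\<in>UNIV. C j k m x *\<^sub>R (D i (e m) x - D m (e i) x))"
      by (simp add: scaleR_diff_right sum_subtractf)
    also have "\<dots> = (\<Sum>m\<in>UNIV. \<Sum>n\<in>UNIV. (C j k m x * C i m n x) *\<^sub>R e n x)"
      by (simp add: br[OF x] scaleR_sum_right)
    also have "\<dots> = (\<Sum>n\<in>UNIV. \<Sum>m\<in>UNIV. (C j k m x * C i m n x) *\<^sub>R e n x)"
      by (rule sum.swap)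
    finally show ?thesis by (simp add: scaleR_sum_left)
  qed
  define J where "J i j k n = D i (C j k n) x + (\<Sum>m\<in>UNIV. C j k m x * C i m n x)" for i j k n
  have 4: "(\<Sum>n\<in>UNIV. J i j k n *\<^sub>R e n x) = D i (D j (e k)) x - D i (D k (e j)) x
     - (\<Sum>m\<in>UNIV. C j k m x *\<^sub>R D m (e i) x)" for i j k
    unfolding 1 J_def using 3[of j k i] by (simp add: scaleR_add_left sum.distrib algebra_simps)
  have "(\<Sum>n\<in>UNIV. (J i j k n + J j k i n + J k i j n) *\<^sub>R e n x) = 0"
    unfolding scaleR_add_left sum.distrib 4 2[symmetric] by (simp add: algebra_simps)
  then have "gmet M a x (\<Sum>n\<in>UNIV. (J i j k n + J j k i n + J k i j n) *\<^sub>R e n x) (e l x) = 0"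
    by (simp add: g_simps x)
  then have "J i j k l + J j k i l + J k i j l = 0"
    unfolding g_frame_sum[OF x] .
  then show ?thesis
    by (simp add: J_def sum.distrib algebra_simps)
qed

end

section \<open>Frame components of connections and curvature\<close>

locale torsion_chart = riemannian_chart M a for M :: "('i, 'm) spin_mfd" and a +
  fixes H :: "('i, 'm) form3"
  assumes H_linear1: "x \<in> P \<Longrightarrow> linear (\<lambda>u. H a x u v w)"
    and H_skew12: "x \<in> P \<Longrightarrow> H a x v u w = - H a x u v w"
    and H_skew23: "x \<in> P \<Longrightarrow> H a x u w v = - H a x u v w"
    and sm_H: "sm (\<lambda>x. H a x u v w)"
begin

lemma H_linear2:
  assumes x: "x \<in> P"
  shows "linear (\<lambda>v. H a x u v w)"
proof -
  have "(\<lambda>v. H a x u v w) = (\<lambda>v. - H a x v u w)"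
    by (intro ext) (rule H_skew12[OF x])
  then show ?thesis
    using linear_compose_neg[OF H_linear1[OF x, of u w]] by simp
qed

lemma H_linear3:
  assumes x: "x \<in> P"
  shows "linear (\<lambda>w. H a x u v w)"
proof -
  have "(\<lambda>w. H a x u v w) = (\<lambda>w. - H a x u w v)"
    by (intro ext) (rule H_skew23[OF x])
  then show ?thesis
    using linear_compose_neg[OF H_linear2[OF x, of u v]] by simp
qed

abbreviation Hc where "Hc i j k x \<equiv> H_comp M H a x i j k"

lemma sm_Hc [intro, simp]: "sm (Hc i j k)"
  unfolding H_comp_def by (rule sm_linear3) (auto intro: H_linear1 H_linear2 H_linear3 sm_H)

lemma Hc_skew12: "x \<in> P \<Longrightarrow> Hc i j k x = - Hc j i k x"
  unfolding H_comp_def by (rule H_skew12)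
lemma Hc_skew23: "x \<in> P \<Longrightarrow> Hc i j k x = - Hc i k j x"
  unfolding H_comp_def by (rule H_skew23)

definition Wc where "Wc c i j k x = W i j k x + c / 2 * Hc i j k x"

lemma sm_Wc [intro, simp]: "sm (Wc c i j k)"
proof -
  have "sm (\<lambda>x. W i j k x + (c/2) *\<^sub>R Hc i j k x)"
    by (intro sm_add sm_W sm_cmult sm_Hc)
  then show ?thesis by (simp add: Wc_def[abs_def])
qed

lemma Wc_skew: "x \<in> P \<Longrightarrow> Wc c i j k x = - Wc c i k j x"
  unfolding Wc_def using W_skew[of x i j k] Hc_skew23[of x i j k] by simp

definition conn where
  "conn c x u v = chr x u v + (\<Sum>k\<in>UNIV. (c / 2 * H a x u v (e k x)) *\<^sub>R e k x)"

lemma conn_linear: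
  assumes x: "x \<in> P"
  shows "linear (\<lambda>u. conn c x u v)" "linear (\<lambda>v. conn c x u v)"
proof -
  have h: "linear (\<lambda>r::real. (c / 2 * r) *\<^sub>R w)" for w :: "real^6"
    by (rule linearI) (simp_all add: distrib_left scaleR_add_left)
  show "linear (\<lambda>u. conn c x u v)" "linear (\<lambda>v. conn c x u v)"
    unfolding conn_def
    by (intro linear_compose_add chr_linear[OF x] linear_compose_sum ballI
      linear_compose[OF H_linear1[OF x] h, unfolded o_def]
      linear_compose[OF H_linear2[OF x] h, unfolded o_def])+
qed

lemma nabla_eq: "nabla M H c a X Y x = dv (X x) Y x + conn c x (X x) (Y x)"
  by (simp add: nabla_def nabla_g_eq conn_def)

lemma nabla_0: "nabla M H 0 a = nabla_g M a"
  by (intro ext) (simp add: nabla_def)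

lemma nabla_frame:
  assumes x: "x \<in> P"
  shows "nabla M H c a (e i) (e j) x = (\<Sum>k\<in>UNIV. Wc c i j k x *\<^sub>R e k x)"
  by (simp add: nabla_def nabla_g_frame[OF x] Wc_def scaleR_add_left sum.distrib H_comp_def)

lemma g_nabla_frame: "x \<in> P \<Longrightarrow> gmet M a x (nabla M H c a (e i) (e j) x) (e k x) = Wc c i j k x"
  by (simp add: nabla_frame g_frame_sum)

lemma nabla_cong:
  assumes "\<And>y. y \<in> P \<Longrightarrow> Y y = Z y" "sm Z" "x \<in> P"
  shows "nabla M H c a X Y x = nabla M H c a X Z x"
  using dv_cong[OF assms] assms by (simp add: nabla_eq)

lemma nabla_frame_sum:
  assumes f: "\<And>m. sm (f m)" and x: "x \<in> P"
  shows "nabla M H c a (e i) (\<lambda>y. \<Sum>m\<in>UNIV. f m y *\<^sub>R e m y) x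
    = (\<Sum>m\<in>UNIV. D i (f m) x *\<^sub>R e m x + f m x *\<^sub>R nabla M H c a (e i) (e m) x)"
  using f x
  by (simp add: nabla_eq dv_sum dv_scaleR linear_sum[OF conn_linear(2)] linear_scale[OF conn_linear(2)]
      vd_at[of M a "e i"] sum.distrib scaleR_add_right)

lemma nabla_direction:
  assumes Z: "sm Z" and x: "x \<in> P" and X: "X x = (\<Sum>m\<in>UNIV. f m *\<^sub>R e m x)"
  shows "nabla M H c a X Z x = (\<Sum>m\<in>UNIV. f m *\<^sub>R nabla M H c a (e m) Z x)"
  unfolding nabla_eq X
  by (simp add: linear_sum[OF dv_linear[OF Z x]] linear_scale[OF dv_linear[OF Z x]]
      linear_sum[OF conn_linear(1)[OF x]] linear_scale[OF conn_linear(1)[OF x]] sum.distrib scaleR_add_right)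

lemma R_comp_eq:
  assumes x: "x \<in> P"
  shows "R_comp M H c a x i j k l = D i (Wc c j k l) x - D j (Wc c i k l) x
    + (\<Sum>m\<in>UNIV. Wc c j k m x * Wc c i m l x - Wc c i k m x * Wc c j m l x - C i j m x * Wc c m k l x)"
proof -
  have 1: "nabla M H c a (e i) (nabla M H c a (e j) (e k)) x
    = (\<Sum>m\<in>UNIV. D i (Wc c j k m) x *\<^sub>R e m x + Wc c j k m x *\<^sub>R nabla M H c a (e i) (e m) x)" for i j
  proof -
    have "nabla M H c a (e i) (nabla M H c a (e j) (e k)) x
       = nabla M H c a (e i) (\<lambda>y. \<Sum>m\<in>UNIV. Wc c j k m y *\<^sub>R e m y) x"
      by (rule nabla_cong[OF nabla_frame _ x]) auto
    then show ?thesis by (simp add: nabla_frame_sum x)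
  qed
  have 2: "gmet M a x (nabla M H c a (e i) (nabla M H c a (e j) (e k)) x) (e l x)
    = D i (Wc c j k l) x + (\<Sum>m\<in>UNIV. Wc c j k m x * Wc c i m l x)" for i j
    unfolding 1 using g_frame_sum[OF x, of "\<lambda>m. D i (Wc c j k m) x" l]
    by (simp add: sum.distrib linear_add[OF g_linear_left[OF x]] linear_sum[OF g_linear_left[OF x]]
        linear_scale[OF g_linear_left[OF x]] g_nabla_frame[OF x])
  have 3: "gmet M a x (nabla M H c a (bracket M a (e i) (e j)) (e k) x) (e l x) = (\<Sum>m\<in>UNIV. C i j m x * Wc c m k l x)"
    unfolding nabla_direction[OF sm_frame x, of "bracket M a (e i) (e j)", OF bracket_frame[OF x]]
    by (simp add: linear_sum[OF g_linear_left[OF x]] linear_scale[OF g_linear_left[OF x]] g_nabla_frame[OF x])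
  show ?thesis
    unfolding R_comp_def curvature_def
    by (simp add: linear_diff[OF g_linear_left[OF x]] 2 3 sum_subtractf)
qed

lemma R_comp_skew12: "x \<in> P \<Longrightarrow> R_comp M H c a x i j k l = - R_comp M H c a x j i k l"
  by (simp add: R_comp_eq C_def sum_subtractf sum.distrib sum_negf algebra_simps)

lemma D_minus: "sm f \<Longrightarrow> x \<in> P \<Longrightarrow> vd M a X (\<lambda>x. - f x) x = - vd M a X f x"
  unfolding vd_at[of M a X] by (rule dv_minus)

lemma R_comp_skew34:
  assumes x: "x \<in> P"
  shows "R_comp M H c a x i j k l = - R_comp M H c a x i j l k"
proof -
  have d: "D i (Wc c j k l) x = - D i (Wc c j l k) x" for i j
  proof -
    have "D i (Wc c j k l) x = D i (\<lambda>y. - Wc c j l k y) x"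
      by (rule vd_cong[OF Wc_skew _ x]) auto
    also have "\<dots> = - D i (Wc c j l k) x"
      by (rule D_minus[OF sm_Wc x])
    finally show ?thesis .
  qed
  have s: "Wc c j k m x * Wc c i m l x = Wc c j m k x * Wc c i l m x" for i j m
    using Wc_skew[OF x, of c j k m] Wc_skew[OF x, of c i m l] by simp
  have s': "C i j m x * Wc c m k l x = - (C i j m x * Wc c m l k x)" for m
    using Wc_skew[OF x, of c m k l] by simp
  show ?thesis
    unfolding R_comp_eq[OF x] d s s' by (simp add: sum_subtractf sum.distrib sum_negf algebra_simps)
qed

text \<open>In the cyclic sum the derivatives of \<open>W\<close> pair up to derivatives of
  \<open>C\<close>, and the quadratic terms to products of two \<open>C\<close>, which is
  \<open>jacobi\<close>.\<close>

lemma first_bianchi: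
  assumes x: "x \<in> P"
  shows "R_comp M H 0 a x i j k l + R_comp M H 0 a x j k i l + R_comp M H 0 a x k i j l = 0"
proof -
  have W0: "Wc 0 i j k = W i j k" for i j k
    by (intro ext) (simp add: Wc_def)
  have d: "D i (C j k l) x = D i (W j k l) x - D i (W k j l) x" for i j k
    unfolding C_def[abs_def] by (rule vd_diff) (auto simp: x)
  show ?thesis
    using jacobi[OF x, of i j k l] unfolding R_comp_eq[OF x] W0 d
    by (simp add: C_def sum_subtractf sum.distrib algebra_simps)
qed

text \<open>The classical combination of four cyclic identities, one for each choice of the last
  index, with the antisymmetries in both pairs.\<close>

lemma pair_symmetry:
  assumes x: "x \<in> P"
  shows "R_comp M H 0 a x i j k l = R_comp M H 0 a x k l i j"
proof -
  define R where "R i j k l = R_comp M H 0 a x i j k l" for i j k l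
  have B: "R i j k l + R j k i l + R k i j l = 0" for i j k l
    unfolding R_def by (rule first_bianchi[OF x])
  have s1: "R i j k l = - R j i k l" for i j k l
    unfolding R_def by (rule R_comp_skew12[OF x])
  have s2: "R i j k l = - R i j l k" for i j k l
    unfolding R_def by (rule R_comp_skew34[OF x])
  have "R k i j l = R j l k i" for i j k l
    using B[of i j k l] B[of j k l i] B[of k l i j] B[of l i j k]
      s2[of i j k l] s2[of j k i l] s2[of k l i j] s2[of l i j k]
      s1[of i k l j] s2[of k i l j] s1[of j l i k] s2[of l j i k] s1[of l j k i] s2[of j l k i]
    by linarith
  then show ?thesis by (simp add: R_def)
qed

text \<open>\<open>T i j k l = \<nabla>\<^sup>g\<^sub>i H\<^sub>j\<^sub>k\<^sub>l\<close>\<close>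

definition T where
  "T i j k l x = D i (Hc j k l) x
    - (\<Sum>m\<in>UNIV. W i j m x * Hc m k l x + W i k m x * Hc j m l x + W i l m x * Hc j k m x)"

lemma T_skew:
  assumes x: "x \<in> P"
  shows "T i j k l x = - T i k j l x" "T i j k l x = - T i j l k x"
proof -
  have d: "D i (Hc j k l) x = - D i (Hc k j l) x"
  proof -
    have "D i (Hc j k l) x = D i (\<lambda>y. - Hc k j l y) x"
      by (rule vd_cong[OF Hc_skew12 _ x]) auto
    also have "\<dots> = - D i (Hc k j l) x"
      by (rule D_minus[OF sm_Hc x])
    finally show ?thesis .
  qed
  have d': "D i (Hc j k l) x = - D i (Hc j l k) x"
  proof -
    have "D i (Hc j k l) x = D i (\<lambda>y. - Hc j l k y) x"
      by (rule vd_cong[OF Hc_skew23 _ x]) auto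
    also have "\<dots> = - D i (Hc j l k) x"
      by (rule D_minus[OF sm_Hc x])
    finally show ?thesis .
  qed
  have "(\<Sum>m\<in>UNIV. W i j m x * Hc m k l x + W i k m x * Hc j m l x + W i l m x * Hc j k m x)
    = - (\<Sum>m\<in>UNIV. W i k m x * Hc m j l x + W i j m x * Hc k m l x + W i l m x * Hc k j m x)"
    unfolding sum_negf[symmetric]
    by (intro sum.cong refl)
       (simp add: Hc_skew12[OF x, of _ k l] Hc_skew12[OF x, of j _ l] Hc_skew12[OF x, of j k])
  then show "T i j k l x = - T i k j l x"
    unfolding T_def d by simp
  have "(\<Sum>m\<in>UNIV. W i j m x * Hc m k l x + W i k m x * Hc j m l x + W i l m x * Hc j k m x)
    = - (\<Sum>m\<in>UNIV. W i j m x * Hc m l k x + W i l m x * Hc j m k x + W i k m x * Hc j l m x)"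
    unfolding sum_negf[symmetric]
    by (intro sum.cong refl)
       (simp add: Hc_skew23[OF x, of _ k l] Hc_skew23[OF x, of j _ l] Hc_skew23[OF x, of j k])
  then show "T i j k l x = - T i j l k x"
    unfolding T_def d' by simp
qed

end

section \<open>Connections with skew torsion\<close>

context torsion_chart
begin

text \<open>Commutator of the torsion endomorphisms in the directions \<open>i\<close> and
  \<open>j\<close>, the part of the curvature quadratic in the torsion.\<close>

definition QH where
  "QH i j k l x = (\<Sum>m\<in>UNIV. Hc j k m x * Hc i m l x - Hc i k m x * Hc j m l x)"

text \<open>The mixed products of \<open>W\<close> and \<open>Hc\<close> complete the frame
  derivatives of \<open>Hc\<close> to covariant ones; the bracket term with \<open>C\<close>
  supplies the corrections for the first form index.\<close>

lemma R_comp_torsion: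
  assumes x: "x \<in> P"
  shows "R_comp M H c a x i j k l = R_comp M H 0 a x i j k l
    + c / 2 * (T i j k l x - T j i k l x) + c\<^sup>2 / 4 * QH i j k l x"
proof -
  have d: "D i (Wc c j k l) x = D i (W j k l) x + c / 2 * D i (Hc j k l) x" for c i j k l
  proof -
    have "D i (Wc c j k l) x = D i (\<lambda>x. W j k l x + (c / 2) *\<^sub>R Hc j k l x) x"
      by (simp add: Wc_def[abs_def])
    also have "\<dots> = D i (W j k l) x + (c / 2) *\<^sub>R D i (Hc j k l) x"
      using vd_add[OF sm_W sm_cmult[OF sm_Hc] x, of "e i" j k l "c/2" j k l]
        vd_cmult[OF sm_Hc x, of "e i" "c/2" j k l] by simp
    finally show ?thesis by simp
  qed
  have "(Wc c j k m x * Wc c i m l x - Wc c i k m x * Wc c j m l x - C i j m x * Wc c m k l x)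
    = (Wc 0 j k m x * Wc 0 i m l x - Wc 0 i k m x * Wc 0 j m l x - C i j m x * Wc 0 m k l x)
      + (c / 2 * ((W j i m x * Hc m k l x + W j k m x * Hc i m l x + W j l m x * Hc i k m x)
          - (W i j m x * Hc m k l x + W i k m x * Hc j m l x + W i l m x * Hc j k m x))
        + c\<^sup>2 / 4 * (Hc j k m x * Hc i m l x - Hc i k m x * Hc j m l x))" for m
    using W_skew[OF x, of i m l] W_skew[OF x, of j m l]
    by (simp add: Wc_def C_def power2_eq_square field_simps)
  then have "(\<Sum>m\<in>UNIV. Wc c j k m x * Wc c i m l x - Wc c i k m x * Wc c j m l x - C i j m x * Wc c m k l x)
    = (\<Sum>m\<in>UNIV. Wc 0 j k m x * Wc 0 i m l x - Wc 0 i k m x * Wc 0 j m l x - C i j m x * Wc 0 m k l x)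
      + (c / 2 * ((\<Sum>m\<in>UNIV. W j i m x * Hc m k l x + W j k m x * Hc i m l x + W j l m x * Hc i k m x)
          - (\<Sum>m\<in>UNIV. W i j m x * Hc m k l x + W i k m x * Hc j m l x + W i l m x * Hc j k m x))
        + c\<^sup>2 / 4 * QH i j k l x)"
    unfolding QH_def by (simp only: sum.distrib[symmetric] sum_distrib_left sum_subtractf[symmetric])
  then show ?thesis
    unfolding R_comp_eq[OF x] d T_def by (simp add: algebra_simps)
qed

lemma QH_pair: "x \<in> P \<Longrightarrow> QH i j k l x = QH k l i j x"
proof -
  assume x: "x \<in> P"
  have "Hc j k m x * Hc i m l x - Hc i k m x * Hc j m l x = Hc l i m x * Hc k m j x - Hc k i m x * Hc l m j x" for m
    using Hc_skew12[OF x, of j k m] Hc_skew23[OF x, of i m l] Hc_skew12[OF x, of i l m] Hc_skew23[OF x, of k m j]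
      Hc_skew12[OF x, of k i m] Hc_skew12[OF x, of l m j] Hc_skew23[OF x, of m l j] Hc_skew12[OF x, of j m l]
    by simp
  then show ?thesis by (simp add: QH_def)
qed

text \<open>Passing from coordinate to covariant derivatives introduces the Christoffel terms
  \<open>c i j\<close>; being symmetric, they cancel in pairs in the alternating sum.\<close>

lemma dH_comp_eq:
  assumes x: "x \<in> P"
  shows "dH_comp M H a x i j k l = T i j k l x - T j i k l x + T k i j l x - T l i j k x"
proof -
  define c where "c i j = chr x (e i x) (e j x)" for i j
  have c: "c i j = c j i" for i j
    unfolding c_def by (rule chr_sym[OF x])
  have de: "dv (e i x) (e j) x = (\<Sum>m\<in>UNIV. W i j m x *\<^sub>R e m x) - c i j" for i j
    using nabla_g_frame[OF x, of i j] by (simp add: nabla_g_eq c_def eq_diff_eq)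
  note l1 = linear_diff[OF H_linear1[OF x]] linear_sum[OF H_linear1[OF x]] linear_scale[OF H_linear1[OF x]]
  note l2 = linear_diff[OF H_linear2[OF x]] linear_sum[OF H_linear2[OF x]] linear_scale[OF H_linear2[OF x]]
  note l3 = linear_diff[OF H_linear3[OF x]] linear_sum[OF H_linear3[OF x]] linear_scale[OF H_linear3[OF x]]
  have 1: "vd M a (\<lambda>_. e i x) (\<lambda>y. H a y (e j x) (e k x) (e l x)) x
    = T i j k l x + H a x (c i j) (e k x) (e l x) + H a x (e j x) (c i k) (e l x) + H a x (e j x) (e k x) (c i l)"
    for i j k l
  proof -
    have "D i (Hc j k l) x = dv (e i x) (\<lambda>y. H a y (e j x) (e k x) (e l x)) x
      + H a x (dv (e i x) (e j) x) (e k x) (e l x) + H a x (e j x) (dv (e i x) (e k) x) (e l x)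
      + H a x (e j x) (e k x) (dv (e i x) (e l) x)"
      unfolding vd_at[of M a "e i"] H_comp_def
      by (rule dv_linear3) (auto simp: x intro: H_linear1 H_linear2 H_linear3 sm_H)
    then show ?thesis
      unfolding de l1 l2 l3 T_def by (simp add: H_comp_def sum.distrib algebra_simps)
  qed
  show ?thesis
    unfolding dH_comp_def ext_deriv_def 1
    using H_skew12[OF x, of "c i j" "e k x" "e l x"]
      H_skew12[OF x, of "c i k" "e j x" "e l x"] H_skew12[OF x, of "c i l" "e j x" "e k x"] H_skew23[OF x, of "e j x" "c i l" "e k x"]
      H_skew12[OF x, of "c j k" "e i x" "e l x"] H_skew12[OF x, of "c j l" "e i x" "e k x"] H_skew23[OF x, of "e i x" "c j l" "e k x"]
      H_skew12[OF x, of "c k l" "e i x" "e j x"] H_skew23[OF x, of "e i x" "c k l" "e j x"]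
    by (simp add: c[of j i] c[of k i] c[of l i] c[of k j] c[of l j] c[of l k])
qed

text \<open>The Riemann tensor and \<open>QH\<close> are pair symmetric, while the terms linear in
  the torsion have opposite signs for the two connections and add up. The identity links
  integrability for one connection to the instanton condition for the other.\<close>

lemma R_plus_minus:
  assumes x: "x \<in> P"
  shows "R_comp M H 1 a x i j k l - R_minus M H a x k l i j = 1/2 * dH_comp M H a x i j k l"
proof -
  have "T k l i j x = T k i j l x"
    using T_skew(1)[OF x, of k l i j] T_skew(2)[OF x, of k i l j] by simp
  moreover have "T l k i j x = T l i j k x"
    using T_skew(1)[OF x, of l k i j] T_skew(2)[OF x, of l i k j] by simp
  ultimately show ?thesis
    using pair_symmetry[OF x, of i j k l] QH_pair[OF x, of i j k l]
      R_comp_torsion[OF x, of 1 i j k l] R_comp_torsion[OF x, of "-1" k l i j] dH_comp_eq[OF x, of i j k l]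
    by (simp add: field_simps)
qed

text \<open>\<open>\<nabla>\<^sup>+\<^sub>i H\<^sub>j\<^sub>k\<^sub>l\<close>; the sums over \<open>m\<close> are cyclic in \<open>j k l\<close>.\<close>

definition nabla_plus_H where
  "nabla_plus_H i j k l x = T i j k l x - 1/2 *
    ((\<Sum>m\<in>UNIV. Hc i j m x * Hc m k l x) + (\<Sum>m\<in>UNIV. Hc i k m x * Hc m l j x)
     + (\<Sum>m\<in>UNIV. Hc i l m x * Hc m j k x))"

text \<open>The Riemann part drops out by the Bianchi identity. The linear part contains
  \<open>3/2\<close> times the derivative along \<open>i\<close>, of which one half completes half
  of the exterior derivative; \<open>QH\<close> sums to the torsion correction in
  \<open>nabla_plus_H\<close>.\<close>

lemma R_plus_cyclic:
  assumes x: "x \<in> P"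
  shows "R_comp M H 1 a x i j k l + R_comp M H 1 a x i k l j + R_comp M H 1 a x i l j k
    = nabla_plus_H i j k l x + 1/2 * dH_comp M H a x i j k l"
proof -
  have B: "R_comp M H 0 a x i j k l + R_comp M H 0 a x i k l j + R_comp M H 0 a x i l j k = 0"
    using first_bianchi[OF x, of j k l i] R_comp_skew34[OF x, of 0 i j k l] pair_symmetry[OF x, of i j k l]
      pair_symmetry[OF x, of i k l j] pair_symmetry[OF x, of i l j k]
      R_comp_skew34[OF x, of 0 k l i j] R_comp_skew34[OF x, of 0 l j i k] R_comp_skew34[OF x, of 0 j k i l]
    by linarith
  have t: "T i k l j x = T i j k l x" "T i l j k x = T i j k l x"
    using T_skew(2)[OF x, of i k l j] T_skew(1)[OF x, of i k j l] T_skew(1)[OF x, of i l j k] T_skew(2)[OF x, of i j l k]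
    by linarith+
  have t': "T k i l j x = - T k i j l x"
    using T_skew(2)[OF x, of k i l j] by linarith
  have q: "QH i j k l x + QH i k l j x + QH i l j k x
     = - 2 * ((\<Sum>m\<in>UNIV. Hc i j m x * Hc m k l x) + (\<Sum>m\<in>UNIV. Hc i k m x * Hc m l j x)
     + (\<Sum>m\<in>UNIV. Hc i l m x * Hc m j k x))"
  proof -
    have "(Hc j k m x * Hc i m l x - Hc i k m x * Hc j m l x)
        + (Hc k l m x * Hc i m j x - Hc i l m x * Hc k m j x)
        + (Hc l j m x * Hc i m k x - Hc i j m x * Hc l m k x)
      = - 2 * (Hc i j m x * Hc m k l x + Hc i k m x * Hc m l j x + Hc i l m x * Hc m j k x)" for m
    proof -
      have c: "Hc p q m x = Hc m p q x" for p q
        using Hc_skew23[OF x, of p q m] Hc_skew12[OF x, of p m q] by linarith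
      have c': "Hc p m q x = - Hc p q m x" for p q
        by (rule Hc_skew23[OF x])
      have d: "Hc m p q x = - Hc m q p x" for p q
        by (rule Hc_skew23[OF x])
      show ?thesis
        unfolding c' c[of j k] c[of k l] c[of l j] c[of j l] c[of k j] c[of l k] d[of j l] d[of k j] d[of l k]
        by (simp add: algebra_simps)
    qed
    then show ?thesis
      unfolding QH_def by (simp only: sum.distrib[symmetric] sum_distrib_left)
  qed
  show ?thesis
    using B q t t' unfolding R_comp_torsion[OF x, of 1] nabla_plus_H_def dH_comp_eq[OF x]
    by (simp add: field_simps)
qed

lemma ricci_eq: "Ric_g M a x i j = (\<Sum>k\<in>UNIV. R_comp M H 0 a x k i j k)"
  by (simp add: Ric_g_def R_comp_def nabla_0)

text \<open>The divergence term is antisymmetric in \<open>i\<close> and \<open>j\<close>, the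
  others are symmetric, so one vector identity will hold both the Einstein equation and the
  \<open>H\<close>-equation.\<close>

lemma R_plus_trace:
  assumes x: "x \<in> P"
  shows "(\<Sum>k\<in>UNIV. R_comp M H 1 a x i k k j) = Ric_g M a x i j + 1/2 * (\<Sum>k\<in>UNIV. T k k i j x)
    - 1/4 * (\<Sum>m\<in>UNIV. \<Sum>n\<in>UNIV. Hc i m n x * Hc j m n x)"
proof -
  have "R_comp M H 1 a x i k k j = R_comp M H 0 a x k i j k + (1/2 * T k k i j x
      - 1/4 * (\<Sum>m\<in>UNIV. Hc i k m x * Hc j k m x))" for k
  proof -
    have R: "R_comp M H 0 a x i k k j = R_comp M H 0 a x k i j k"
      using R_comp_skew12[OF x, of 0 i k k j] R_comp_skew34[OF x, of 0 k i k j] by simp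
    have t: "T i k k j x = 0" "T k i k j x = - T k k i j x"
      using T_skew(1)[OF x, of i k k j] T_skew(1)[OF x, of k i k j] by simp_all
    have q: "QH i k k j x = (\<Sum>m\<in>UNIV. - (Hc i k m x * Hc j k m x))"
      unfolding QH_def
    proof (intro sum.cong refl)
      fix m
      show "Hc k k m x * Hc i m j x - Hc i k m x * Hc k m j x = - (Hc i k m x * Hc j k m x)"
        using Hc_skew12[OF x, of k k m] Hc_skew23[OF x, of k m j] Hc_skew12[OF x, of k j m] by simp
    qed
    show ?thesis
      unfolding R_comp_torsion[OF x, of 1] R t q by (simp add: sum_negf)
  qed
  then show ?thesis
    by (simp add: ricci_eq sum.distrib sum_subtractf sum_distrib_left)
qed

lemma hess_eq:
  assumes \<phi>: "sm \<phi>" and x: "x \<in> P"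
  shows "hess M \<phi> a x i j = D i (D j \<phi>) x - (\<Sum>m\<in>UNIV. W i j m x * D m \<phi> x)"
  unfolding hess_def vd_at[of M a "nabla_g M a (e i) (e j)"] nabla_g_frame[OF x] vd_at[of M a "e _" \<phi> x]
  by (simp add: linear_sum[OF dv_linear[OF \<phi> x]] linear_scale[OF dv_linear[OF \<phi> x]])

lemma hess_sym:
  assumes \<phi>: "sm \<phi>" and x: "x \<in> P"
  shows "hess M \<phi> a x i j = hess M \<phi> a x j i"
  using D_commutator[OF \<phi> x, of i j]
  by (simp add: hess_eq[OF \<phi> x] C_def scaleR_diff_left sum_subtractf algebra_simps)

lemma dv_exp:
  assumes \<phi>: "sm \<phi>" and f: "sm f" and x: "x \<in> P"
  shows "vd M a X (\<lambda>y. exp (- 2 * \<phi> y) *\<^sub>R f y) x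
    = exp (- 2 * \<phi> x) *\<^sub>R (vd M a X f x - (2 * vd M a X \<phi> x) *\<^sub>R f x)"
  unfolding vd_at[of M a X]
proof (rule dv_unique[THEN trans])
  have "((\<lambda>z. exp (- 2 * in_coord M a \<phi> z) *\<^sub>R in_coord M a f z) has_derivative
     (\<lambda>v. exp (- 2 * \<phi> x) *\<^sub>R dv v f x + (exp (- 2 * \<phi> x) * (- 2 * dv v \<phi> x)) *\<^sub>R f x)) (at (coord M a x))"
    using x by (auto intro!: derivative_eq_intros sm_deriv[OF f x] sm_deriv[OF \<phi> x])
  then show "(in_coord M a (\<lambda>y. exp (- 2 * \<phi> y) *\<^sub>R f y) has_derivative
     (\<lambda>v. exp (- 2 * \<phi> x) *\<^sub>R dv v f x + (exp (- 2 * \<phi> x) * (- 2 * dv v \<phi> x)) *\<^sub>R f x)) (at (coord M a x))"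
    by (simp add: in_coord_def o_def)
qed (simp add: algebra_simps)

lemma divergence_H:
  assumes \<phi>: "sm \<phi>" and x: "x \<in> P"
  shows "(\<Sum>i\<in>UNIV. nabla_g_form3 M (\<lambda>b y u v w. exp (- 2 * \<phi> y) * H b y u v w) a (e i) (e i) (e j) (e k) x)
    = exp (- 2 * \<phi> x) * ((\<Sum>i\<in>UNIV. T i i j k x) - 2 * (\<Sum>i\<in>UNIV. D i \<phi> x * Hc i j k x))"
proof -
  note l = linear_sum[OF H_linear1[OF x]] linear_scale[OF H_linear1[OF x]]
    linear_sum[OF H_linear2[OF x]] linear_scale[OF H_linear2[OF x]]
    linear_sum[OF H_linear3[OF x]] linear_scale[OF H_linear3[OF x]]
  have "nabla_g_form3 M (\<lambda>b y u v w. exp (- 2 * \<phi> y) * H b y u v w) a (e i) (e i) (e j) (e k) x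
    = exp (- 2 * \<phi> x) * (T i i j k x - 2 * (D i \<phi> x * Hc i j k x))" for i
    using dv_exp[OF \<phi> sm_Hc x, of "e i" i j k]
    unfolding nabla_g_form3_def nabla_g_frame[OF x] l T_def
    by (simp add: H_comp_def sum.distrib algebra_simps sum_distrib_left)
  then show ?thesis
    by (simp add: sum_subtractf sum_distrib_left right_diff_distrib)
qed

end

section \<open>Parallel spinors and the dilatino equation\<close>

lemma clifford_generators_module:
  assumes "clifford_generators \<Gamma>"
  shows "inner_clifford_module (\<lambda>i. (*v) (\<Gamma> i))"
proof (unfold inner_clifford_module_def clifford_module_def, intro conjI allI)
  show "linear ((*v) (\<Gamma> i))" for i
  proof (rule linearI)
    show "\<Gamma> i *v (c *\<^sub>R v) = c *\<^sub>R (\<Gamma> i *v v)" for c v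
      by (simp add: vec_eq_iff matrix_vector_mult_def scaleR_sum_right)
  qed (rule matrix_vector_right_distrib)
  show "\<Gamma> i *v (\<Gamma> j *v e) + \<Gamma> j *v (\<Gamma> i *v e) = (if i = j then 2 *\<^sub>R e else 0)" for i j e
  proof -
    have "\<Gamma> i *v (\<Gamma> j *v e) + \<Gamma> j *v (\<Gamma> i *v e) = (\<Gamma> i ** \<Gamma> j + \<Gamma> j ** \<Gamma> i) *v e"
      by (simp add: matrix_vector_mult_add_rdistrib matrix_vector_mul_assoc)
    also have "\<Gamma> i ** \<Gamma> j + \<Gamma> j ** \<Gamma> i = (if i = j then mat 1 + mat 1 else 0)"
      using assms unfolding clifford_generators_def scaleR_2 by blast
    also have "(if i = j then mat 1 + mat 1 else 0) *v e = (if i = j then 2 *\<^sub>R e else 0)"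
      unfolding scaleR_2
      by (simp only: matrix_vector_mult_add_rdistrib matrix_vector_mul_lid matrix_vector_mult_0 split: if_split)
         simp
    finally show ?thesis .
  qed
qed

locale spinor_chart = torsion_chart M a H for M :: "('i, 'm) spin_mfd" and a H +
  fixes \<Gamma> :: "6 \<Rightarrow> complex^8^8"
  assumes clifford_\<Gamma>: "clifford_generators \<Gamma>"
begin

sublocale inner_clifford_module "\<lambda>i. (*v) (\<Gamma> i)"
  by (rule clifford_generators_module[OF clifford_\<Gamma>])

abbreviation \<gamma> where "\<gamma> i \<equiv> (*v) (\<Gamma> i)"

lemma bounded_linear_\<gamma>: "bounded_linear (\<gamma> i)"
  using linear_\<gamma> linear_conv_bounded_linear by blast

lemma sm_\<gamma>: "sm f \<Longrightarrow> sm (\<lambda>x. \<gamma> i (f x))"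
  by (rule sm_bounded_linear[OF bounded_linear_\<gamma>])

lemma sm_G1: "(\<And>i. sm (v i)) \<Longrightarrow> sm s \<Longrightarrow> sm (\<lambda>y. G1 (\<lambda>i. v i y) (s y))"
  unfolding G1_def by (intro sm_sum sm_scaleR sm_\<gamma>)
lemma sm_G2: "(\<And>i j. sm (A i j)) \<Longrightarrow> sm s \<Longrightarrow> sm (\<lambda>y. G2 (\<lambda>i j. A i j y) (s y))"
  unfolding G2_def by (intro sm_sum sm_G1 sm_\<gamma>)
lemma sm_G3: "(\<And>i j k. sm (A i j k)) \<Longrightarrow> sm s \<Longrightarrow> sm (\<lambda>y. G3 (\<lambda>i j k. A i j k y) (s y))"
  unfolding G3_def by (intro sm_sum sm_G2 sm_\<gamma>)

lemma vd_G1: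
  "(\<And>i. sm (v i)) \<Longrightarrow> sm s \<Longrightarrow> x \<in> P \<Longrightarrow>
    vd M a X (\<lambda>y. G1 (\<lambda>i. v i y) (s y)) x = G1 (\<lambda>i. vd M a X (v i) x) (s x) + G1 (\<lambda>i. v i x) (vd M a X s x)"
  unfolding G1_def
  by (simp add: vd_sum sm_scaleR sm_\<gamma> vd_scaleR vd_bounded_linear[OF bounded_linear_\<gamma>] sum.distrib)

lemma vd_G2:
  "(\<And>i j. sm (A i j)) \<Longrightarrow> sm s \<Longrightarrow> x \<in> P \<Longrightarrow>
    vd M a X (\<lambda>y. G2 (\<lambda>i j. A i j y) (s y)) x = G2 (\<lambda>i j. vd M a X (A i j) x) (s x) + G2 (\<lambda>i j. A i j x) (vd M a X s x)"
  unfolding G2_def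
  by (simp add: vd_sum sm_\<gamma> sm_G1 vd_G1 vd_bounded_linear[OF bounded_linear_\<gamma>] \<gamma>_simps sum.distrib)

lemma vd_G3:
  "(\<And>i j k. sm (A i j k)) \<Longrightarrow> sm s \<Longrightarrow> x \<in> P \<Longrightarrow>
    vd M a X (\<lambda>y. G3 (\<lambda>i j k. A i j k y) (s y)) x
    = G3 (\<lambda>i j k. vd M a X (A i j k) x) (s x) + G3 (\<lambda>i j k. A i j k x) (vd M a X s x)"
  unfolding G3_def
  by (simp add: vd_sum sm_\<gamma> sm_G2 vd_G2 vd_bounded_linear[OF bounded_linear_\<gamma>] \<gamma>_simps sum.distrib)

text \<open>In \<open>nabla_spin\<close> the differentiated frame vector belongs to the second
  generator, so antisymmetry of \<open>Wc\<close> produces the minus sign.\<close>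

lemma nabla_spin_frame:
  assumes x: "x \<in> P"
  shows "nabla_spin \<Gamma> M H c a (e i) \<epsilon> x = D i (\<epsilon> a) x - (1/4) *\<^sub>R G2 (\<lambda>j k. Wc c i j k x) (\<epsilon> a x)"
proof -
  have "(\<Sum>j\<in>UNIV. \<Sum>k\<in>UNIV. gmet M a x (nabla M H c a (e i) (e k) x) (e j x) *\<^sub>R ((\<Gamma> j ** \<Gamma> k) *v \<epsilon> a x))
     = G2 (\<lambda>j k. - Wc c i j k x) (\<epsilon> a x)"
    unfolding g_nabla_frame[OF x] G2_def G1_def \<gamma>_sum \<gamma>_simps matrix_vector_mul_assoc[symmetric]
    by (intro sum.cong refl) (subst Wc_skew[OF x], rule refl)
  then show ?thesis
    by (simp add: nabla_spin_def G2_minus)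
qed

section \<open>Consequences of a parallel spinor\<close>

context
  fixes s :: "'m \<Rightarrow> complex^8" and c :: real
  assumes sm_s: "sm s"
    and parallel: "\<And>x i. x \<in> P \<Longrightarrow> D i s x = (1/4) *\<^sub>R G2 (\<lambda>j k. Wc c i j k x) (s x)"
begin

text \<open>Compare \<open>D_commutator\<close> on the spinor with the derivative of the parallel
  equation; the Clifford commutator \<open>G2_G2\<close> of the connection forms supplies the
  quadratic terms of the curvature.\<close>

lemma integrability:
  assumes x: "x \<in> P"
  shows "G2 (\<lambda>k l. R_comp M H c a x i j k l) (s x) = 0"
proof -
  have DD: "D i (D j s) x = (1/4) *\<^sub>R (G2 (\<lambda>k l. D i (Wc c j k l) x) (s x)
      + (1/4) *\<^sub>R G2 (\<lambda>k l. Wc c j k l x) (G2 (\<lambda>k l. Wc c i k l x) (s x)))" for i j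
  proof -
    have "D i (D j s) x = D i (\<lambda>y. (1/4) *\<^sub>R G2 (\<lambda>k l. Wc c j k l y) (s y)) x"
      by (rule vd_cong[OF _ sm_cmult[OF sm_G2[OF sm_Wc sm_s]] x]) (erule parallel)
    also have "\<dots> = (1/4) *\<^sub>R D i (\<lambda>y. G2 (\<lambda>k l. Wc c j k l y) (s y)) x"
      by (rule vd_cmult[OF sm_G2[OF sm_Wc sm_s] x])
    also have "D i (\<lambda>y. G2 (\<lambda>k l. Wc c j k l y) (s y)) x
        = G2 (\<lambda>k l. D i (Wc c j k l) x) (s x) + G2 (\<lambda>k l. Wc c j k l x) (D i s x)"
      by (rule vd_G2[OF sm_Wc sm_s x])
    finally show ?thesis
      by (simp add: parallel[OF x] G2_simps)
  qed
  have comm: "G2 (\<lambda>k l. Wc c j k l x) (G2 (\<lambda>k l. Wc c i k l x) (s x))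
     = G2 (\<lambda>k l. Wc c i k l x) (G2 (\<lambda>k l. Wc c j k l x) (s x))
       + 4 *\<^sub>R G2 (\<lambda>k l. (\<Sum>m\<in>UNIV. Wc c j k m x * Wc c i m l x) - (\<Sum>m\<in>UNIV. Wc c i k m x * Wc c j m l x)) (s x)"
  proof -
    have "(\<Sum>m\<in>UNIV. Wc c j l m x * Wc c i k m x) = - (\<Sum>m\<in>UNIV. Wc c i k m x * Wc c j m l x)" for k l
      unfolding sum_negf[symmetric]
      by (intro sum.cong refl) (simp add: Wc_skew[OF x, of c j l _])
    then show ?thesis
      using G2_G2[of "\<lambda>k l. Wc c j k l x" "\<lambda>k l. Wc c i k l x" "s x", OF Wc_skew[OF x]] by simp
  qed
  have "D i (D j s) x - D j (D i s) x = (\<Sum>m\<in>UNIV. C i j m x *\<^sub>R D m s x)"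
    by (rule D_commutator[OF sm_s x])
  then have "4 *\<^sub>R (D i (D j s) x - D j (D i s) x) = 4 *\<^sub>R (\<Sum>m\<in>UNIV. C i j m x *\<^sub>R D m s x)"
    by simp
  also have "\<dots> = G2 (\<lambda>k l. \<Sum>m\<in>UNIV. C i j m x * Wc c m k l x) (s x)"
    by (simp add: parallel[OF x] G2_sum G2_scale scaleR_sum_right)
  finally have "G2 (\<lambda>k l. D i (Wc c j k l) x) (s x) - G2 (\<lambda>k l. D j (Wc c i k l) x) (s x)
      + G2 (\<lambda>k l. (\<Sum>m\<in>UNIV. Wc c j k m x * Wc c i m l x) - (\<Sum>m\<in>UNIV. Wc c i k m x * Wc c j m l x)) (s x)
      = G2 (\<lambda>k l. \<Sum>m\<in>UNIV. C i j m x * Wc c m k l x) (s x)"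
    unfolding DD comm by (simp add: algebra_simps)
  then show ?thesis
    unfolding R_comp_eq[OF x] sum_subtractf G2_add G2_diff by (simp only: algebra_simps add_0_left)
qed

text \<open>The coefficients receive their covariant derivative, and the left-over term is the spin
  connection acting on the whole product. That term cancels when both sides of a spinor equation are
  differentiated.\<close>

lemma D_G1:
  assumes v: "\<And>j. sm (v j)" and x: "x \<in> P"
  shows "D i (\<lambda>y. G1 (\<lambda>j. v j y) (s y)) x
    = G1 (\<lambda>j. D i (v j) x - (\<Sum>m\<in>UNIV. Wc c i j m x * v m x)) (s x)
      + (1/4) *\<^sub>R G2 (\<lambda>j k. Wc c i j k x) (G1 (\<lambda>j. v j x) (s x))"
  unfolding vd_G1[OF v sm_s x] parallel[OF x] G2_G1[of "\<lambda>j k. Wc c i j k x", OF Wc_skew[OF x]]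
  by (simp add: G1_simps G1_diff scaleR_add_right)

lemma D_G2:
  assumes A: "\<And>j k. sm (A j k)" and x: "x \<in> P"
  shows "D i (\<lambda>y. G2 (\<lambda>j k. A j k y) (s y)) x
    = G2 (\<lambda>j k. D i (A j k) x - ((\<Sum>m\<in>UNIV. Wc c i j m x * A m k x) + (\<Sum>m\<in>UNIV. Wc c i k m x * A j m x))) (s x)
      + (1/4) *\<^sub>R G2 (\<lambda>j k. Wc c i j k x) (G2 (\<lambda>j k. A j k x) (s x))"
  unfolding vd_G2[OF A sm_s x] parallel[OF x] G2_G2[of "\<lambda>j k. Wc c i j k x", OF Wc_skew[OF x]]
  by (simp add: G2_simps G2_diff scaleR_add_right)

lemma D_G3:
  assumes X: "\<And>j k l. sm (X j k l)" and x: "x \<in> P"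
  shows "D i (\<lambda>y. G3 (\<lambda>j k l. X j k l y) (s y)) x
    = G3 (\<lambda>j k l. D i (X j k l) x - ((\<Sum>m\<in>UNIV. Wc c i j m x * X m k l x)
        + ((\<Sum>m\<in>UNIV. Wc c i k m x * X j m l x) + (\<Sum>m\<in>UNIV. Wc c i l m x * X j k m x)))) (s x)
      + (1/4) *\<^sub>R G2 (\<lambda>j k. Wc c i j k x) (G3 (\<lambda>j k l. X j k l x) (s x))"
  unfolding vd_G3[OF X sm_s x] parallel[OF x] G2_G3[of "\<lambda>j k. Wc c i j k x", OF Wc_skew[OF x]]
  by (simp add: G3_simps G3_diff scaleR_add_right)

end

context
  fixes s :: "'m \<Rightarrow> complex^8" and \<phi> :: "'m \<Rightarrow> real"
  assumes sm_s: "sm s" and sm_\<phi>: "sm \<phi>" and s_nonzero: "\<And>x. x \<in> P \<Longrightarrow> s x \<noteq> 0"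
    and parallel: "\<And>x i. x \<in> P \<Longrightarrow> D i s x = (1/4) *\<^sub>R G2 (\<lambda>j k. Wc 1 i j k x) (s x)"
    and dilatino: "\<And>x. x \<in> P \<Longrightarrow> G1 (\<lambda>j. D j \<phi> x) (s x) = (1/12) *\<^sub>R G3 (\<lambda>j k l. Hc j k l x) (s x)"
begin

lemma derivative_dilatino:
  assumes x: "x \<in> P"
  shows "G1 (\<lambda>j. hess M \<phi> a x i j - 1/2 * (\<Sum>m\<in>UNIV. Hc i j m x * D m \<phi> x)) (s x)
    = (1/12) *\<^sub>R G3 (\<lambda>j k l. nabla_plus_H i j k l x) (s x)"
proof -
  have s3: "sm (\<lambda>y. G3 (\<lambda>j k l. Hc j k l y) (s y))"
    by (intro sm_G3 sm_Hc sm_s)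
  have v: "D i (D j \<phi>) x - (\<Sum>m\<in>UNIV. Wc 1 i j m x * D m \<phi> x)
    = hess M \<phi> a x i j - 1/2 * (\<Sum>m\<in>UNIV. Hc i j m x * D m \<phi> x)" for j
    by (simp add: hess_eq[OF sm_\<phi> x] Wc_def algebra_simps sum.distrib sum_distrib_left)
  have H: "D i (Hc j k l) x - ((\<Sum>m\<in>UNIV. Wc 1 i j m x * Hc m k l x)
        + ((\<Sum>m\<in>UNIV. Wc 1 i k m x * Hc j m l x) + (\<Sum>m\<in>UNIV. Wc 1 i l m x * Hc j k m x)))
    = nabla_plus_H i j k l x" for j k l
  proof -
    have "(\<Sum>m\<in>UNIV. Hc i k m x * Hc m l j x) = (\<Sum>m\<in>UNIV. Hc i k m x * Hc j m l x)"
    proof (intro sum.cong refl)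
      fix m show "Hc i k m x * Hc m l j x = Hc i k m x * Hc j m l x"
        using Hc_skew12[OF x, of j m l] Hc_skew23[OF x, of m j l] by simp
    qed
    moreover have "(\<Sum>m\<in>UNIV. Hc i l m x * Hc m j k x) = (\<Sum>m\<in>UNIV. Hc i l m x * Hc j k m x)"
    proof (intro sum.cong refl)
      fix m show "Hc i l m x * Hc m j k x = Hc i l m x * Hc j k m x"
        using Hc_skew23[OF x, of j k m] Hc_skew12[OF x, of j m k] by simp
    qed
    ultimately show ?thesis
      by (simp add: nabla_plus_H_def T_def Wc_def distrib_right sum.distrib sum_divide_distrib
          add_divide_distrib)
  qed
  \<comment> \<open>Rewritten by the dilatino equation, the spin connection term is
    \<open>1/12\<close> of the one in \<open>d3\<close>, so that only the covariant derivatives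
    remain in the end.\<close>
  have d1: "D i (\<lambda>y. G1 (\<lambda>j. D j \<phi> y) (s y)) x
      = G1 (\<lambda>j. hess M \<phi> a x i j - 1/2 * (\<Sum>m\<in>UNIV. Hc i j m x * D m \<phi> x)) (s x)
        + (1/4) *\<^sub>R G2 (\<lambda>j k. Wc 1 i j k x) ((1/12) *\<^sub>R G3 (\<lambda>j k l. Hc j k l x) (s x))"
    unfolding v[symmetric] dilatino[OF x, symmetric]
    by (rule D_G1[OF sm_s parallel sm_vd[OF sm_frame sm_\<phi>] x])
  have d3: "D i (\<lambda>y. G3 (\<lambda>j k l. Hc j k l y) (s y)) x
      = G3 (\<lambda>j k l. nabla_plus_H i j k l x) (s x)
        + (1/4) *\<^sub>R G2 (\<lambda>j k. Wc 1 i j k x) (G3 (\<lambda>j k l. Hc j k l x) (s x))"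
    unfolding H[symmetric] by (rule D_G3[OF sm_s parallel sm_Hc x])
  have "D i (\<lambda>y. G1 (\<lambda>j. D j \<phi> y) (s y)) x = D i (\<lambda>y. (1/12) *\<^sub>R G3 (\<lambda>j k l. Hc j k l y) (s y)) x"
    by (rule vd_cong[OF dilatino sm_cmult[OF s3] x])
  also have "\<dots> = (1/12) *\<^sub>R D i (\<lambda>y. G3 (\<lambda>j k l. Hc j k l y) (s y)) x"
    by (rule vd_cmult[OF s3 x])
  finally show ?thesis
    unfolding d1 d3 by (simp add: G2_simps scaleR_add_right)
qed

lemma killing_identity:
  assumes x: "x \<in> P"
  shows "G1 (\<lambda>j. Ric_g M a x i j - 1/4 * (\<Sum>m\<in>UNIV. \<Sum>n\<in>UNIV. Hc i m n x * Hc j m n x) + 2 * hess M \<phi> a x i j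
      + 1/2 * ((\<Sum>k\<in>UNIV. T k k i j x) - 2 * (\<Sum>k\<in>UNIV. D k \<phi> x * Hc k i j x))) (s x)
    = - (1/12) *\<^sub>R G3 (\<lambda>j k l. dH_comp M H a x i j k l) (s x)"
proof -
  \<comment> \<open>The added term is twice the Hessian of \<open>\<phi>\<close> for the plus
    connection; its antisymmetric part is the dilaton term of the \<open>H\<close>-equation.\<close>
  have "(\<Sum>k\<in>UNIV. R_comp M H 1 a x i k k j) + 2 * (hess M \<phi> a x i j - 1/2 * (\<Sum>m\<in>UNIV. Hc i j m x * D m \<phi> x))
    = Ric_g M a x i j - 1/4 * (\<Sum>m\<in>UNIV. \<Sum>n\<in>UNIV. Hc i m n x * Hc j m n x) + 2 * hess M \<phi> a x i j
      + 1/2 * ((\<Sum>k\<in>UNIV. T k k i j x) - 2 * (\<Sum>k\<in>UNIV. D k \<phi> x * Hc k i j x))" for j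
  proof -
    have "(\<Sum>m\<in>UNIV. Hc i j m x * D m \<phi> x) = (\<Sum>k\<in>UNIV. D k \<phi> x * Hc k i j x)"
    proof (intro sum.cong refl)
      fix m show "Hc i j m x * D m \<phi> x = D m \<phi> x * Hc m i j x"
        using Hc_skew23[OF x, of i j m] Hc_skew12[OF x, of i m j] by simp
    qed
    then show ?thesis by (simp add: R_plus_trace[OF x])
  qed
  moreover have "G1 (\<lambda>j. (\<Sum>k\<in>UNIV. R_comp M H 1 a x i k k j)
        + 2 * (hess M \<phi> a x i j - 1/2 * (\<Sum>m\<in>UNIV. Hc i j m x * D m \<phi> x))) (s x)
      = - (1/12) *\<^sub>R G3 (\<lambda>j k l. dH_comp M H a x i j k l) (s x)"
    by (rule killing_ricci_identity[OF R_comp_skew34[OF x] integrability[OF sm_s parallel x]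
          derivative_dilatino[OF x] R_plus_cyclic[OF x]])
  ultimately show ?thesis by (simp only:)
qed

lemma dilaton_equation:
  assumes x: "x \<in> P"
    and div: "\<And>j k. (\<Sum>i\<in>UNIV. T i i j k x) = 2 * (\<Sum>i\<in>UNIV. D i \<phi> x * Hc i j k x)"
    and dH: "\<And>i j. G2 (\<lambda>k l. dH_comp M H a x i j k l) (s x) = 0"
  shows "(\<Sum>i\<in>UNIV. hess M \<phi> a x i i) = 2 * (\<Sum>i\<in>UNIV. D i \<phi> x * D i \<phi> x)
    - (1/12) * (\<Sum>i\<in>UNIV. \<Sum>j\<in>UNIV. \<Sum>k\<in>UNIV. Hc i j k x * Hc i j k x)"
proof (rule dilaton_identity[where T = "\<lambda>i j k l. T i j k l x" and e = "s x" and h = "hess M \<phi> a x"])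
  show "G1 (\<lambda>j. hess M \<phi> a x i j - 1/2 * (\<Sum>m\<in>UNIV. Hc i j m x * D m \<phi> x)) (s x)
    = (1/12) *\<^sub>R G3 (\<lambda>j k l. T i j k l x - 1/2 * quad_form (\<lambda>i j k. Hc i j k x) i j k l) (s x)" for i
    using derivative_dilatino[OF x, of i] unfolding nabla_plus_H_def quad_form_def .
  show "G4 (\<lambda>i j k l. T i j k l x - T j i k l x + T k i j l x - T l i j k x) (s x) = 0"
    unfolding dH_comp_eq[OF x, symmetric] using dH by (simp add: G4_def G3_def \<gamma>_simps)
  show "s x \<noteq> 0" by (rule s_nonzero[OF x])
  show "G1 (\<lambda>j. D j \<phi> x) (s x) = (1/12) *\<^sub>R G3 (\<lambda>j k l. Hc j k l x) (s x)"
    by (rule dilatino[OF x])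
qed (rule Hc_skew12[OF x] Hc_skew23[OF x] T_skew[OF x] hess_sym[OF sm_\<phi> x] div)+

end

end

section \<open>The strong minimum principle\<close>

text \<open>Along the line through \<open>p\<close>, a negative second derivative would make the
  first derivative, zero at \<open>p\<close>, negative just beyond it, and the mean value theorem
  would give a value below \<open>f p\<close>.\<close>

lemma local_minimum_second_derivative:
  fixes f :: "'a::real_normed_vector \<Rightarrow> real"
  assumes S: "open S" "p \<in> S"
    and f': "\<And>x. x \<in> S \<Longrightarrow> (f has_derivative f' x) (at x)"
    and f2: "((\<lambda>x. f' x \<xi>) has_derivative f2) (at p)"
    and le: "\<And>x. x \<in> S \<Longrightarrow> f p \<le> f x"
  shows "f' p \<xi> = 0" "f2 \<xi> \<ge> 0"
proof -
  have "f' p = (\<lambda>v. 0)"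
    using differential_zero_maxmin[OF S(2,1) f'[OF S(2)]] le by blast
  then show 0: "f' p \<xi> = 0" by simp
  show "f2 \<xi> \<ge> 0"
  proof (rule ccontr)
    assume neg: "\<not> f2 \<xi> \<ge> 0"
    have l2: "linear f2" using f2 has_derivative_linear by blast
    have "((\<lambda>t. f' (p + t *\<^sub>R \<xi>) \<xi>) has_derivative (\<lambda>t. f2 (t *\<^sub>R \<xi>))) (at 0)"
      by (rule has_derivative_compose[where g = "\<lambda>x. f' x \<xi>" and f = "\<lambda>t. p + t *\<^sub>R \<xi>"])
         (use f2 in \<open>auto intro!: derivative_eq_intros\<close>)
    then have "((\<lambda>t. f' (p + t *\<^sub>R \<xi>) \<xi>) has_real_derivative f2 \<xi>) (at 0)"
      by (simp add: has_field_derivative_def linear_scale[OF l2] mult_commute_abs)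
    then obtain d where d: "d > 0" "\<And>h. 0 < h \<Longrightarrow> h < d \<Longrightarrow> f' (p + h *\<^sub>R \<xi>) \<xi> < 0"
      using DERIV_neg_dec_right[of "\<lambda>t. f' (p + t *\<^sub>R \<xi>) \<xi>" "f2 \<xi>" 0] neg 0 by auto
    have "open ((\<lambda>t::real. p + t *\<^sub>R \<xi>) -` S)"
      by (intro continuous_open_vimage S continuous_intros)
    moreover have "0 \<in> (\<lambda>t::real. p + t *\<^sub>R \<xi>) -` S" using S(2) by simp
    ultimately obtain r where r: "r > 0" "ball 0 r \<subseteq> (\<lambda>t::real. p + t *\<^sub>R \<xi>) -` S"
      by (meson openE)
    define h where "h = min d r / 2"
    have h: "0 < h" "h < d" "h < r" using d(1) r(1) by (auto simp: h_def)
    have inS: "p + t *\<^sub>R \<xi> \<in> S" if "0 \<le> t" "t \<le> h" for t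
      using r(2) that h by (auto simp: subset_iff)
    have "((\<lambda>t. f (p + t *\<^sub>R \<xi>)) has_derivative (\<lambda>r. f' (p + t *\<^sub>R \<xi>) (r *\<^sub>R \<xi>))) (at t within {0..h})"
      if "0 \<le> t" "t \<le> h" for t
      by (rule has_derivative_at_withinI, rule has_derivative_compose[where g = f and f = "\<lambda>t. p + t *\<^sub>R \<xi>"])
         (use f'[OF inS[OF that]] in \<open>auto intro!: derivative_eq_intros\<close>)
    from mvt_simple[OF h(1) this] obtain t where t: "0 < t" "t < h"
      "f (p + h *\<^sub>R \<xi>) - f (p + 0 *\<^sub>R \<xi>) = f' (p + t *\<^sub>R \<xi>) ((h - 0) *\<^sub>R \<xi>)"
      by auto
    have "linear (f' (p + t *\<^sub>R \<xi>))"
      using f'[OF inS] t has_derivative_linear by (metis less_imp_le)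
    then have "f (p + h *\<^sub>R \<xi>) - f p = h * f' (p + t *\<^sub>R \<xi>) \<xi>"
      using t(3) by (simp add: linear_scale)
    moreover have "h * f' (p + t *\<^sub>R \<xi>) \<xi> < 0"
      using d(2)[of t] t h by (simp add: mult_pos_neg)
    moreover have "f p \<le> f (p + h *\<^sub>R \<xi>)"
      using le[OF inS[of h]] h by simp
    ultimately show False by linarith
  qed
qed

text \<open>Moving the centre halfway towards a boundary point \<open>z\<close> turns the ball into one that meets the
  sphere only in \<open>z\<close>.\<close>

lemma internally_tangent_ball:
  fixes x y z :: "'a::real_inner"
  assumes x: "dist x (midpoint y z) \<le> dist y z / 2" and ne: "x \<noteq> z"
  shows "dist x y < dist y z"
proof -
  define c where "c = (1/2) *\<^sub>R (z - y)"
  define b where "b = x - midpoint y z"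
  have z: "z = midpoint y z + c" and y: "y = midpoint y z - c"
    unfolding c_def midpoint_def by (simp_all add: algebra_simps flip: scaleR_add_left)
  have nc: "norm c = dist y z / 2"
    by (simp add: c_def dist_norm norm_minus_commute)
  have nb: "norm b \<le> norm c" using x nc by (simp add: b_def dist_norm)
  have "b - c \<noteq> 0"
    using ne z by (auto simp: b_def algebra_simps)
  \<comment> \<open>Parallelogram law: \<open>b\<close> is no longer than \<open>c\<close> and
    differs from it, so \<open>b + c\<close> is strictly shorter than twice
    \<open>c\<close>.\<close>
  then have "norm (b - c)^2 > 0" by simp
  moreover have "norm (b + c)^2 + norm (b - c)^2 = 2 * norm b ^2 + 2 * norm c^2"
    by (simp add: power2_norm_eq_inner inner_add_left inner_add_right inner_diff_left inner_diff_right)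
  moreover have "norm b^2 \<le> norm c^2" using nb by (simp add: power_mono)
  ultimately have "norm (b + c)^2 < 4 * norm c ^2"
    by linarith
  then have "norm (b + c)^2 < (2 * norm c)^2"
    by (simp add: power_mult_distrib)
  then have "norm (b + c) < 2 * norm c"
    by (rule power2_less_imp_less) simp
  moreover have "b + c = x - y" using y by (simp add: b_def algebra_simps)
  ultimately show ?thesis by (simp add: nc dist_norm)
qed

lemma barrier_derivatives:
  fixes y :: "'a::real_inner"
  shows "((\<lambda>x. exp (- \<alpha> * ((x - y) \<bullet> (x - y)))) has_derivative
      (\<lambda>v. - 2 * \<alpha> * ((x - y) \<bullet> v) * exp (- \<alpha> * ((x - y) \<bullet> (x - y))))) (at x)"
    and "((\<lambda>x. - 2 * \<alpha> * ((x - y) \<bullet> \<xi>) * exp (- \<alpha> * ((x - y) \<bullet> (x - y)))) has_derivative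
      (\<lambda>v. (4 * \<alpha>\<^sup>2 * ((x - y) \<bullet> \<xi>) * ((x - y) \<bullet> v) - 2 * \<alpha> * (v \<bullet> \<xi>)) * exp (- \<alpha> * ((x - y) \<bullet> (x - y))))) (at x)"
  by (auto intro!: derivative_eq_intros ext simp: inner_commute algebra_simps power2_eq_square)

text \<open>Hopf's barrier argument. If \<open>u\<close> exceeded \<open>m\<close> at a point near
  \<open>z0\<close>, a ball about that point could grow until it touches the set where
  \<open>u\<close> equals \<open>m\<close>. Subtracting a small multiple of a Gaussian from
  \<open>u\<close> near the touching point creates an interior minimum that contradicts the
  differential inequality.\<close>

theorem strong_minimum_principle_local:
  fixes u :: "'a::euclidean_space \<Rightarrow> real"
  assumes U: "open U" and I: "finite I"
    and u': "\<And>x. x \<in> U \<Longrightarrow> (u has_derivative u' x) (at x)"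
    and u2: "\<And>x \<xi>. x \<in> U \<Longrightarrow> ((\<lambda>x. u' x \<xi>) has_derivative u2 x \<xi>) (at x)"
    and X: "\<And>i. i \<in> I \<Longrightarrow> continuous_on U (X i)" and b: "continuous_on U b"
    and elliptic: "\<And>x \<xi>. x \<in> U \<Longrightarrow> \<xi> \<noteq> 0 \<Longrightarrow> (\<Sum>i\<in>I. (\<xi> \<bullet> X i x)\<^sup>2) > 0"
    and L: "\<And>x. x \<in> U \<Longrightarrow> (\<Sum>i\<in>I. u2 x (X i x) (X i x)) + u' x (b x) \<le> 0"
    and m: "\<And>x. x \<in> U \<Longrightarrow> m \<le> u x" and z0: "z0 \<in> U" "u z0 = m"
  obtains r where "r > 0" "ball z0 r \<subseteq> U" "\<And>x. x \<in> ball z0 r \<Longrightarrow> u x = m"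
proof -
  obtain \<rho> where \<rho>: "\<rho> > 0" "cball z0 \<rho> \<subseteq> U"
    using U z0(1) open_contains_cball by blast
  \<comment> \<open>A third of \<open>\<rho>\<close> keeps everything inside: the nearest point of
    \<open>Z\<close> to \<open>y1\<close> lies within \<open>2 * r\<close> of \<open>z0\<close>, and
    the ball \<open>K\<close> about it reaches less than \<open>r\<close> further.\<close>
  define r where "r = \<rho> / 3"
  have cu: "continuous_on U u"
    using u' by (meson continuous_at_imp_continuous_on has_derivative_continuous)
  have "u y1 = m" if y1: "y1 \<in> ball z0 r" for y1
  proof (rule ccontr)
    assume ne: "u y1 \<noteq> m"
    define Z where "Z = {x \<in> cball z0 \<rho>. u x = m}"
    have "closed Z"
      unfolding Z_def
      by (rule continuous_closed_preimage_constant[OF continuous_on_subset[OF cu \<rho>(2)] closed_cball])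
    moreover have z0Z: "z0 \<in> Z" using z0 \<rho> by (simp add: Z_def)
    ultimately obtain z where z: "z \<in> Z" "\<And>x. x \<in> Z \<Longrightarrow> dist y1 z \<le> dist y1 x"
      using distance_attains_inf[of Z y1] by blast
    define R where "R = dist y1 z / 2"
    define y where "y = midpoint y1 z"
    have y1Z: "y1 \<notin> Z" using ne by (simp add: Z_def)
    then have R: "R > 0" using z(1) by (auto simp: R_def)
    have R2: "2 * R < r" using z(2)[OF z0Z] y1 by (simp add: R_def dist_commute)
    have uz: "u z = m" using z(1) by (simp add: Z_def)
    have distz: "dist z0 z < 2 * r"
      using dist_triangle[of z0 z y1] y1 R2 by (simp add: R_def)
    \<comment> \<open>Half of \<open>R\<close> keeps the centre \<open>y\<close>, where
      \<open>q\<close> vanishes, outside \<open>K\<close>.\<close>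
    define s where "s = R / 2"
    define K where "K = cball z s"
    have KB: "K \<subseteq> cball z0 \<rho>"
    proof
      fix x assume "x \<in> K"
      then have "dist z0 x \<le> dist z0 z + s"
        using dist_triangle[of z0 x z] by (simp add: K_def)
      then show "x \<in> cball z0 \<rho>"
        using distz R2 R by (simp add: s_def r_def)
    qed
    then have KU: "K \<subseteq> U" using \<rho>(2) by blast
    have dyz: "dist y z = R"
      by (simp add: y_def R_def dist_midpoint)
    have yK: "y \<notin> K" using dyz R by (simp add: K_def s_def dist_commute)
    have K: "compact K" "z \<in> K" using R by (auto simp: K_def s_def)
    have pos: "u x > m" if "x \<in> K" "x \<in> cball y R" "x \<noteq> z" for x
    proof -
      have "dist x y1 < dist y1 z"
        using that internally_tangent_ball[of x y1 z] by (simp add: y_def R_def dist_commute)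
      then have "x \<notin> Z" using z(2)[of x] by (auto simp: dist_commute)
      then have "u x \<noteq> m" using that KB by (auto simp: Z_def)
      then show ?thesis using m[of x] that KU by force
    qed
    define q where "q x = (\<Sum>i\<in>I. ((x - y) \<bullet> X i x)\<^sup>2)" for x
    define B where "B x = (\<Sum>i\<in>I. X i x \<bullet> X i x) + (x - y) \<bullet> b x" for x
    have XK: "continuous_on K (X i)" if "i \<in> I" for i
      using X[OF that] KU continuous_on_subset by blast
    have bK: "continuous_on K b" using b KU continuous_on_subset by blast
    have "continuous_on K q" unfolding q_def[abs_def] using XK by (intro continuous_intros) auto
    then obtain x1 where x1: "x1 \<in> K" "\<And>x. x \<in> K \<Longrightarrow> q x1 \<le> q x"
      using continuous_attains_inf[OF K(1), of q] K(2) by blast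
    have "continuous_on K B" unfolding B_def[abs_def] using XK bK by (intro continuous_intros) auto
    then obtain x2 where x2: "x2 \<in> K" "\<And>x. x \<in> K \<Longrightarrow> B x \<le> B x2"
      using continuous_attains_sup[OF K(1), of B] K(2) by blast
    have q1: "q x1 > 0"
      unfolding q_def using x1(1) yK KU by (intro elliptic) auto
    \<comment> \<open>Chosen so large that the leading part \<open>q\<close> of the operator applied
      to the Gaussian dominates the lower-order part \<open>B\<close> on all of \<open>K\<close>;
      the 1 makes the estimate strict.\<close>
    define \<alpha> where "\<alpha> = (\<bar>B x2\<bar> + 1) / q x1"
    have \<alpha>: "\<alpha> > 0" using q1 by (simp add: \<alpha>_def)
    have barrier: "4 * \<alpha>\<^sup>2 * q x - 2 * \<alpha> * B x > 0" if "x \<in> K" for x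
    proof -
      have "B x < 2 * (\<alpha> * q x1)"
        using x2(2)[OF that] q1 by (simp add: \<alpha>_def)
      also have "\<dots> \<le> 2 * (\<alpha> * q x)"
        using x1(2)[OF that] \<alpha> by simp
      finally have "2 * \<alpha> * B x < 2 * \<alpha> * (2 * (\<alpha> * q x))"
        using \<alpha> by simp
      then show ?thesis by (simp add: power2_eq_square)
    qed
    define E where "E x = exp (- \<alpha> * ((x - y) \<bullet> (x - y)))" for x
    define w where "w x = E x - exp (- \<alpha> * R\<^sup>2)" for x
    have sq: "(x - y) \<bullet> (x - y) = (dist x y)\<^sup>2" for x
      by (simp add: dist_norm power2_norm_eq_inner)
    have w1: "w x \<le> 1" for x
    proof -
      have "E x \<le> 1" using \<alpha> by (simp add: E_def)
      then show ?thesis unfolding w_def using exp_gt_zero[of "- \<alpha> * R\<^sup>2"] by linarith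
    qed
    have wneg: "w x < 0" if "x \<notin> cball y R" for x
    proof -
      have "R\<^sup>2 < (dist x y)\<^sup>2"
        using that R by (intro power_strict_mono) (auto simp: dist_commute)
      then show ?thesis using \<alpha> by (simp add: w_def E_def sq)
    qed
    have wz: "w z = 0" using dyz by (simp add: w_def E_def sq dist_commute)
    \<comment> \<open>On the part of the sphere inside the ball about \<open>y\<close>, compactness
      gives a margin of \<open>u\<close> above \<open>m\<close> against which \<delta> is chosen; on
      the rest \<open>w\<close> is negative.\<close>
    have "\<exists>\<delta>>0. \<forall>x\<in>sphere z s. u x - m - \<delta> * w x > 0"
    proof (cases "sphere z s \<inter> cball y R = {}")
      case True
      show ?thesis
      proof (intro exI[of _ 1] conjI ballI)
        fix x assume x: "x \<in> sphere z s"
        then have "w x < 0" using True wneg by blast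
        moreover have "m \<le> u x" using x KU by (intro m) (auto simp: K_def)
        ultimately show "u x - m - 1 * w x > 0" by simp
      qed simp
    next
      case False
      have c: "compact (sphere z s \<inter> cball y R)" by (intro compact_Int_closed) auto
      have sub: "sphere z s \<inter> cball y R \<subseteq> U" using KU by (auto simp: K_def)
      obtain x3 where x3: "x3 \<in> sphere z s \<inter> cball y R"
        "\<And>x. x \<in> sphere z s \<inter> cball y R \<Longrightarrow> u x3 \<le> u x"
        using continuous_attains_inf[OF c False continuous_on_subset[OF cu sub]] by blast
      have "u x3 > m" using x3(1) R by (intro pos) (auto simp: K_def s_def)
      define \<delta> where "\<delta> = (u x3 - m) / 2"
      have \<delta>: "\<delta> > 0" using \<open>u x3 > m\<close> by (simp add: \<delta>_def)
      show ?thesis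
      proof (intro exI[of _ \<delta>] conjI ballI)
        fix x assume x: "x \<in> sphere z s"
        show "u x - m - \<delta> * w x > 0"
        proof (cases "x \<in> cball y R")
          case True
          have "\<delta> * w x \<le> \<delta> * 1" using w1 \<delta> by (intro mult_left_mono) auto
          moreover have "u x3 \<le> u x" using x True by (intro x3(2)) auto
          ultimately show ?thesis using \<open>u x3 > m\<close> by (simp add: \<delta>_def field_simps)
        next
          case False
          then have "\<delta> * w x < 0" using wneg \<delta> by (simp add: mult_pos_neg)
          moreover have "m \<le> u x" using x KU by (intro m) (auto simp: K_def)
          ultimately show ?thesis by simp
        qed
      qed (rule \<delta>)
    qed
    then obtain \<delta> where \<delta>: "\<delta> > 0" "\<And>x. x \<in> sphere z s \<Longrightarrow> u x - m - \<delta> * w x > 0"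
      by blast
    define v where "v x = u x - \<delta> * E x" for x
    have cont: "continuous_on K v"
      unfolding v_def E_def using continuous_on_subset[OF cu KU] by (intro continuous_intros)
    then obtain p where p: "p \<in> K" "\<And>x. x \<in> K \<Longrightarrow> v p \<le> v x"
      using continuous_attains_inf[OF K(1), of v] K(2) by blast
    \<comment> \<open>Because \<open>w z = 0\<close> and \<open>u z = m\<close>, the value of
      \<open>v\<close> at \<open>z\<close> lies strictly below its values on the sphere.\<close>
    have "p \<notin> sphere z s"
    proof
      assume "p \<in> sphere z s"
      then have "v p > v z"
        using \<delta>(2)[of p] wz uz by (simp add: v_def w_def algebra_simps)
      then show False using p(2)[OF K(2)] by simp
    qed
    then have pb: "p \<in> ball z s" using p(1) by (auto simp: K_def)
    have pU: "p \<in> U" using p(1) KU by blast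
    have min: "u' p \<xi> - \<delta> * (- 2 * \<alpha> * ((p - y) \<bullet> \<xi>) * E p) = 0"
      "u2 p \<xi> \<xi> - \<delta> * ((4 * \<alpha>\<^sup>2 * ((p - y) \<bullet> \<xi>) * ((p - y) \<bullet> \<xi>) - 2 * \<alpha> * (\<xi> \<bullet> \<xi>)) * E p) \<ge> 0" for \<xi>
    proof -
      have 1: "(v has_derivative (\<lambda>\<xi>. u' x \<xi> - \<delta> * (- 2 * \<alpha> * ((x - y) \<bullet> \<xi>) * E x))) (at x)"
        if "x \<in> ball z s" for x
        unfolding v_def[abs_def] E_def using that KU
        by (intro has_derivative_diff has_derivative_mult_right u' barrier_derivatives) (auto simp: K_def)
      have 2: "((\<lambda>x. u' x \<xi> - \<delta> * (- 2 * \<alpha> * ((x - y) \<bullet> \<xi>) * E x)) has_derivative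
         (\<lambda>\<eta>. u2 p \<xi> \<eta> - \<delta> * ((4 * \<alpha>\<^sup>2 * ((p - y) \<bullet> \<xi>) * ((p - y) \<bullet> \<eta>) - 2 * \<alpha> * (\<eta> \<bullet> \<xi>)) * E p))) (at p)"
        unfolding E_def
        by (intro has_derivative_diff has_derivative_mult_right u2 barrier_derivatives pU)
      have 3: "v p \<le> v x" if "x \<in> ball z s" for x
        using that by (intro p(2)) (auto simp: K_def)
      show "u' p \<xi> - \<delta> * (- 2 * \<alpha> * ((p - y) \<bullet> \<xi>) * E p) = 0"
        "u2 p \<xi> \<xi> - \<delta> * ((4 * \<alpha>\<^sup>2 * ((p - y) \<bullet> \<xi>) * ((p - y) \<bullet> \<xi>) - 2 * \<alpha> * (\<xi> \<bullet> \<xi>)) * E p) \<ge> 0"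
        using local_minimum_second_derivative[OF open_ball pb 1 2 3] by auto
    qed
    \<comment> \<open>The second-order conditions along the vectors \<open>X i p\<close> and the
      first-order condition along \<open>b p\<close> bound a positive quantity by the left side of
      the differential inequality.\<close>
    have "\<delta> * E p * (4 * \<alpha>\<^sup>2 * q p - 2 * \<alpha> * B p)
      = (\<Sum>i\<in>I. \<delta> * ((4 * \<alpha>\<^sup>2 * ((p - y) \<bullet> X i p) * ((p - y) \<bullet> X i p) - 2 * \<alpha> * (X i p \<bullet> X i p)) * E p))
        + \<delta> * (- 2 * \<alpha> * ((p - y) \<bullet> b p) * E p)"
      unfolding q_def B_def
      by (simp add: sum_distrib_left sum_distrib_right sum_subtractf sum.distrib algebra_simps power2_eq_square)
    also have "\<dots> \<le> (\<Sum>i\<in>I. u2 p (X i p) (X i p)) + u' p (b p)"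
    proof (intro add_mono sum_mono)
      show "\<delta> * ((4 * \<alpha>\<^sup>2 * ((p - y) \<bullet> X i p) * ((p - y) \<bullet> X i p) - 2 * \<alpha> * (X i p \<bullet> X i p)) * E p)
        \<le> u2 p (X i p) (X i p)" for i
        using min(2)[of "X i p"] by linarith
      show "\<delta> * (- 2 * \<alpha> * ((p - y) \<bullet> b p) * E p) \<le> u' p (b p)"
        using min(1)[of "b p"] by linarith
    qed
    also have "\<dots> \<le> 0" by (rule L[OF pU])
    finally have "\<delta> * E p * (4 * \<alpha>\<^sup>2 * q p - 2 * \<alpha> * B p) \<le> 0" .
    moreover have "\<delta> * E p * (4 * \<alpha>\<^sup>2 * q p - 2 * \<alpha> * B p) > 0"
      using \<delta>(1) barrier[OF p(1)] by (intro mult_pos_pos) (auto simp: E_def)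
    ultimately show False by linarith
  qed
  moreover have "r > 0" "ball z0 r \<subseteq> U"
    using \<rho> by (auto simp: r_def subset_iff)
  ultimately show thesis using that by blast
qed

section \<open>The gauge field\<close>

lemma bounded_bilinear_matrix_mult: "bounded_bilinear ((**) :: real^'r^'r \<Rightarrow> real^'r^'r \<Rightarrow> real^'r^'r)"
proof -
  have "bilinear ((**) :: real^'r^'r \<Rightarrow> real^'r^'r \<Rightarrow> real^'r^'r)"
    unfolding bilinear_def
  proof (intro conjI allI)
    show "linear ((**) A)" for A :: "real^'r^'r"
      by (rule linearI)
         (simp_all add: matrix_matrix_mult_def vec_eq_iff distrib_left sum.distrib sum_distrib_left mult.left_commute)
    show "linear (\<lambda>A. A ** B)" for B :: "real^'r^'r"
      by (rule linearI)
         (simp_all add: matrix_matrix_mult_def vec_eq_iff distrib_right sum.distrib sum_distrib_left mult.assoc)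
  qed
  then show ?thesis by (simp add: bilinear_conv_bounded_bilinear)
qed

interpretation matrix_mult: bounded_bilinear "(**) :: real^'r^'r \<Rightarrow> real^'r^'r \<Rightarrow> real^'r^'r"
  by (rule bounded_bilinear_matrix_mult)

locale gauge_chart = torsion_chart M a H for M :: "('i, 'm) spin_mfd" and a H +
  fixes E :: "('i, 'm, 'r::finite) metric_bundle"
  assumes A_linear: "x \<in> P \<Longrightarrow> linear (gauge_pot E a x)"
    and sm_A: "sm (\<lambda>x. gauge_pot E a x u)"
begin

abbreviation A where "A \<equiv> gauge_pot E a"
abbreviation F where "F \<equiv> gauge_curv M E a"

lemmas sm_matrix_mult = sm_bilinear[OF bounded_bilinear_matrix_mult]
lemmas dv_matrix_mult = dv_bilinear[OF bounded_bilinear_matrix_mult]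

lemma sm_F: "sm (\<lambda>x. F x u v)"
  unfolding gauge_curv_def by (intro sm_add sm_diff sm_dv sm_matrix_mult sm_A)

lemma F_skew: "F x u v = - F x v u"
  by (simp add: gauge_curv_def)

lemma dv_A_linear:
  assumes x: "x \<in> P"
  shows "linear (\<lambda>v. dv w (\<lambda>y. A y v) x)"
proof (rule linearI)
  fix u v :: "real^6" and c :: real
  have "dv w (\<lambda>y. A y (u + v)) x = dv w (\<lambda>y. A y u + A y v) x"
    by (rule dv_cong[OF _ sm_add[OF sm_A sm_A] x]) (rule linear_add[OF A_linear])
  then show "dv w (\<lambda>y. A y (u + v)) x = dv w (\<lambda>y. A y u) x + dv w (\<lambda>y. A y v) x"
    by (simp add: dv_add[OF sm_A sm_A x])
  have "dv w (\<lambda>y. A y (c *\<^sub>R u)) x = dv w (\<lambda>y. c *\<^sub>R A y u) x"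
    by (rule dv_cong[OF _ sm_cmult[OF sm_A] x]) (rule linear_scale[OF A_linear])
  then show "dv w (\<lambda>y. A y (c *\<^sub>R u)) x = c *\<^sub>R dv w (\<lambda>y. A y u) x"
    by (simp add: dv_cmult[OF sm_A x])
qed

lemma F_linear1:
  assumes x: "x \<in> P"
  shows "linear (\<lambda>u. F x u v)"
  using A_linear[OF x]
  by (intro linearI)
     (simp_all add: gauge_curv_def linear_add[OF dv_A_linear[OF x]] linear_scale[OF dv_A_linear[OF x]]
       linear_add[OF dv_linear[OF sm_A x]] linear_scale[OF dv_linear[OF sm_A x]]
       linear_add linear_scale matrix_mult.add_left matrix_mult.add_right matrix_mult.scaleR_left
       matrix_mult.scaleR_right algebra_simps)

lemma F_linear2:
  assumes x: "x \<in> P"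
  shows "linear (\<lambda>v. F x u v)"
proof -
  have "(\<lambda>v. F x u v) = (\<lambda>v. - F x v u)" by (intro ext) (rule F_skew)
  then show ?thesis using linear_compose_neg[OF F_linear1[OF x]] by simp
qed

text \<open>Second derivatives of the potential cancel by \<open>dv_commute\<close>; the terms
  linear in its first derivatives and the cubic terms cancel within the cyclic sum of
  commutators.\<close>

lemma bianchi_coord:
  assumes x: "x \<in> P"
  shows "(dv u (\<lambda>y. F y v w) x + A x u ** F x v w - F x v w ** A x u)
     + (dv v (\<lambda>y. F y w u) x + A x v ** F x w u - F x w u ** A x v)
     + (dv w (\<lambda>y. F y u v) x + A x w ** F x u v - F x u v ** A x w) = 0"
proof -
  have d: "dv u (\<lambda>y. F y v w) x = dv u (dv v (\<lambda>y. A y w)) x - dv u (dv w (\<lambda>y. A y v)) x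
     + (A x v ** dv u (\<lambda>y. A y w) x + dv u (\<lambda>y. A y v) x ** A x w)
     - (A x w ** dv u (\<lambda>y. A y v) x + dv u (\<lambda>y. A y w) x ** A x v)" for u v w
    unfolding gauge_curv_def
    by (simp only: dv_add dv_diff sm_add sm_diff sm_dv sm_matrix_mult sm_A dv_matrix_mult x)
  have c: "dv u (dv v (\<lambda>y. A y w)) x = dv v (dv u (\<lambda>y. A y w)) x" for u v w
    by (rule dv_commute[OF sm_A x])
  show ?thesis
    unfolding d using c[of u v w] c[of v w u] c[of w u v]
    by (simp add: gauge_curv_def matrix_mult.add_left matrix_mult.add_right matrix_mult.diff_left
        matrix_mult.diff_right matrix_mul_assoc)
qed

text \<open>The derivatives of the frame fields cancel, so only frame vectors at the point remain
  and the coordinate Bianchi identity becomes applicable.\<close>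

lemma nabla_plus_A_frame:
  assumes x: "x \<in> P"
  shows "nabla_plus_A M H E (gauge_curv M E) a (e k) (e m) (e n) x
    = dv (e k x) (\<lambda>y. F y (e m x) (e n x)) x + A x (e k x) ** F x (e m x) (e n x) - F x (e m x) (e n x) ** A x (e k x)
      - F x (conn 1 x (e k x) (e m x)) (e n x) - F x (e m x) (conn 1 x (e k x) (e n x))"
proof -
  have "vd M a (e k) (\<lambda>y. F y (e m y) (e n y)) x = dv (e k x) (\<lambda>y. F y (e m x) (e n x)) x
     + F x (dv (e k x) (e m) x) (e n x) + F x (e m x) (dv (e k x) (e n) x)"
    unfolding vd_at[of M a "e k"]
    by (rule dv_linear2) (auto simp: x intro: F_linear1 F_linear2 sm_F)
  then show ?thesis
    by (simp add: nabla_plus_A_def nabla_eq linear_add[OF F_linear1[OF x]] linear_add[OF F_linear2[OF x]])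
qed

lemma nabla_plus_A_skew:
  assumes x: "x \<in> P"
  shows "nabla_plus_A M H E (gauge_curv M E) a (e k) (e m) (e n) x
    = - nabla_plus_A M H E (gauge_curv M E) a (e k) (e n) (e m) x"
proof -
  have "dv (e k x) (\<lambda>y. F y (e m x) (e n x)) x = dv (e k x) (\<lambda>y. - F y (e n x) (e m x)) x"
    by (rule dv_cong[OF _ sm_minus[OF sm_F] x]) (rule F_skew)
  also have "\<dots> = - dv (e k x) (\<lambda>y. F y (e n x) (e m x)) x"
    by (rule dv_minus[OF sm_F x])
  finally show ?thesis
    unfolding nabla_plus_A_frame[OF x]
    using F_skew[of x "e m x" "e n x"] F_skew[of x "conn 1 x (e k x) (e m x)" "e n x"]
      F_skew[of x "e m x" "conn 1 x (e k x) (e n x)"]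
    by (simp add: matrix_mult.minus_left matrix_mult.minus_right)
qed

text \<open>Without torsion the connection term is symmetric, so its contributions cancel in pairs
  and the coordinate identity remains.\<close>

lemma gauge_bianchi:
  assumes x: "x \<in> P" and H0: "\<And>u v w. H a x u v w = 0"
  shows "nabla_plus_A M H E (gauge_curv M E) a (e k) (e m) (e n) x
    + nabla_plus_A M H E (gauge_curv M E) a (e m) (e n) (e k) x
    + nabla_plus_A M H E (gauge_curv M E) a (e n) (e k) (e m) x = 0"
proof -
  have c: "conn 1 x u v = chr x u v" for u v
    by (simp add: conn_def H0)
  show ?thesis
    unfolding nabla_plus_A_frame[OF x] c
    using bianchi_coord[OF x, of "e k x" "e m x" "e n x"]
      F_skew[of x "chr x (e k x) (e m x)" "e n x"] F_skew[of x "chr x (e m x) (e n x)" "e k x"]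
      F_skew[of x "chr x (e n x) (e k x)" "e m x"]
      chr_sym[OF x, of "e m x" "e k x"] chr_sym[OF x, of "e n x" "e k x"] chr_sym[OF x, of "e n x" "e m x"]
    by (simp add: algebra_simps)
qed

lemma F_comp_skew: "F_comp M E a x i j s t = - F_comp M E a x j i s t"
  unfolding F_comp_def using F_skew[of x "e i x" "e j x"] by simp

lemma divergence_F:
  assumes \<phi>: "sm \<phi>" and x: "x \<in> P"
  shows "nabla_plus_A M H E (\<lambda>b y u v. exp (- 2 * \<phi> y) *\<^sub>R gauge_curv M E b y u v) a (e k) (e m) (e n) x
    = exp (- 2 * \<phi> x) *\<^sub>R (nabla_plus_A M H E (gauge_curv M E) a (e k) (e m) (e n) x
        - (2 * D k \<phi> x) *\<^sub>R F x (e m x) (e n x))"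
proof -
  have "sm (\<lambda>y. F y (e m y) (e n y))"
    by (rule sm_linear2) (auto intro: F_linear1 F_linear2 sm_F)
  from dv_exp[OF \<phi> this x, of "e k"] show ?thesis
    unfolding nabla_plus_A_def
    by (simp add: matrix_mult.scaleR_left matrix_mult.scaleR_right scaleR_diff_right scaleR_add_right)
qed

lemma nabla_plus_A_comp:
  assumes x: "x \<in> P"
  shows "nabla_plus_A M H E (gauge_curv M E) a (e k) (e m) (e n) x $ t $ s
    = D k (\<lambda>y. F_comp M E a y m n s t) x
      - ((\<Sum>p\<in>UNIV. Wc 1 k m p x * F_comp M E a x p n s t) + (\<Sum>p\<in>UNIV. Wc 1 k n p x * F_comp M E a x m p s t))
      + ((\<Sum>r\<in>UNIV. A x (e k x) $ t $ r * F_comp M E a x m n s r)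
         - (\<Sum>r\<in>UNIV. A x (e k x) $ r $ s * F_comp M E a x m n r t))"
proof -
  have sF: "sm (\<lambda>y. F y (e m y) (e n y))"
    by (rule sm_linear2) (auto intro: F_linear1 F_linear2 sm_F)
  have "D k (\<lambda>y. F_comp M E a y m n s t) x = vd M a (e k) (\<lambda>y. F y (e m y) (e n y)) x $ t $ s"
    unfolding F_comp_def
    by (simp add: vd_bounded_linear[OF bounded_linear_vec_nth sm_nth[OF sF] x] vd_bounded_linear[OF bounded_linear_vec_nth sF x])
  then show ?thesis
    by (simp add: nabla_plus_A_def nabla_frame[OF x] linear_sum[OF F_linear1[OF x]] linear_sum[OF F_linear2[OF x]]
      linear_scale[OF F_linear1[OF x]] linear_scale[OF F_linear2[OF x]] F_comp_def matrix_matrix_mult_def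
      mult.commute[of "F x (e m x) (e n x) $ _ $ _"])
qed

end

locale gauge_spinor_chart = spinor_chart M a H \<Gamma> + gauge_chart M a H E
  for M :: "('i, 'm) spin_mfd" and a H \<Gamma> and E :: "('i, 'm, 'r::finite) metric_bundle"
begin

lemma gauge_divergence_free:
  fixes s :: "'m \<Rightarrow> complex^8"
  assumes sm_s: "sm s" and s_nonzero: "\<And>x. x \<in> P \<Longrightarrow> s x \<noteq> 0"
    and parallel: "\<And>x i. x \<in> P \<Longrightarrow> D i s x = (1/4) *\<^sub>R G2 (\<lambda>j k. Wc 1 i j k x) (s x)"
    and gaugino: "\<And>x p q. x \<in> P \<Longrightarrow> G2 (\<lambda>m n. F_comp M E a x m n p q) (s x) = 0"
    and x: "x \<in> P" and H0: "\<And>u v w. H a x u v w = 0"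
  shows "(\<Sum>k\<in>UNIV. nabla_plus_A M H E (gauge_curv M E) a (e k) (e k) (e n) x) = 0"
proof -
  define K where "K k m n = nabla_plus_A M H E (gauge_curv M E) a (e k) (e m) (e n) x" for k m n
  have sF: "sm (\<lambda>y. F_comp M E a y m n p q)" for m n p q
  proof -
    have "sm (\<lambda>y. F y (e m y) (e n y))"
      by (rule sm_linear2) (auto intro: F_linear1 F_linear2 sm_F)
    then show ?thesis unfolding F_comp_def by (intro sm_nth)
  qed
  have G: "G2 (\<lambda>m n. K k m n $ q $ p) (s x) = 0" for k p q
  proof -
    have "D k (\<lambda>y. G2 (\<lambda>m n. F_comp M E a y m n p q) (s y)) x = D k (\<lambda>y. 0) x"
      by (rule vd_cong[OF gaugino sm_const x])
    then have 1: "G2 (\<lambda>m n. D k (\<lambda>y. F_comp M E a y m n p q) x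
      - ((\<Sum>r\<in>UNIV. Wc 1 k m r x * F_comp M E a x r n p q) + (\<Sum>r\<in>UNIV. Wc 1 k n r x * F_comp M E a x m r p q))) (s x) = 0"
      using D_G2[OF sm_s parallel sF x, of k "\<lambda>m n. m" "\<lambda>m n. n" "\<lambda>m n. p" "\<lambda>m n. q"] gaugino[OF x]
      by (simp add: G2_simps)
    \<comment> \<open>The commutator with the gauge potential is a linear combination of components
      of the gauge curvature, each of which annihilates the spinor.\<close>
    show ?thesis
      unfolding K_def nabla_plus_A_comp[OF x] G2_add G2_diff[of "\<lambda>m n. \<Sum>r\<in>UNIV. A x (e k x) $ q $ r * F_comp M E a x m n p r"] 1
      by (simp add: G2_sum G2_scale gaugino[OF x])
  qed
  have "(\<Sum>k\<in>UNIV. K k k n $ q $ p) = 0" for p q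
  proof -
    have skew: "K k m n $ q $ p = - K k n m $ q $ p" for k m n
      unfolding K_def by (subst nabla_plus_A_skew[OF x]) simp
    have cyc: "K k m n $ q $ p + K m n k $ q $ p + K n k m $ q $ p = 0" for k m n
      using arg_cong[OF gauge_bianchi[OF x H0, of k m n], of "\<lambda>z. z $ q $ p"] by (simp add: K_def)
    have "G3 (\<lambda>k m n. K k m n $ q $ p) (s x) = 0"
      unfolding G3_def G by (simp add: \<gamma>_simps)
    then have "G1 (\<lambda>n. \<Sum>k\<in>UNIV. K k k n $ q $ p) (s x) = 0"
      using G3_cyclic_sum[of "\<lambda>k m n. K k m n $ q $ p" "s x", OF skew] unfolding cyc G3_0 by simp
    then show ?thesis
      by (rule G1_eq_0D[OF _ s_nonzero[OF x]])
  qed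
  then show ?thesis
    by (simp add: K_def vec_eq_iff)
qed

end

section \<open>The minimum principle in a chart\<close>

context riemannian_chart
begin

lemma continuous_in_coord: "sm f \<Longrightarrow> continuous_on (coord M a ` P) (in_coord M a f)"
  unfolding smooth_in_def smooth_on_def by (metis Ck_on.simps(1))

lemma strong_minimum_principle_chart:
  assumes \<phi>: "sm \<phi>" and m: "\<And>x. x \<in> P \<Longrightarrow> m \<le> \<phi> x"
    and L: "\<And>x. x \<in> P \<Longrightarrow> (\<Sum>i\<in>UNIV. hess M \<phi> a x i i) \<le> 2 * (\<Sum>i\<in>UNIV. D i \<phi> x * D i \<phi> x)"
    and x0: "x0 \<in> P" "\<phi> x0 = m"
  obtains r where "r > 0" "\<And>y. y \<in> P \<Longrightarrow> coord M a y \<in> ball (coord M a x0) r \<Longrightarrow> \<phi> y = m"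
proof -
  \<comment> \<open>In coordinates the trace of the Hessian has the frame vectors as second-order
    coefficients. The drift \<open>b\<close> collects its first-order part and absorbs the quadratic
    gradient term by freezing one factor \<open>D i \<phi>\<close> as a coefficient, so a linear
    inequality results.\<close>
  define b where "b x = (\<Sum>i\<in>UNIV. vd M a (e i) (e i) x - nabla_g M a (e i) (e i) x - (2 * D i \<phi> x) *\<^sub>R e i x)" for x
  have sb: "sm b"
  proof -
    have "sm (\<lambda>x. 2 *\<^sub>R D i \<phi> x)" for i
      by (intro sm_cmult sm_vd sm_frame \<phi>)
    then show ?thesis
      unfolding b_def[abs_def] by (intro sm_sum sm_diff sm_vd sm_nabla_g sm_frame sm_scaleR) simp
  qed
  let ?c = "coord M a"
  obtain r where r: "r > 0" "ball (?c x0) r \<subseteq> ?c ` P" "\<And>z. z \<in> ball (?c x0) r \<Longrightarrow> in_coord M a \<phi> z = m"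
  proof (rule strong_minimum_principle_local[of "?c ` P" "UNIV :: 6 set" "in_coord M a \<phi>"
        "\<lambda>z \<xi>. in_coord M a (dv \<xi> \<phi>) z" "\<lambda>z \<xi> \<eta>. in_coord M a (dv \<eta> (dv \<xi> \<phi>)) z"
        "\<lambda>i. in_coord M a (e i)" "in_coord M a b" m "?c x0"])
    fix z assume z: "z \<in> ?c ` P"
    then obtain x where x: "x \<in> P" "z = ?c x" by blast
    show "(in_coord M a \<phi> has_derivative (\<lambda>\<xi>. in_coord M a (dv \<xi> \<phi>) z)) (at z)"
      using sm_deriv[OF \<phi> x(1)] x by simp
    show "((\<lambda>z. in_coord M a (dv \<xi> \<phi>) z) has_derivative (\<lambda>\<eta>. in_coord M a (dv \<eta> (dv \<xi> \<phi>)) z)) (at z)" for \<xi>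
      using sm_deriv[OF sm_dv[OF \<phi>] x(1), of \<xi>] x by simp
    show "m \<le> in_coord M a \<phi> z" using m x by simp
    \<comment> \<open>Ellipticity: a vector orthogonal to the whole frame in the coordinate inner
      product is orthogonal to itself by \<open>frame_expansion\<close>.\<close>
    show "(\<Sum>i\<in>UNIV. (\<xi> \<bullet> in_coord M a (e i) z)\<^sup>2) > 0" if "\<xi> \<noteq> 0" for \<xi>
    proof (rule ccontr)
      assume "\<not> ?thesis"
      then have "(\<Sum>i\<in>UNIV. (\<xi> \<bullet> e i x)\<^sup>2) = 0"
        using x by (simp add: antisym sum_nonneg not_less)
      then have "\<xi> \<bullet> e i x = 0" for i by (simp add: sum_nonneg_eq_0_iff)
      then have "\<xi> \<bullet> (\<Sum>k\<in>UNIV. gmet M a x \<xi> (e k x) *\<^sub>R e k x) = 0"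
        by (simp add: inner_sum_right)
      then show False using frame_expansion[OF x(1), of \<xi>] that by simp
    qed
    have "(\<Sum>i\<in>UNIV. dv (e i x) (dv (e i x) \<phi>) x) + dv (b x) \<phi> x
      = (\<Sum>i\<in>UNIV. hess M \<phi> a x i i) - 2 * (\<Sum>i\<in>UNIV. D i \<phi> x * D i \<phi> x)"
    proof -
      note l = linear_sum[OF dv_linear[OF \<phi> x(1)]] linear_diff[OF dv_linear[OF \<phi> x(1)]] linear_scale[OF dv_linear[OF \<phi> x(1)]]
      have "dv (b x) \<phi> x = (\<Sum>i\<in>UNIV. dv (vd M a (e i) (e i) x) \<phi> x - dv (nabla_g M a (e i) (e i) x) \<phi> x
          - 2 * D i \<phi> x * dv (e i x) \<phi> x)"
        by (simp add: b_def l)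
      moreover have "hess M \<phi> a x i i = dv (e i x) (dv (e i x) \<phi>) x + dv (vd M a (e i) (e i) x) \<phi> x
          - dv (nabla_g M a (e i) (e i) x) \<phi> x" for i
        unfolding hess_def vd_vd[OF sm_frame \<phi> x(1)] vd_at[of M a "nabla_g M a (e i) (e i)"] ..
      moreover have "dv (e i x) \<phi> x = D i \<phi> x" for i by (rule vd_at[symmetric])
      ultimately show ?thesis
        by (simp add: sum.distrib sum_subtractf sum_distrib_left mult.assoc)
    qed
    then show "(\<Sum>i\<in>UNIV. in_coord M a (dv (in_coord M a (e i) z) (dv (in_coord M a (e i) z) \<phi>)) z)
        + in_coord M a (dv (in_coord M a b z) \<phi>) z \<le> 0"
      using L[OF x(1)] x by simp
  qed (use x0 sb in \<open>auto intro: open_image continuous_in_coord\<close>)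
  show thesis
    by (rule that[OF r(1)]) (use r(3) in \<open>metis in_coord_apply\<close>)
qed

end

section \<open>The equations of motion\<close>

context torsion_chart
begin

lemma linear_frame_eq_0:
  assumes "linear f" "x \<in> P" "\<And>k. f (e k x) = 0"
  shows "f v = (0::real)"
  using g_right_expansion[OF assms(1,2), of v] assms(3) by simp

lemma H_eq_0_iff:
  assumes x: "x \<in> P"
  shows "(\<forall>u v w. H a x u v w = 0) \<longleftrightarrow> (\<forall>i j k. Hc i j k x = 0)"
proof
  assume 0: "\<forall>i j k. Hc i j k x = 0"
  have "H a x (e i x) (e j x) w = 0" for i j w
    by (rule linear_frame_eq_0[OF H_linear3[OF x] x]) (use 0 in \<open>simp add: H_comp_def\<close>)
  then have "H a x (e i x) v w = 0" for i v w
    by (rule linear_frame_eq_0[OF H_linear2[OF x] x])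
  then have "H a x u v w = 0" for u v w
    by (rule linear_frame_eq_0[OF H_linear1[OF x] x])
  then show "\<forall>u v w. H a x u v w = 0" by blast
qed (simp add: H_comp_def)

text \<open>Vanishing is required on the whole patch, since \<open>T\<close> differentiates
  \<open>H\<close>.\<close>

lemma T_eq_0:
  assumes H0: "\<And>y u v w. y \<in> P \<Longrightarrow> H a y u v w = 0" and x: "x \<in> P"
  shows "T i j k l x = 0"
proof -
  have Hc: "Hc i j k y = 0" if "y \<in> P" for i j k y
    using H0[OF that] by (simp add: H_comp_def)
  have "D i (Hc j k l) x = D i (\<lambda>_. 0) x"
    by (rule vd_cong[OF Hc sm_const x])
  then show ?thesis by (simp add: T_def Hc[OF x])
qed

end

context gauge_spinor_chart
begin

definition einstein_lhs where
  "einstein_lhs \<phi> \<alpha>' x i j = Ric_g M a x i j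
    - 1/4 * (\<Sum>m\<in>UNIV. \<Sum>n\<in>UNIV. H_comp M H a x i m n * H_comp M H a x j m n)
    + 2 * hess M \<phi> a x i j
    - \<alpha>' / 4 *
      ((\<Sum>m\<in>UNIV. \<Sum>n\<in>UNIV. \<Sum>s\<in>UNIV. F_comp M E a x i m n s * F_comp M E a x j m n s)
       - (\<Sum>m\<in>UNIV. \<Sum>n\<in>UNIV. \<Sum>s\<in>UNIV. R_minus M H a x i m n s * R_minus M H a x j m n s))"

context
  fixes s :: "'m \<Rightarrow> complex^8" and \<phi> :: "'m \<Rightarrow> real" and \<alpha>' :: real
  assumes sm_s: "sm s" and sm_\<phi>: "sm \<phi>" and s_nonzero: "\<And>x. x \<in> P \<Longrightarrow> s x \<noteq> 0"
    and parallel: "\<And>x i. x \<in> P \<Longrightarrow> D i s x = (1/4) *\<^sub>R G2 (\<lambda>j k. Wc 1 i j k x) (s x)"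
    and dilatino: "\<And>x. x \<in> P \<Longrightarrow> G1 (\<lambda>j. D j \<phi> x) (s x) = (1/12) *\<^sub>R G3 (\<lambda>j k l. Hc j k l x) (s x)"
    and gaugino: "\<And>x p q. x \<in> P \<Longrightarrow> G2 (\<lambda>m n. F_comp M E a x m n p q) (s x) = 0"
    and anomaly: "\<And>x i j k l. x \<in> P \<Longrightarrow> dH_comp M H a x i j k l =
        \<alpha>' / 4 * (Tr_wedge (R_minus M H a x) i j k l - Tr_wedge (F_comp M E a x) i j k l)"
    and \<alpha>': "\<alpha>' > 0"
begin

text \<open>The trace terms of both curvatures in the anomaly condition reproduce the
  \<open>\<alpha>'\<close> corrections of the Einstein equation. The gaugino equation removes the
  accompanying term for \<open>F_comp\<close>; for \<open>R_minus\<close> it survives as the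
  obstruction on the right.\<close>

lemma einstein_identity:
  assumes x: "x \<in> P"
  shows "G1 (\<lambda>j. einstein_lhs \<phi> \<alpha>' x i j + 1/2 * ((\<Sum>k\<in>UNIV. T k k i j x) - 2 * (\<Sum>k\<in>UNIV. D k \<phi> x * Hc k i j x))) (s x)
    = - (\<alpha>' / 8) *\<^sub>R (\<Sum>p\<in>UNIV. \<Sum>q\<in>UNIV. G1 (\<lambda>j. R_minus M H a x i j p q) (G2 (\<lambda>k l. R_minus M H a x k l p q) (s x)))"
proof -
  define RR where "RR j = (\<Sum>m\<in>UNIV. \<Sum>p\<in>UNIV. \<Sum>q\<in>UNIV. R_minus M H a x i m p q * R_minus M H a x j m p q)" for j
  define FF where "FF j = (\<Sum>m\<in>UNIV. \<Sum>p\<in>UNIV. \<Sum>q\<in>UNIV. F_comp M E a x i m p q * F_comp M E a x j m p q)" for j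
  define \<Psi> where "\<Psi> = (\<Sum>p\<in>UNIV. \<Sum>q\<in>UNIV. G1 (\<lambda>j. R_minus M H a x i j p q) (G2 (\<lambda>k l. R_minus M H a x k l p q) (s x)))"
  define X where "X j = Ric_g M a x i j
    - 1/4 * (\<Sum>m\<in>UNIV. \<Sum>n\<in>UNIV. H_comp M H a x i m n * H_comp M H a x j m n) + 2 * hess M \<phi> a x i j
    + 1/2 * ((\<Sum>k\<in>UNIV. T k k i j x) - 2 * (\<Sum>k\<in>UNIV. D k \<phi> x * Hc k i j x))" for j
  have 1: "G1 X (s x) = - (1/12) *\<^sub>R G3 (\<lambda>j k l. dH_comp M H a x i j k l) (s x)"
    unfolding X_def by (rule killing_identity[OF sm_s sm_\<phi> s_nonzero parallel dilatino x])
  have R: "G3 (\<lambda>j k l. Tr_wedge (R_minus M H a x) i j k l) (s x) = 6 *\<^sub>R \<Psi> + 12 *\<^sub>R G1 RR (s x)"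
    unfolding Tr_wedge_def \<Psi>_def RR_def by (rule G3_trace_wedge[OF R_comp_skew12[OF x]])
  have F: "G3 (\<lambda>j k l. Tr_wedge (F_comp M E a x) i j k l) (s x) = 12 *\<^sub>R G1 FF (s x)"
    unfolding Tr_wedge_def FF_def G3_trace_wedge[of "F_comp M E a x", OF F_comp_skew] gaugino[OF x]
    by (simp add: G1_simps)
  have dH: "G3 (\<lambda>j k l. dH_comp M H a x i j k l) (s x)
    = (\<alpha>' / 4) *\<^sub>R (6 *\<^sub>R \<Psi> + 12 *\<^sub>R G1 RR (s x) - 12 *\<^sub>R G1 FF (s x))"
    unfolding anomaly[OF x] G3_scale G3_diff R F ..
  have 2: "G1 X (s x) = \<alpha>' *\<^sub>R (- (1/8) *\<^sub>R \<Psi> - (1/4) *\<^sub>R G1 RR (s x) + (1/4) *\<^sub>R G1 FF (s x))"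
    unfolding 1 dH by (simp add: algebra_simps)
  have 3: "(\<lambda>j. einstein_lhs \<phi> \<alpha>' x i j + 1/2 * ((\<Sum>k\<in>UNIV. T k k i j x) - 2 * (\<Sum>k\<in>UNIV. D k \<phi> x * Hc k i j x)))
    = (\<lambda>j. X j - \<alpha>' / 4 * (FF j - RR j))"
    by (intro ext) (simp add: einstein_lhs_def X_def FF_def RR_def)
  show ?thesis
    unfolding \<Psi>_def[symmetric] 3 G1_diff G1_scale 2 by (simp add: algebra_simps)
qed

lemma dilaton_equation_of_motion:
  assumes x: "x \<in> P" and einstein: "\<And>i j. einstein_lhs \<phi> \<alpha>' x i j = 0"
    and div: "\<And>j k. (\<Sum>i\<in>UNIV. T i i j k x) = 2 * (\<Sum>i\<in>UNIV. D i \<phi> x * Hc i j k x)"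
  shows "(\<Sum>i\<in>UNIV. hess M \<phi> a x i i) = 2 * (\<Sum>i\<in>UNIV. D i \<phi> x * D i \<phi> x)
    - (1/12) * (\<Sum>i\<in>UNIV. \<Sum>j\<in>UNIV. \<Sum>k\<in>UNIV. Hc i j k x * Hc i j k x)"
proof (rule dilaton_equation[OF sm_s sm_\<phi> s_nonzero parallel dilatino x div])
  \<comment> \<open>Both field equations make the left side of \<open>einstein_identity\<close>
    vanish, and \<open>\<alpha>' > 0\<close> allows division.\<close>
  have "(\<Sum>p\<in>UNIV. \<Sum>q\<in>UNIV. G1 (\<lambda>j. R_minus M H a x i j p q) (G2 (\<lambda>k l. R_minus M H a x k l p q) (s x))) = 0" for i
    using einstein_identity[OF x, of i] \<alpha>' unfolding einstein div by (simp add: G1_0)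
  then have R: "G2 (\<lambda>k l. R_minus M H a x k l p q) (s x) = 0" for p q
    by (rule instanton_condition[where R = "R_minus M H a x", OF R_comp_skew12[OF x]])
  show "G2 (\<lambda>k l. dH_comp M H a x i j k l) (s x) = 0" for i j
  proof -
    \<comment> \<open>In the indices \<open>k\<close> and \<open>l\<close> the plus curvature
      annihilates the spinor by integrability, and the minus curvature, with its index pairs
      exchanged, by the instanton condition.\<close>
    have "dH_comp M H a x i j k l = 2 * (R_comp M H 1 a x i j k l - R_minus M H a x k l i j)" for k l
      using R_plus_minus[OF x, of i j k l] by simp
    then show ?thesis
      by (simp only: G2_scale G2_diff R integrability[OF sm_s parallel x]) simp
  qed
qed

lemma
  assumes x: "x \<in> P" and H0: "\<And>y u v w. y \<in> P \<Longrightarrow> H a y u v w = 0"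
  shows torsion_free_dilaton: "D i \<phi> x = 0"
    and torsion_free_einstein: "einstein_lhs \<phi> \<alpha>' x i j = 0"
proof -
  have Hc: "Hc i j k x = 0" for i j k
    using H0[OF x] by (simp add: H_comp_def)
  note T = T_eq_0[OF H0 x]
  have "G1 (\<lambda>j. D j \<phi> x) (s x) = 0"
    unfolding dilatino[OF x] Hc G3_0 by simp
  then show "D i \<phi> x = 0"
    by (rule G1_eq_0D[OF _ s_nonzero[OF x]])
  have "dH_comp M H a x i j k l = 0" for i j k l
    by (simp add: dH_comp_eq[OF x] T)
  \<comment> \<open>Form indices of the minus curvature become endomorphism indices of the plus
    curvature, so integrability is already the instanton condition.\<close>
  then have "R_minus M H a x k l i j = R_comp M H 1 a x i j k l" for i j k l
    using R_plus_minus[OF x, of i j k l] by simp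
  then have "G2 (\<lambda>k l. R_minus M H a x k l i j) (s x) = 0" for i j
    by (simp only: integrability[OF sm_s parallel x])
  then have "G1 (\<lambda>j. einstein_lhs \<phi> \<alpha>' x i j) (s x) = 0"
    using einstein_identity[OF x, of i] by (simp add: T Hc G1_simps)
  then show "einstein_lhs \<phi> \<alpha>' x i j = 0"
    by (rule G1_eq_0D[OF _ s_nonzero[OF x]])
qed

end

end

section \<open>From charts to the compact manifold\<close>

lemma gauge_spinor_chartI:
  assumes "clifford_generators \<Gamma>" "riemannian_spin_manifold \<Gamma> M" "three_form M H" "bundle_with_connection M E"
  shows "gauge_spinor_chart M a H \<Gamma> E"
proof -
  have atlas: "smooth_atlas M" and met: "riemannian_metric M" and fr: "orthonormal_frames M"
    using assms(2) by (auto simp: riemannian_spin_manifold_def)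
  have hom: "homeomorphism (patch M a) (coord M a ` patch M a) (coord M a) (inv_into (patch M a) (coord M a))"
    and op: "open (coord M a ` patch M a)"
    using atlas by (auto simp: smooth_atlas_def)
  have inj: "inj_on (coord M a) (patch M a)"
    using hom by (intro inj_on_inverseI[of _ "inv_into (patch M a) (coord M a)"]) (simp add: homeomorphism_def)
  have g: "bilinear (gmet M a x)" "gmet M a x u v = gmet M a x v u" if "x \<in> patch M a" for x u v
    using met that unfolding riemannian_metric_def by blast+
  have sg: "smooth_in M a (patch M a) (\<lambda>x. gmet M a x u v)" for u v
    using met unfolding riemannian_metric_def by blast
  have f: "smooth_in M a (patch M a) (frame M a i)" for i
    using fr unfolding orthonormal_frames_def by blast
  have o: "gmet M a x (frame M a i x) (frame M a j x) = (if i = j then 1 else 0)"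
    if "x \<in> patch M a" for x i j
    using fr that unfolding orthonormal_frames_def by blast
  have H: "linear (\<lambda>u. H a x u v w)" "H a x v u w = - H a x u v w" "H a x u w v = - H a x u v w"
    if "x \<in> patch M a" for x u v w
    using assms(3) that unfolding three_form_def by blast+
  have sH: "smooth_in M a (patch M a) (\<lambda>x. H a x u v w)" for u v w
    using assms(3) unfolding three_form_def by blast
  have A: "linear (gauge_pot E a x)" if "x \<in> patch M a" for x
    using assms(4) that unfolding bundle_with_connection_def by blast
  have sA: "smooth_in M a (patch M a) (\<lambda>x. gauge_pot E a x u)" for u
    using assms(4) unfolding bundle_with_connection_def by blast
  show ?thesis
    by unfold_locales
       (rule op inj sg f sH sA assms(1) | erule g o H(2,3) linear_add[OF H(1)] linear_scale[OF H(1)]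
          linear_add[OF A] linear_scale[OF A])+
qed

lemma smooth_function_continuous:
  assumes atlas: "smooth_atlas M" and \<phi>: "smooth_function M \<phi>"
  shows "continuous_on UNIV \<phi>"
proof -
  have "continuous_on (patch M a) \<phi>" for a
  proof -
    have hom: "homeomorphism (patch M a) (coord M a ` patch M a) (coord M a) (inv_into (patch M a) (coord M a))"
      using atlas by (auto simp: smooth_atlas_def)
    have "Ck_on 0 (coord M a ` patch M a) (in_coord M a \<phi>)"
      using \<phi> unfolding smooth_function_def smooth_in_def smooth_on_def by blast
    then have "continuous_on (patch M a) (in_coord M a \<phi> \<circ> coord M a)"
      using hom by (intro continuous_on_compose) (auto simp: homeomorphism_def)
    moreover have "(in_coord M a \<phi> \<circ> coord M a) x = \<phi> x" if "x \<in> patch M a" for x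
      using hom that by (simp add: in_coord_def homeomorphism_def)
    ultimately show ?thesis
      by (simp cong: continuous_on_cong)
  qed
  moreover have "open (patch M a)" for a using atlas by (auto simp: smooth_atlas_def)
  ultimately have "continuous_on (\<Union>a\<in>UNIV. patch M a) \<phi>"
    by (intro continuous_on_open_UN) auto
  then show ?thesis using atlas by (simp add: smooth_atlas_def)
qed

text \<open>The set where the minimum is attained is nonempty by compactness, closed by continuity
  and open by the chart version.\<close>

theorem strong_minimum_principle:
  fixes M :: "('i, 'm::t2_space) spin_mfd"
  assumes "compact (UNIV :: 'm set)" "connected (UNIV :: 'm set)"
    and M: "smooth_atlas M" "\<And>a. riemannian_chart M a" and \<phi>: "smooth_function M \<phi>"
    and L: "\<And>a x. x \<in> patch M a \<Longrightarrow>
      (\<Sum>i\<in>UNIV. hess M \<phi> a x i i) \<le> 2 * (\<Sum>i\<in>UNIV. vd M a (frame M a i) \<phi> x * vd M a (frame M a i) \<phi> x)"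
  obtains m where "\<phi> = (\<lambda>_. m)"
proof -
  have cont: "continuous_on UNIV \<phi>" by (rule smooth_function_continuous[OF M(1) \<phi>])
  obtain x0 where x0: "\<And>x. \<phi> x0 \<le> \<phi> x"
    using continuous_attains_inf[OF assms(1) _ cont] by auto
  define Z where "Z = {x. \<phi> x = \<phi> x0}"
  have cl: "closed Z"
    unfolding Z_def using continuous_closed_preimage_constant[OF cont closed_UNIV, of "\<phi> x0"] by simp
  have op: "open Z"
  proof (subst open_subopen, intro ballI)
    fix x assume "x \<in> Z"
    then have x: "\<phi> x = \<phi> x0" by (simp add: Z_def)
    obtain a where a: "x \<in> patch M a"
      using M(1) unfolding smooth_atlas_def by (metis UNIV_I UN_E)
    interpret riemannian_chart M a by (rule M(2))
    have "smooth_in M a (patch M a) \<phi>" using \<phi> by (simp add: smooth_function_def)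
    then obtain r where r: "r > 0" "\<And>y. y \<in> P \<Longrightarrow> coord M a y \<in> ball (coord M a x) r \<Longrightarrow> \<phi> y = \<phi> x0"
      using strong_minimum_principle_chart[of \<phi> "\<phi> x0" x] x0 L a x by blast
    have "continuous_on P (coord M a)" "open P"
      using M(1) by (auto simp: smooth_atlas_def homeomorphism_def)
    then have "open (P \<inter> coord M a -` ball (coord M a x) r)"
      by (intro continuous_open_preimage) auto
    moreover have "x \<in> P \<inter> coord M a -` ball (coord M a x) r" using a r(1) by simp
    moreover have "P \<inter> coord M a -` ball (coord M a x) r \<subseteq> Z" using r(2) by (auto simp: Z_def)
    ultimately show "\<exists>T. open T \<and> x \<in> T \<and> T \<subseteq> Z" by blast
  qed
  have "openin (top_of_set UNIV) Z" "closedin (top_of_set UNIV) Z"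
    using op cl by (simp_all add: open_openin[symmetric] closed_closedin[symmetric])
  then have "Z = {} \<or> Z = UNIV"
    using iffD1[OF connected_clopen assms(2)] by blast
  moreover have "x0 \<in> Z" by (simp add: Z_def)
  ultimately have "Z = UNIV" by blast
  then show thesis using that[of "\<phi> x0"] by (auto simp: Z_def fun_eq_iff)
qed

theorem corollary1p2:
  fixes \<alpha>' :: real
    and \<Gamma> :: "6 \<Rightarrow> complex^8^8"
    and M :: "('i, 'm::t2_space) spin_mfd"
    and H :: "('i, 'm) form3"
    and \<phi> :: "'m \<Rightarrow> real"
    and \<epsilon> :: "'i \<Rightarrow> 'm \<Rightarrow> complex^8"
    and E :: "('i, 'm, 'r::finite) metric_bundle"
  assumes "\<alpha>' > 0"
    and "compact (UNIV :: 'm set)"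
    and "connected (UNIV :: 'm set)"
    and "clifford_generators \<Gamma>"
    and "riemannian_spin_manifold \<Gamma> M"
    and "three_form M H"
    and "smooth_function M \<phi>"
    and "spinor_field M \<epsilon>"
    and "chiral \<Gamma> M \<epsilon>"
    and "nowhere_vanishing M \<epsilon>"
    and "bundle_with_connection M E"
    and "parallel_spinor \<Gamma> M H 1 \<epsilon>"
    and "dilatino_eq \<Gamma> M H \<phi> \<epsilon>"
    and "gaugino_eq \<Gamma> M E \<epsilon>"
    and "anomaly_cancellation \<alpha>' M H E"
  shows "(einstein_eq \<alpha>' M H \<phi> E \<and> H_field_eq M H \<phi> \<and> gauge_field_eq M H \<phi> E \<longleftrightarrow> H_vanishes M H) \<and>
         (H_vanishes M H \<longleftrightarrow> parallel_spinor \<Gamma> M H 0 \<epsilon>)"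
proof -
  have chart: "gauge_spinor_chart M a H \<Gamma> E" for a
    by (rule gauge_spinor_chartI[OF assms(4,5,6,11)])
  have riem: "riemannian_chart M a" for a
  proof -
    interpret gauge_spinor_chart M a H \<Gamma> E by (rule chart)
    show ?thesis by unfold_locales
  qed
  have \<phi>: "smooth_in M a (patch M a) \<phi>" and \<epsilon>: "smooth_in M a (patch M a) (\<epsilon> a)" for a
    using assms(7,8) by (auto simp: smooth_function_def spinor_field_def)
  have nz: "\<epsilon> a x \<noteq> 0" if "x \<in> patch M a" for a x
    using assms(10) that by (simp add: nowhere_vanishing_def)
  have anomaly: "dH_comp M H a x i j k l =
      \<alpha>' / 4 * (Tr_wedge (R_minus M H a x) i j k l - Tr_wedge (F_comp M E a x) i j k l)"
    if "x \<in> patch M a" for a x i j k l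
    using assms(15) that by (simp add: anomaly_cancellation_def)
  \<comment> \<open>The supersymmetry equations are restated as Clifford contractions in every
    chart, the form in which the chart results take them.\<close>
  have par: "vd M a (frame M a i) (\<epsilon> a) x = (1/4) *\<^sub>R
      clifford_module.G2 (\<lambda>i. (*v) (\<Gamma> i)) (\<lambda>j k. torsion_chart.Wc M a H 1 i j k x) (\<epsilon> a x)"
    if x: "x \<in> patch M a" for a x i
  proof -
    interpret gauge_spinor_chart M a H \<Gamma> E by (rule chart)
    have "nabla_spin \<Gamma> M H 1 a (e i) \<epsilon> x = 0"
      using assms(12) x by (simp add: parallel_spinor_def)
    then show ?thesis by (simp add: nabla_spin_frame[OF x])
  qed
  have dil: "clifford_module.G1 (\<lambda>i. (*v) (\<Gamma> i)) (\<lambda>j. vd M a (frame M a j) \<phi> x) (\<epsilon> a x)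
      = (1/12) *\<^sub>R clifford_module.G3 (\<lambda>i. (*v) (\<Gamma> i)) (\<lambda>j k l. H_comp M H a x j k l) (\<epsilon> a x)"
    if x: "x \<in> patch M a" for a x
  proof -
    interpret gauge_spinor_chart M a H \<Gamma> E by (rule chart)
    have "(\<Sum>m\<in>UNIV. \<Sum>n\<in>UNIV. \<Sum>p\<in>UNIV. H_comp M H a x m n p *\<^sub>R ((\<Gamma> m ** \<Gamma> n ** \<Gamma> p) *v \<epsilon> a x))
      = G3 (\<lambda>j k l. Hc j k l x) (\<epsilon> a x)"
      by (simp add: G3_def G2_def G1_def \<gamma>_sum \<gamma>_simps matrix_vector_mul_assoc matrix_mul_assoc)
    then show ?thesis
      using assms(13) x by (simp add: dilatino_eq_def G1_def)
  qed
  have gaug: "clifford_module.G2 (\<lambda>i. (*v) (\<Gamma> i)) (\<lambda>m n. F_comp M E a x m n p q) (\<epsilon> a x) = 0"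
    if x: "x \<in> patch M a" for a x p q
  proof -
    interpret gauge_spinor_chart M a H \<Gamma> E by (rule chart)
    have "(\<Sum>m\<in>UNIV. \<Sum>n\<in>UNIV. F_comp M E a x m n p q *\<^sub>R ((\<Gamma> m ** \<Gamma> n) *v \<epsilon> a x)) = 0"
      using assms(14) x by (simp add: gaugino_eq_def)
    then show ?thesis
      by (simp add: G2_def G1_def \<gamma>_sum \<gamma>_simps matrix_vector_mul_assoc)
  qed
  have forward: "H_vanishes M H" if ein: "einstein_eq \<alpha>' M H \<phi> E" and Hf: "H_field_eq M H \<phi>"
  proof -
    have eq: "(\<Sum>i\<in>UNIV. hess M \<phi> a x i i)
      = 2 * (\<Sum>i\<in>UNIV. vd M a (frame M a i) \<phi> x * vd M a (frame M a i) \<phi> x)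
        - (1/12) * (\<Sum>i\<in>UNIV. \<Sum>j\<in>UNIV. \<Sum>k\<in>UNIV. H_comp M H a x i j k * H_comp M H a x i j k)"
      if x: "x \<in> patch M a" for a x
    proof -
      interpret gauge_spinor_chart M a H \<Gamma> E by (rule chart)
      have div: "(\<Sum>i\<in>UNIV. T i i j k x) = 2 * (\<Sum>i\<in>UNIV. D i \<phi> x * Hc i j k x)" for j k
        using Hf x divergence_H[OF \<phi> x, of j k] by (simp add: H_field_eq_def)
      show ?thesis
        by (rule dilaton_equation_of_motion[OF \<epsilon> \<phi> nz par dil gaug anomaly assms(1) x _ div])
           (use ein x in \<open>auto simp: einstein_eq_def einstein_lhs_def\<close>)
    qed
    \<comment> \<open>The term in \<open>H\<close> is a sum of squares with a negative coefficient,
      so the dilaton satisfies the inequality of the minimum principle.\<close>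
    obtain m where m: "\<phi> = (\<lambda>_. m)"
    proof (rule strong_minimum_principle[OF assms(2,3) _ riem assms(7)])
      show "smooth_atlas M" using assms(5) by (simp add: riemannian_spin_manifold_def)
      show "(\<Sum>i\<in>UNIV. hess M \<phi> a x i i) \<le> 2 * (\<Sum>i\<in>UNIV. vd M a (frame M a i) \<phi> x * vd M a (frame M a i) \<phi> x)"
        if "x \<in> patch M a" for a x
        unfolding eq[OF that] by (simp add: sum_nonneg)
    qed blast
    have "H_comp M H a x i j k = 0" if x: "x \<in> patch M a" for a x i j k
    proof -
      interpret gauge_spinor_chart M a H \<Gamma> E by (rule chart)
      \<comment> \<open>For a constant dilaton the Hessian and the gradient vanish, and the dilaton
        equation leaves a vanishing sum of squares.\<close>
      have "(\<Sum>i\<in>UNIV. \<Sum>j\<in>UNIV. \<Sum>k\<in>UNIV. Hc i j k x * Hc i j k x) = 0"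
      proof -
        have "vd M a X (\<lambda>_. m) = (\<lambda>_. 0)" for X
          by (intro ext) simp
        then show ?thesis using eq[OF x] by (simp add: m hess_def)
      qed
      then show ?thesis
        by (simp add: sum_nonneg_eq_0_iff sum_nonneg)
    qed
    then show ?thesis
      unfolding H_vanishes_def
    proof (intro allI ballI)
      fix a x u v w assume H: "\<And>x a i j k. x \<in> patch M a \<Longrightarrow> H_comp M H a x i j k = 0" and x: "x \<in> patch M a"
      interpret gauge_spinor_chart M a H \<Gamma> E by (rule chart)
      show "H a x u v w = 0" using H_eq_0_iff[OF x] H[OF x] by blast
    qed
  qed
  have backward: "einstein_eq \<alpha>' M H \<phi> E \<and> H_field_eq M H \<phi> \<and> gauge_field_eq M H \<phi> E"
    if H0: "H_vanishes M H"
  proof -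
    have H0: "H a x u v w = 0" if "x \<in> patch M a" for a x u v w
      using H0 that by (simp add: H_vanishes_def)
    have "einstein_eq \<alpha>' M H \<phi> E"
      unfolding einstein_eq_def
    proof (intro allI ballI)
      fix a x i j assume x: "x \<in> patch M a"
      interpret gauge_spinor_chart M a H \<Gamma> E by (rule chart)
      have "einstein_lhs \<phi> \<alpha>' x i j = 0"
        by (rule torsion_free_einstein[OF \<epsilon> \<phi> nz par dil gaug anomaly assms(1) x H0])
      then show "Ric_g M a x i j
        - 1/4 * (\<Sum>m\<in>UNIV. \<Sum>n\<in>UNIV. H_comp M H a x i m n * H_comp M H a x j m n)
        + 2 * hess M \<phi> a x i j
        - \<alpha>' / 4 *
          ((\<Sum>m\<in>UNIV. \<Sum>n\<in>UNIV. \<Sum>s\<in>UNIV. F_comp M E a x i m n s * F_comp M E a x j m n s)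
           - (\<Sum>m\<in>UNIV. \<Sum>n\<in>UNIV. \<Sum>s\<in>UNIV. R_minus M H a x i m n s * R_minus M H a x j m n s))
        = 0"
        unfolding einstein_lhs_def .
    qed
    moreover have "H_field_eq M H \<phi>"
      unfolding H_field_eq_def
    proof (intro allI ballI)
      fix a x j k assume x: "x \<in> patch M a"
      interpret gauge_spinor_chart M a H \<Gamma> E by (rule chart)
      show "(\<Sum>i\<in>UNIV. nabla_g_form3 M (\<lambda>b y u v w. exp (- 2 * \<phi> y) * H b y u v w) a
           (e i) (e i) (e j) (e k) x) = 0"
        unfolding divergence_H[OF \<phi> x] using T_eq_0[OF _ x] H0 x by (simp add: H_comp_def)
    qed
    moreover have "gauge_field_eq M H \<phi> E"
      unfolding gauge_field_eq_def
    proof (intro allI ballI)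
      fix a x j assume x: "x \<in> patch M a"
      interpret gauge_spinor_chart M a H \<Gamma> E by (rule chart)
      \<comment> \<open>The exponential weight enters the divergence only through an overall factor
        and the gradient of \<open>\<phi>\<close>.\<close>
      have v: "D i \<phi> x = 0" for i
        by (rule torsion_free_dilaton[OF \<epsilon> \<phi> nz par dil gaug anomaly assms(1) x H0])
      have div: "(\<Sum>k\<in>UNIV. nabla_plus_A M H E (gauge_curv M E) a (e k) (e k) (e j) x) = 0"
        by (rule gauge_divergence_free[OF \<epsilon> nz par gaug x H0[OF x]])
      show "(\<Sum>i\<in>UNIV. nabla_plus_A M H E (\<lambda>b y u v. exp (- 2 * \<phi> y) *\<^sub>R gauge_curv M E b y u v) a
           (e i) (e i) (e j) x) = 0"
        unfolding divergence_F[OF \<phi> x] v using div by (simp add: scaleR_sum_right[symmetric])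
    qed
    ultimately show ?thesis by blast
  qed
  have "H_vanishes M H \<longleftrightarrow> parallel_spinor \<Gamma> M H 0 \<epsilon>"
  proof -
    have "(\<forall>u v w. H a x u v w = 0) \<longleftrightarrow> (\<forall>i. nabla_spin \<Gamma> M H 0 a (frame M a i) \<epsilon> x = 0)"
      if x: "x \<in> patch M a" for a x
    proof -
      interpret gauge_spinor_chart M a H \<Gamma> E by (rule chart)
      \<comment> \<open>The two spin connections differ by torsion alone: \<open>1/4\<close> from
        the spin representation times \<open>1/2\<close> from the definition of
        \<open>nabla\<close>.\<close>
      have n: "nabla_spin \<Gamma> M H 0 a (e i) \<epsilon> x = (1/8) *\<^sub>R G2 (\<lambda>j k. Hc i j k x) (\<epsilon> a x)" for i
        unfolding nabla_spin_frame[OF x] par[OF x] Wc_def G2_add G2_scale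
        by (simp add: algebra_simps)
      have "(\<forall>i j k. Hc i j k x = 0) \<longleftrightarrow> (\<forall>i. G2 (\<lambda>j k. Hc i j k x) (\<epsilon> a x) = 0)"
      proof
        assume "\<forall>i j k. Hc i j k x = 0"
        then have "(\<lambda>j k. Hc i j k x) = (\<lambda>j k. 0)" for i by blast
        then show "\<forall>i. G2 (\<lambda>j k. Hc i j k x) (\<epsilon> a x) = 0" by (simp only: G2_0) simp
      next
        assume G: "\<forall>i. G2 (\<lambda>j k. Hc i j k x) (\<epsilon> a x) = 0"
        show "\<forall>i j k. Hc i j k x = 0"
          by (intro allI norm_H_eq_0[OF Hc_skew12[OF x] Hc_skew23[OF x] G[rule_format] nz[OF x]])
      qed
      then show ?thesis
        unfolding H_eq_0_iff[OF x] n by simp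
    qed
    then show ?thesis
      unfolding H_vanishes_def parallel_spinor_def by blast
  qed
  then show ?thesis using forward backward by blast
qed

end
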